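(* Let $\epsilon>0$. Then there exists a triplet $(m_\epsilon,u_\epsilon,h_\epsilon)\in\mathcal{X}^+$ such that \[ \left\langle A_\epsilon(m_\epsilon,u_\epsilon,h_\epsilon),\,(\mu-m_\epsilon,\,v-u_\epsilon,\,k-h_\epsilon)\right\rangle\ge 0\qquad\text{for all }(\mu,v,k)\in\mathcal{X}^+ . \]
   Context: Setting. $\Omega\subset\mathbb{R}^d$ is open, bounded, connected, with $C^1$ boundary $\Gamma=\partial\Omega$; $ds$ denotes the surface measure $d\mathcal{H}^{d-1}$. $\Gamma=\overline{\Gamma_D\cup\Gamma_N}$, where $\Gamma_D,\Gamma_N$ are disjoint, nonempty, relatively open $C^1$ $(d-1)$-dimensional manifolds of positive $\mathcal{H}^{d-1}$-measure with $\mathcal{H}^{d-1}(\partial\Gamma_D\cap\partial\Gamma_N)=0$. Boundary values of Sobolev functions are traces. Exponents: $\alpha>1$, $\beta>0$, $\gamma=\frac{\beta+1}{\beta}\alpha$, $\gamma'=\gamma/(\gamma-1)$. Data: $j\in L^{\gamma'}(\Gamma_N)$, $j\ge0$, $j\not\equiv0$. $g:[0,\infty)\to\mathbb{R}$ is continuous and strictly increasing, and there is $C>1$ with $C^{-1}m^\beta-C\le g(m)\le Cm^\beta+C$ for all $m\ge0$. $H:\overline\Omega\times\mathbb{R}^d\to\mathbb{R}$ is measurable in $x$, and for a.e. $x$, $H(x,\cdot)\in C^1(\mathbb{R}^d)$ is convex; there is $C>1$ such that for a.e. $x\in\Omega$ and all $p\in\mathbb{R}^d$: $|D_pH(x,p)|\le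 C|p|^{\alpha-1}+C$, $H(x,0)\le C$, and one of the following holds: (a) $H(x,p)\ge C^{-1}|p|^\alpha-C$; (b) $D_pH(x,p)\cdot p\ge C^{-1}|p|^\alpha-C$ and $H(x,p)\ge -C$; (c) $-H(x,p)+D_pH(x,p)\cdot p\ge C^{-1}|p|^\alpha-C$ and $H(x,p)\ge-C$. Spaces. $\mathcal{X}=L^{\beta+1}(\Omega)\times W^{1,\gamma}(\Omega)\times L^{\gamma'}(\Gamma_D)$ and $\mathcal{X}^+=\{(m,u,h)\in\mathcal{X}: m\ge0\text{ a.e. in }\Omega,\ h\ge0\text{ a.e. on }\Gamma_D\}$. Operator. For $\epsilon>0$, $(m,u,h)\in\mathcal{X}^+$ and $(\mu,v,k)\in\mathcal{X}$, \[\langle A_\epsilon(m,u,h),(\mu,v,k)\rangle=\int_\Omega(-H(x,Du)+g(m))\mu\,dx+\int_\Omega mD_pH(x,Du)\cdot Dv\,dx-\int_{\Gamma_N}jv\,ds+\int_{\Gamma_D}hv\,ds+\int_{\Gamma_D}(-u+\epsilon^{\gamma'}h^{\gamma'-1})k\,ds.\] *)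

theory Defs
  imports "HOL-Analysis.Analysis"
begin

primrec dderiv :: "'a::euclidean_space list \<Rightarrow> ('a \<Rightarrow> real) \<Rightarrow> 'a \<Rightarrow> real" where
  "dderiv [] f = f"
| "dderiv (v # vs) f = (\<lambda>x. frechet_derivative (dderiv vs f) (at x) v)"

definition smooth_fn :: "('a::euclidean_space \<Rightarrow> real) \<Rightarrow> bool" where
  "smooth_fn f \<longleftrightarrow> (\<forall>vs x. dderiv vs f differentiable (at x))"

definition tsupp :: "('a::euclidean_space \<Rightarrow> real) \<Rightarrow> 'a set" where
  "tsupp f = closure {x. f x \<noteq> 0}"

definition test_fn :: "'a::euclidean_space set \<Rightarrow> ('a \<Rightarrow> real) \<Rightarrow> bool" where
  "test_fn S f \<longleftrightarrow> smooth_fn f \<and> compact (tsupp f) \<and> tsupp f \<subseteq> S"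

definition grad :: "('a::euclidean_space \<Rightarrow> real) \<Rightarrow> 'a \<Rightarrow> 'a" where
  "grad f x = (\<Sum>b\<in>Basis. frechet_derivative f (at x) b *\<^sub>R b)"

definition Lp_mem :: "'b measure \<Rightarrow> real \<Rightarrow> ('b \<Rightarrow> 'c::{real_normed_vector,second_countable_topology}) \<Rightarrow> bool" where
  "Lp_mem M p f \<longleftrightarrow> f \<in> borel_measurable M \<and> integrable M (\<lambda>x. norm (f x) powr p)"

definition weak_grad :: "'a::euclidean_space set \<Rightarrow> ('a \<Rightarrow> real) \<Rightarrow> ('a \<Rightarrow> 'a) \<Rightarrow> bool" where
  "weak_grad \<Omega> u Du \<longleftrightarrow>
     (\<forall>\<phi>. test_fn \<Omega> \<phi> \<longrightarrow> (\<forall>b\<in>Basis.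
        (\<integral>x. u x * frechet_derivative \<phi> (at x) b \<partial>lebesgue_on \<Omega>)
          = - (\<integral>x. (Du x \<bullet> b) * \<phi> x \<partial>lebesgue_on \<Omega>)))"

definition W1p :: "'a::euclidean_space set \<Rightarrow> real \<Rightarrow> ('a \<Rightarrow> real) \<Rightarrow> ('a \<Rightarrow> 'a) \<Rightarrow> bool" where
  "W1p \<Omega> p u Du \<longleftrightarrow> Lp_mem (lebesgue_on \<Omega>) p u \<and> Lp_mem (lebesgue_on \<Omega>) p Du \<and> weak_grad \<Omega> u Du"

definition haus_coef :: "nat \<Rightarrow> real" where
  "haus_coef s = pi powr (real s / 2) / Gamma (real s / 2 + 1)"

definition haus_outer :: "nat \<Rightarrow> 'a::euclidean_space set \<Rightarrow> ennreal" where
  "haus_outer s A =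
     (SUP \<delta>\<in>{0<..}. INF C\<in>{C :: nat \<Rightarrow> 'a set. A \<subseteq> (\<Union>n. C n) \<and> (\<forall>n. bounded (C n) \<and> diameter (C n) \<le> \<delta>)}.
        (\<Sum>n. ennreal (haus_coef s * (if C n = {} then 0 else (diameter (C n) / 2) ^ s))))"

definition hausdorff_measure :: "nat \<Rightarrow> 'a::euclidean_space measure" where
  "hausdorff_measure s = measure_of UNIV (sets borel) (haus_outer s)"

definition surf :: "'a::euclidean_space set \<Rightarrow> 'a measure" where
  "surf S = restrict_space (hausdorff_measure (DIM('a) - 1)) S"

definition has_trace :: "'a::euclidean_space set \<Rightarrow> real \<Rightarrow> ('a \<Rightarrow> real) \<Rightarrow> ('a \<Rightarrow> 'a) \<Rightarrow> ('a \<Rightarrow> real) \<Rightarrow> bool" where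
  "has_trace \<Omega> p u Du t \<longleftrightarrow>
     t \<in> borel_measurable (surf (frontier \<Omega>)) \<and>
     (\<exists>\<phi> :: nat \<Rightarrow> 'a \<Rightarrow> real.
        (\<forall>n. test_fn UNIV (\<phi> n)) \<and>
        (\<lambda>n. \<integral>\<^sup>+x. ennreal (\<bar>\<phi> n x - u x\<bar> powr p) \<partial>lebesgue_on \<Omega>) \<longlonglongrightarrow> 0 \<and>
        (\<lambda>n. \<integral>\<^sup>+x. ennreal (norm (grad (\<phi> n) x - Du x) powr p) \<partial>lebesgue_on \<Omega>) \<longlonglongrightarrow> 0 \<and>
        (\<lambda>n. \<integral>\<^sup>+x. ennreal (\<bar>\<phi> n x - t x\<bar> powr p) \<partial>surf (frontier \<Omega>)) \<longlonglongrightarrow> 0)"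

definition C1_fn :: "('a::euclidean_space \<Rightarrow> real) \<Rightarrow> bool" where
  "C1_fn \<psi> \<longleftrightarrow> (\<exists>G. (\<forall>y. (\<psi> has_derivative (\<lambda>q. G y \<bullet> q)) (at y)) \<and> continuous_on UNIV G)"

text \<open>Omega has C^1 boundary: locally Omega is the subgraph of a C^1 function
  over the hyperplane orthogonal to a unit vector n.\<close>
definition C1_boundary :: "'a::euclidean_space set \<Rightarrow> bool" where
  "C1_boundary \<Omega> \<longleftrightarrow>
     (\<forall>x0\<in>frontier \<Omega>. \<exists>r>0. \<exists>n \<psi>. norm n = 1 \<and> C1_fn \<psi> \<and>
        \<Omega> \<inter> ball x0 r = {x\<in>ball x0 r. (x - x0) \<bullet> n < \<psi> ((x - x0) - ((x - x0) \<bullet> n) *\<^sub>R n)})"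

definition Xplus :: "'a::euclidean_space set \<Rightarrow> 'a set \<Rightarrow> real \<Rightarrow> real \<Rightarrow>
    ('a \<Rightarrow> real) \<Rightarrow> ('a \<Rightarrow> real) \<Rightarrow> ('a \<Rightarrow> 'a) \<Rightarrow> ('a \<Rightarrow> real) \<Rightarrow> ('a \<Rightarrow> real) \<Rightarrow> bool" where
  "Xplus \<Omega> \<Gamma>D \<beta> \<alpha> m u Du tu h \<longleftrightarrow>
     (let \<gamma> = (\<beta> + 1) / \<beta> * \<alpha>; \<gamma>' = \<gamma> / (\<gamma> - 1) in
       Lp_mem (lebesgue_on \<Omega>) (\<beta> + 1) m \<and> (AE x in lebesgue_on \<Omega>. m x \<ge> 0) \<and>
       W1p \<Omega> \<gamma> u Du \<and> has_trace \<Omega> \<gamma> u Du tu \<and>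
       Lp_mem (surf \<Gamma>D) \<gamma>' h \<and> (AE x in surf \<Gamma>D. h x \<ge> 0))"

text \<open>The pairing <A_eps(m,u,h),(mu,v,k)>, with gradients Du, Dv and traces tu, tv.\<close>
definition A_pair :: "'a::euclidean_space set \<Rightarrow> 'a set \<Rightarrow> 'a set \<Rightarrow> real \<Rightarrow> real \<Rightarrow>
    ('a \<Rightarrow> 'a \<Rightarrow> real) \<Rightarrow> ('a \<Rightarrow> 'a \<Rightarrow> 'a) \<Rightarrow> (real \<Rightarrow> real) \<Rightarrow> ('a \<Rightarrow> real) \<Rightarrow> real \<Rightarrow>
    ('a \<Rightarrow> real) \<Rightarrow> ('a \<Rightarrow> 'a) \<Rightarrow> ('a \<Rightarrow> real) \<Rightarrow> ('a \<Rightarrow> real) \<Rightarrow>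
    ('a \<Rightarrow> real) \<Rightarrow> ('a \<Rightarrow> 'a) \<Rightarrow> ('a \<Rightarrow> real) \<Rightarrow> ('a \<Rightarrow> real) \<Rightarrow> real" where
  "A_pair \<Omega> \<Gamma>D \<Gamma>N \<beta> \<alpha> H DpH g j \<epsilon> m Du tu h \<mu> Dv tv k =
     (let \<gamma> = (\<beta> + 1) / \<beta> * \<alpha>; \<gamma>' = \<gamma> / (\<gamma> - 1) in
       (\<integral>x. (- H x (Du x) + g (m x)) * \<mu> x \<partial>lebesgue_on \<Omega>)
     + (\<integral>x. m x * (DpH x (Du x) \<bullet> Dv x) \<partial>lebesgue_on \<Omega>)
     - (\<integral>x. j x * tv x \<partial>surf \<Gamma>N)
     + (\<integral>x. h x * tv x \<partial>surf \<Gamma>D)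
     + (\<integral>x. (- tu x + \<epsilon> powr \<gamma>' * h x powr (\<gamma>' - 1)) * k x \<partial>surf \<Gamma>D))"

end

theory Submission
  imports Defs
begin

text \<open>The operator is the derivative of a convex-concave functional. Eliminating \<open>m\<close> and \<open>h\<close> by
  \<open>m = g\<^sup>-\<^sup>1(max (H(x, Du)) (g 0))\<close> and \<open>\<epsilon>\<^sup>\<gamma>\<^sup>' h\<^sup>\<gamma>\<^sup>'\<^sup>-\<^sup>1 = u\<^sup>+\<close> turns the variational inequality into the
  Euler-Lagrange equation of the convex functional
  \<open>J(u) = \<integral>\<^sub>\<Omega> E(H(x, Du)) - \<integral> j u + c \<integral> (u\<^sup>+)\<^sup>\<gamma> / \<gamma>\<close> (boundary integrals over \<open>\<Gamma>\<^sub>N\<close> and \<open>\<Gamma>\<^sub>D\<close>),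
  where \<open>E\<close> is the antiderivative of the truncated inverse of \<open>g\<close>.
  Coercivity rests on a Poincare-trace inequality: oscillations of a \<open>C\<^sup>1\<close> function are transported
  along segments inside \<open>\<Omega>\<close>, near the boundary in the direction of the local graph, where the image of
  \<open>surface measure \<times> dt\<close> is dominated by Lebesgue measure. Weak compactness is avoided: among almost
  minimisers of \<open>J\<close> those of almost minimal norm form a Cauchy sequence by uniform convexity.\<close>

section \<open>Oscillation along segments\<close>

text \<open>By \<open>has_trace\<close>, an admissible (u, Du, tu) is a limit of test functions on
  the whole space in three L^\<gamma> norms at once. So J is minimised over test functions, and a
  sequence that is Cauchy in all three norms produces function, weak gradient and trace together;
  the Euler-Lagrange equation for test functions passes to every admissible v by the same
  approximation. The truncation at g(0) encodes the constraint m >= 0: where H(x, Du) < g(0) the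
  density is 0 and -H + g(0) is positive, which is the complementarity behind the inequality; the
  positive part of u does the same for h. E is convex and nondecreasing, so its composition with
  H(x, .) stays convex, with growth exponent \<alpha>/\<beta> + \<alpha> = \<gamma>. The
  Poincare-trace inequality controls u only up to a constant a. Two different terms hold this
  constant: the strictly positive total flux of j when a tends to -infinity, and the penalty on
  \<Gamma>_D, which grows like a^\<gamma> and beats the linear flux term, when a tends to
  +infinity.\<close>

lemma powr_tangent:
  fixes a h p :: real
  assumes "p > 1" "a \<ge> 0" "h \<ge> 0"
  shows "a powr p + p * a powr (p - 1) * (h - a) \<le> h powr p"
proof -
  \<comment> \<open>Young's inequality with exponents p and p/(p-1) is the tangent inequality
    divided by p; it covers a = 0 as well.\<close>
  have "h * a powr (p - 1) \<le> h powr p / p + (a powr (p - 1)) powr (p / (p - 1)) / (p / (p - 1))"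
    using assms by (intro Youngs_inequality) (auto simp: field_simps)
  also have "(a powr (p - 1)) powr (p / (p - 1)) = a powr p"
    using assms by (simp add: powr_powr)
  finally have "p * (h * a powr (p - 1)) \<le> p * (h powr p / p + a powr p / (p / (p - 1)))"
    using assms by simp
  also have "\<dots> = h powr p + (p - 1) * a powr p"
    using assms by (simp add: field_simps)
  finally have "p * (h * a powr (p - 1)) \<le> h powr p + (p - 1) * a powr p" .
  moreover have "a powr (p - 1) * a = a powr p"
    using assms powr_mult_base[of a "p - 1"] by (simp add: mult.commute)
  ultimately show ?thesis by (simp add: algebra_simps)
qed

lemma powr_add_le:
  fixes a b p :: real
  assumes "p > 0" "a \<ge> 0" "b \<ge> 0"
  shows "(a + b) powr p \<le> 2 powr p * (a powr p + b powr p)"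
proof -
  have "(a + b) powr p \<le> (2 * max a b) powr p"
    using assms by (intro powr_mono2) auto
  also have "\<dots> = 2 powr p * (max a b) powr p"
    using assms by (simp add: powr_mult)
  also have "(max a b) powr p \<le> a powr p + b powr p"
    by (auto simp: max_def)
  finally show ?thesis by simp
qed

text \<open>The gradient is carried as an explicit function, and one continuous derivative is all
  that is asked, so that a product of two test functions qualifies directly.\<close>

definition C1_grad :: "('a::euclidean_space \<Rightarrow> real) \<Rightarrow> ('a \<Rightarrow> 'a) \<Rightarrow> bool" where
  "C1_grad f Df \<longleftrightarrow> (\<forall>x. (f has_derivative (\<lambda>h. Df x \<bullet> h)) (at x)) \<and> continuous_on UNIV Df"

lemma C1_gradD:
  assumes "C1_grad f Df"
  shows "continuous_on UNIV f" "continuous_on UNIV Df"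
        "f \<in> borel_measurable borel" "Df \<in> borel_measurable borel"
proof -
  show "continuous_on UNIV f"
    using assms by (auto simp: C1_grad_def continuous_on_eq_continuous_at intro!: has_derivative_continuous)
  then show "f \<in> borel_measurable borel" by (rule borel_measurable_continuous_onI)
  show "continuous_on UNIV Df" using assms by (simp add: C1_grad_def)
  then show "Df \<in> borel_measurable borel" by (rule borel_measurable_continuous_onI)
qed

text \<open>Difference quotients along a fixed sequence of steps, because dominated convergence and
  measurability of limits are statements about sequences.\<close>

lemma directional_derivative_LIMSEQ:
  fixes f :: "'a::euclidean_space \<Rightarrow> real"
  assumes "(f has_derivative (\<lambda>h. D \<bullet> h)) (at x)"
  shows "(\<lambda>n. (f ((1 / real (Suc n)) *\<^sub>R b + x) - f x) / (1 / real (Suc n))) \<longlonglongrightarrow> D \<bullet> b"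
proof -
  have d: "((\<lambda>r. f (r *\<^sub>R b + x)) has_real_derivative D \<bullet> b) (at 0)"
  proof -
    have "(f has_derivative (\<lambda>h. D \<bullet> h)) (at (0 *\<^sub>R b + x))" using assms by simp
    then have "((\<lambda>r. f (r *\<^sub>R b + x)) has_derivative (\<lambda>u. D \<bullet> (u *\<^sub>R b + 0))) (at 0)"
      by (intro has_derivative_compose[where g = f and f = "\<lambda>r. r *\<^sub>R b + x"]) (auto intro!: derivative_eq_intros)
    then show ?thesis by (simp add: has_field_derivative_def mult.commute[of _ "D \<bullet> b"])
  qed
  have "(\<lambda>n. 1 / real (Suc n)) \<longlonglongrightarrow> 0" using LIMSEQ_inverse_real_of_nat by (simp add: inverse_eq_divide)
  then have "filterlim (\<lambda>n. 1 / real (Suc n)) (at 0) sequentially" by (simp add: filterlim_at)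
  from filterlim_compose[OF d[unfolded DERIV_def] this] show ?thesis by simp
qed

text \<open>Jensen's inequality: integrate the tangent of the power at the mean value a = s/t, where
  the linear term has integral zero.\<close>

lemma integral_powr_le:
  fixes h :: "real \<Rightarrow> real"
  assumes p: "p > 1" and t: "t > 0" and h: "continuous_on {0..t} h" "\<And>r. r \<in> {0..t} \<Longrightarrow> h r \<ge> 0"
  shows "(integral {0..t} h) powr p \<le> t powr (p - 1) * integral {0..t} (\<lambda>r. h r powr p)"
proof -
  define s where "s = integral {0..t} h"
  define a where "a = s / t"
  have ih: "h integrable_on {0..t}" using h by (intro integrable_continuous_real)
  have ihp: "(\<lambda>r. h r powr p) integrable_on {0..t}"
    using h p by (intro integrable_continuous_real continuous_on_powr' continuous_intros) auto
  have s0: "s \<ge> 0" unfolding s_def using h by (intro integral_nonneg ih) auto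
  then have a0: "a \<ge> 0" using t by (simp add: a_def)
  have const: "((\<lambda>r. c) has_integral c * t) {0..t}" for c :: real
    using has_integral_const_real[of c 0 t] t by (simp add: mult.commute)
  have "((\<lambda>r. a powr p + p * a powr (p - 1) * (h r - a)) has_integral
      (a powr p * t + p * a powr (p - 1) * (s - a * t))) {0..t}"
    unfolding s_def
    by (intro has_integral_add has_integral_mult_right has_integral_diff integrable_integral[OF ih] const)
  moreover have "p * a powr (p - 1) * (s - a * t) = 0" using t by (simp add: a_def)
  ultimately have 1: "((\<lambda>r. a powr p + p * a powr (p - 1) * (h r - a)) has_integral (a powr p * t)) {0..t}"
    by simp
  have "a powr p * t \<le> integral {0..t} (\<lambda>r. h r powr p)"
    by (rule has_integral_le[OF 1 integrable_integral[OF ihp]]) (use powr_tangent[OF p a0] h in auto)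
  then have "t powr (p - 1) * (a powr p * t) \<le> t powr (p - 1) * integral {0..t} (\<lambda>r. h r powr p)"
    by (intro mult_left_mono) auto
  moreover have "t powr (p - 1) * (a powr p * t) = s powr p"
  proof -
    have "t powr (p - 1) * t = t powr p" using t powr_mult_base[of t "p - 1"] by (simp add: mult.commute)
    moreover have "a powr p = s powr p / t powr p" using t s0 by (simp add: a_def powr_divide)
    ultimately show ?thesis using t by (metis (no_types, lifting) mult.left_commute mult.commute nonzero_divide_eq_eq powr_gt_zero less_irrefl times_divide_eq_left)
  qed
  ultimately show ?thesis by (simp add: s_def)
qed

text \<open>The fundamental theorem of calculus along the segment, followed by
  \<open>integral_powr_le\<close>. The right-hand side is extended to the full length s and is free
  of t, so it survives averaging over the endpoint.\<close>

lemma segment_increment_le: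
  fixes f :: "'a::euclidean_space \<Rightarrow> real"
  assumes p: "p > 1" and t: "0 \<le> t" "t \<le> s" and f: "C1_grad f Df"
  shows "ennreal (\<bar>f x - f (x + t *\<^sub>R v)\<bar> powr p) \<le> ennreal (s powr (p - 1) * norm v powr p) *
    (\<integral>\<^sup>+r\<in>{0<..<s}. ennreal (norm (Df (x + r *\<^sub>R v)) powr p) \<partial>lborel)"
proof (cases "t = 0")
  case False
  then have t0: "t > 0" "s > 0" using t by auto
  note [measurable] = C1_gradD(3,4)[OF f]
  have cDf: "continuous_on A (\<lambda>r. Df (x + r *\<^sub>R v))" for A :: "real set"
    by (rule continuous_on_compose2[OF C1_gradD(2)[OF f]]) (auto intro!: continuous_intros)
  define h where "h r = norm (Df (x + r *\<^sub>R v)) * norm v" for r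
  have ch: "continuous_on A h" for A unfolding h_def by (intro continuous_intros cDf)
  have chp: "continuous_on A (\<lambda>r. h r powr p)" for A
    by (intro continuous_on_powr' ch continuous_on_const) (use p in \<open>auto simp: h_def\<close>)
  have "((\<lambda>r. f (x + r *\<^sub>R v)) has_real_derivative Df (x + r *\<^sub>R v) \<bullet> v) (at r within A)" for r A
  proof -
    have "(f has_derivative (\<lambda>h. Df (x + r *\<^sub>R v) \<bullet> h)) (at (x + r *\<^sub>R v))"
      using f by (simp add: C1_grad_def)
    then have "((\<lambda>r. f (x + r *\<^sub>R v)) has_derivative (\<lambda>u. Df (x + r *\<^sub>R v) \<bullet> (0 + u *\<^sub>R v))) (at r within A)"
      by (intro has_derivative_compose[where g = f and f = "\<lambda>r. x + r *\<^sub>R v"]) (auto intro!: derivative_eq_intros)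
    then show ?thesis by (simp add: has_field_derivative_def mult.commute[of _ "Df _ \<bullet> v"])
  qed
  then have "((\<lambda>r. Df (x + r *\<^sub>R v) \<bullet> v) has_integral (f (x + t *\<^sub>R v) - f (x + 0 *\<^sub>R v))) {0..t}"
    using t0 by (intro fundamental_theorem_of_calculus) (auto simp: has_real_derivative_iff_has_vector_derivative)
  then have fi: "f (x + t *\<^sub>R v) - f x = integral {0..t} (\<lambda>r. Df (x + r *\<^sub>R v) \<bullet> v)"
    by (simp add: integral_unique)
  have "norm (f (x + t *\<^sub>R v) - f x) \<le> integral {0..t} h"
    unfolding fi using Cauchy_Schwarz_ineq2
    by (intro integral_norm_bound_integral integrable_continuous_real ch)
       (auto simp: h_def intro!: continuous_intros cDf)
  then have "\<bar>f x - f (x + t *\<^sub>R v)\<bar> powr p \<le> (integral {0..t} h) powr p"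
    using p by (intro powr_mono2) (auto simp: abs_minus_commute)
  also have "\<dots> \<le> t powr (p - 1) * integral {0..t} (\<lambda>r. h r powr p)"
    by (intro integral_powr_le p t0 ch) (auto simp: h_def)
  also have "\<dots> \<le> s powr (p - 1) * integral {0..s} (\<lambda>r. h r powr p)"
  proof (intro mult_mono powr_mono2 integral_subset_le)
    show "(\<lambda>r. h r powr p) integrable_on {0..t}" "(\<lambda>r. h r powr p) integrable_on {0..s}"
      by (auto intro!: integrable_continuous_real chp)
    then show "0 \<le> integral {0..t} (\<lambda>r. h r powr p)" by (intro integral_nonneg) auto
  qed (use p t t0 in auto)
  finally have 1: "ennreal (\<bar>f x - f (x + t *\<^sub>R v)\<bar> powr p) \<le> ennreal (s powr (p - 1) * integral {0..s} (\<lambda>r. h r powr p))"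
    by (rule ennreal_leI)
  have ihp: "(\<lambda>r. h r powr p) integrable_on {0..s}"
    by (auto intro!: integrable_continuous_real chp)
  have "ennreal (integral {0..s} (\<lambda>r. h r powr p)) = (\<integral>\<^sup>+r\<in>{0..s}. ennreal (h r powr p) \<partial>lborel)"
    using nn_integral_has_integral_lebesgue[OF _ integrable_integral[OF ihp]]
    by (simp add: nn_integral_completion h_def indicator_mult_ennreal mult.commute)
  also have "\<dots> = (\<integral>\<^sup>+r\<in>{0<..<s}. ennreal (h r powr p) \<partial>lborel)"
  proof (rule nn_integral_cong_AE)
    show "AE r in lborel. ennreal (h r powr p) * indicator {0..s} r = ennreal (h r powr p) * indicator {0<..<s} r"
      using AE_lborel_singleton[of 0] AE_lborel_singleton[of s]
      by eventually_elim (auto simp: indicator_def)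
  qed
  also have "\<dots> = (\<integral>\<^sup>+r. ennreal (norm v powr p) * (ennreal (norm (Df (x + r *\<^sub>R v)) powr p) * indicator {0<..<s} r) \<partial>lborel)"
    by (intro nn_integral_cong) (auto simp: h_def powr_mult ennreal_mult' mult_ac)
  also have "\<dots> = ennreal (norm v powr p) * (\<integral>\<^sup>+r\<in>{0<..<s}. ennreal (norm (Df (x + r *\<^sub>R v)) powr p) \<partial>lborel)"
    by (rule nn_integral_cmult) measurable
  finally show ?thesis using 1
    by (simp add: ennreal_mult' mult.assoc)
qed simp

text \<open>A Poincare inequality between two measures. In double-integral form it is symmetric and
  chains through an intermediate measure, so the geometry of \<Omega> can be handled one ball or one
  chart at a time.\<close>

definition link :: "'a::euclidean_space set \<Rightarrow> real \<Rightarrow> 'a measure \<Rightarrow> 'a measure \<Rightarrow> bool" where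
  "link \<Omega> p M N \<longleftrightarrow> (\<exists>C<top. \<forall>f Df. C1_grad f Df \<longrightarrow>
     (\<integral>\<^sup>+x. \<integral>\<^sup>+y. ennreal (\<bar>f x - f y\<bar> powr p) \<partial>N \<partial>M)
       \<le> C * (\<integral>\<^sup>+x\<in>\<Omega>. ennreal (norm (Df x) powr p) \<partial>lborel))"

abbreviation fin_borel :: "'a::euclidean_space measure \<Rightarrow> bool" where
  "fin_borel M \<equiv> finite_measure M \<and> sets M = sets borel"

lemma pair_sigma_finite_fin_borel: "fin_borel M \<Longrightarrow> fin_borel N \<Longrightarrow> pair_sigma_finite M N"
  by (auto simp: pair_sigma_finite_def finite_measure_def)

lemma link_sym:
  assumes MN: "fin_borel M" "fin_borel N" and l: "link \<Omega> p M N"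
  shows "link \<Omega> p N M"
proof -
  obtain C where C: "C < top" "\<And>f Df. C1_grad f Df \<Longrightarrow> (\<integral>\<^sup>+x. \<integral>\<^sup>+y. ennreal (\<bar>f x - f y\<bar> powr p) \<partial>N \<partial>M)
       \<le> C * (\<integral>\<^sup>+x\<in>\<Omega>. ennreal (norm (Df x) powr p) \<partial>lborel)"
    using l by (auto simp: link_def)
  interpret MN: pair_sigma_finite M N by (rule pair_sigma_finite_fin_borel[OF MN])
  have [measurable_cong]: "sets M = sets borel" "sets N = sets borel" using MN by auto
  show ?thesis unfolding link_def
  proof (intro exI[of _ C] conjI allI impI C(1))
    fix f :: "'a \<Rightarrow> real" and Df assume f: "C1_grad f Df"
    note [measurable] = C1_gradD(3,4)[OF f]
    have "(\<integral>\<^sup>+y. \<integral>\<^sup>+x. ennreal (\<bar>f y - f x\<bar> powr p) \<partial>M \<partial>N) = (\<integral>\<^sup>+y. \<integral>\<^sup>+x. ennreal (\<bar>f x - f y\<bar> powr p) \<partial>M \<partial>N)"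
      by (simp add: abs_minus_commute)
    also have "\<dots> = (\<integral>\<^sup>+x. \<integral>\<^sup>+y. ennreal (\<bar>f x - f y\<bar> powr p) \<partial>N \<partial>M)"
      by (rule MN.Fubini') measurable
    finally show "(\<integral>\<^sup>+y. \<integral>\<^sup>+x. ennreal (\<bar>f y - f x\<bar> powr p) \<partial>M \<partial>N) \<le> C * (\<integral>\<^sup>+x\<in>\<Omega>. ennreal (norm (Df x) powr p) \<partial>lborel)"
      using C(2)[OF f] by simp
  qed
qed

lemma abs_diff_powr_le_ennreal:
  fixes a b c p :: real
  assumes "p > 0"
  shows "ennreal (\<bar>a - c\<bar> powr p) \<le> ennreal (2 powr p) * (ennreal (\<bar>a - b\<bar> powr p) + ennreal (\<bar>b - c\<bar> powr p))"
proof -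
  have "\<bar>a - c\<bar> powr p \<le> (\<bar>a - b\<bar> + \<bar>b - c\<bar>) powr p"
    using assms by (intro powr_mono2) auto
  also have "\<dots> \<le> 2 powr p * (\<bar>a - b\<bar> powr p + \<bar>b - c\<bar> powr p)"
    by (rule powr_add_le) (use assms in auto)
  finally show ?thesis
    by (metis abs_ge_zero ennreal_leI ennreal_mult' ennreal_plus powr_ge_zero)
qed

lemma ennreal_le_divide_mult:
  fixes a x y :: ennreal
  assumes "a * x \<le> y" "a \<noteq> 0" "a < top"
  shows "x \<le> y / a"
proof -
  have "x = (x * a) / a" using assms by (simp add: mult_divide_eq_ennreal)
  also have "\<dots> \<le> y / a" using assms by (intro divide_right_mono_ennreal) (simp add: mult.commute)
  finally show ?thesis .
qed

lemma ennreal_divide_lt_top: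
  fixes a b :: ennreal
  assumes "a < top" "b \<noteq> 0"
  shows "a / b < top"
  using assms by (auto simp: divide_ennreal_def ennreal_mult_less_top less_top[symmetric] ennreal_mult_eq_top_iff)

text \<open>Insert an intermediate point y, integrate it over P, and divide by the total mass of P,
  which therefore must not vanish.\<close>

lemma link_trans:
  assumes p: "p > 1" and MPN: "fin_borel M" "fin_borel P" "fin_borel N"
    and P0: "emeasure P (space P) \<noteq> 0"
    and l: "link \<Omega> p M P" "link \<Omega> p P N"
  shows "link \<Omega> p M N"
proof -
  obtain C1 where C1: "C1 < top" "\<And>f Df. C1_grad f Df \<Longrightarrow> (\<integral>\<^sup>+x. \<integral>\<^sup>+y. ennreal (\<bar>f x - f y\<bar> powr p) \<partial>P \<partial>M)
       \<le> C1 * (\<integral>\<^sup>+x\<in>\<Omega>. ennreal (norm (Df x) powr p) \<partial>lborel)"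
    using l by (auto simp: link_def)
  have "link \<Omega> p N P" by (rule link_sym) (use MPN l in auto)
  then obtain C2 where C2: "C2 < top" "\<And>f Df. C1_grad f Df \<Longrightarrow> (\<integral>\<^sup>+x. \<integral>\<^sup>+y. ennreal (\<bar>f x - f y\<bar> powr p) \<partial>P \<partial>N)
       \<le> C2 * (\<integral>\<^sup>+x\<in>\<Omega>. ennreal (norm (Df x) powr p) \<partial>lborel)"
    by (auto simp: link_def)
  interpret M: finite_measure M using MPN by simp
  interpret P: finite_measure P using MPN by simp
  interpret N: finite_measure N using MPN by simp
  have [measurable_cong]: "sets M = sets borel" "sets P = sets borel" "sets N = sets borel" using MPN by auto
  define c where "c = ennreal (2 powr p)"
  define m where "m L = emeasure L (space L)" for L :: "'a measure"
  have fin: "m M < top" "m P < top" "m N < top"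
    unfolding m_def using M.emeasure_finite P.emeasure_finite N.emeasure_finite by (simp_all add: less_top[symmetric])
  define C where "C = c * (m N * C1 + m M * C2) / m P"
  show ?thesis unfolding link_def
  proof (intro exI[of _ C] conjI allI impI)
    have "c * (m N * C1 + m M * C2) < top" using C1(1) C2(1) fin
      by (simp add: c_def ennreal_mult_less_top)
    then show "C < top" using P0 unfolding C_def by (intro ennreal_divide_lt_top) (simp_all add: m_def)
    fix f :: "'a \<Rightarrow> real" and Df assume f: "C1_grad f Df"
    note [measurable] = C1_gradD(3,4)[OF f]
    define h where "h x y = ennreal (\<bar>f x - f y\<bar> powr p)" for x y
    have [measurable]: "case_prod h \<in> borel_measurable (borel \<Otimes>\<^sub>M borel)" unfolding h_def by measurable
    define I where "I = (\<integral>\<^sup>+x\<in>\<Omega>. ennreal (norm (Df x) powr p) \<partial>lborel)"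
    have hsym: "h x y = h y x" for x y by (simp add: h_def abs_minus_commute)
    have tri: "h x z \<le> c * (h x y + h z y)" for x y z
      using abs_diff_powr_le_ennreal[of p "f x" "f z" "f y"] p unfolding hsym[of z y]
      by (simp add: h_def c_def)
    have "m P * (\<integral>\<^sup>+x. \<integral>\<^sup>+z. h x z \<partial>N \<partial>M) = (\<integral>\<^sup>+x. \<integral>\<^sup>+z. \<integral>\<^sup>+y. h x z \<partial>P \<partial>N \<partial>M)"
      by (simp add: m_def nn_integral_cmult mult.commute nn_integral_multc)
    also have "\<dots> \<le> (\<integral>\<^sup>+x. \<integral>\<^sup>+z. \<integral>\<^sup>+y. c * (h x y + h z y) \<partial>P \<partial>N \<partial>M)"
      by (intro nn_integral_mono tri)
    also have "\<dots> = (\<integral>\<^sup>+x. \<integral>\<^sup>+z. c * ((\<integral>\<^sup>+y. h x y \<partial>P) + (\<integral>\<^sup>+y. h z y \<partial>P)) \<partial>N \<partial>M)"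
      by (simp add: nn_integral_cmult nn_integral_add)
    also have "\<dots> = (\<integral>\<^sup>+x. c * (m N * (\<integral>\<^sup>+y. h x y \<partial>P) + (\<integral>\<^sup>+z. \<integral>\<^sup>+y. h z y \<partial>P \<partial>N)) \<partial>M)"
      by (simp add: nn_integral_cmult nn_integral_add m_def mult.commute)
    also have "\<dots> = c * (m N * (\<integral>\<^sup>+x. \<integral>\<^sup>+y. h x y \<partial>P \<partial>M) + m M * (\<integral>\<^sup>+z. \<integral>\<^sup>+y. h z y \<partial>P \<partial>N))"
      by (simp add: nn_integral_cmult nn_integral_add m_def mult.commute[of _ "emeasure M _"])
    also have "\<dots> \<le> c * (m N * (C1 * I) + m M * (C2 * I))"
      using C1(2)[OF f] C2(2)[OF f] by (intro mult_mono add_mono) (auto simp: h_def I_def)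
    also have "\<dots> = c * (m N * C1 + m M * C2) * I" by (simp add: algebra_simps)
    finally have "(\<integral>\<^sup>+x. \<integral>\<^sup>+z. h x z \<partial>N \<partial>M) \<le> c * (m N * C1 + m M * C2) * I / m P"
      by (intro ennreal_le_divide_mult) (use P0 fin in \<open>auto simp: m_def\<close>)
    also have "\<dots> = C * I" by (simp add: C_def divide_ennreal_def mult_ac)
    finally show "(\<integral>\<^sup>+x. \<integral>\<^sup>+z. ennreal (\<bar>f x - f z\<bar> powr p) \<partial>N \<partial>M) \<le> C * (\<integral>\<^sup>+x\<in>\<Omega>. ennreal (norm (Df x) powr p) \<partial>lborel)"
      by (simp add: h_def I_def)
  qed
qed

text \<open>A density instead of a restricted space: all measures keep the whole space and its Borel
  sets, so that measures on different sets, volume or surface, can be paired, compared and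
  joined.\<close>

definition meas_on :: "'a measure \<Rightarrow> 'a set \<Rightarrow> 'a measure" where
  "meas_on \<mu> E = density \<mu> (indicator E)"

lemma sets_meas_on[simp, measurable_cong]: "sets (meas_on \<mu> E) = sets \<mu>"
  and space_meas_on[simp]: "space (meas_on \<mu> E) = space \<mu>"
  by (auto simp: meas_on_def)

lemma nn_integral_meas_on:
  assumes "E \<in> sets \<mu>" "f \<in> borel_measurable \<mu>"
  shows "(\<integral>\<^sup>+x. f x \<partial>meas_on \<mu> E) = (\<integral>\<^sup>+x\<in>E. f x \<partial>\<mu>)"
  using assms unfolding meas_on_def by (subst nn_integral_density) (auto simp: mult.commute)

lemma emeasure_meas_on:
  assumes "E \<in> sets \<mu>" "A \<in> sets \<mu>"
  shows "emeasure (meas_on \<mu> E) A = emeasure \<mu> (E \<inter> A)"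
  using assms unfolding meas_on_def by (subst emeasure_density) (auto simp: indicator_inter_arith[symmetric] nn_integral_indicator)

lemma AE_meas_on:
  assumes "E \<in> sets \<mu>"
  shows "(AE x in meas_on \<mu> E. P x) \<longleftrightarrow> (AE x in \<mu>. x \<in> E \<longrightarrow> P x)"
  using assms unfolding meas_on_def by (subst AE_density) (auto simp: indicator_def)

lemma fin_borel_meas_on:
  assumes "sets \<mu> = sets borel" "E \<in> sets borel" "emeasure \<mu> E < top"
  shows "fin_borel (meas_on \<mu> E)"
proof -
  have "space \<mu> = UNIV" using sets_eq_imp_space_eq[OF assms(1)] by simp
  then have "emeasure (meas_on \<mu> E) (space \<mu>) = emeasure \<mu> E"
    using assms by (subst emeasure_meas_on) auto
  then show ?thesis using assms by (auto intro!: finite_measureI simp: less_top)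
qed

lemma fin_borel_lborel_on:
  fixes E :: "'a::euclidean_space set"
  assumes "E \<in> sets borel" "bounded E"
  shows "fin_borel (meas_on lborel E)"
  using assms emeasure_bounded_finite[OF assms(2)] by (intro fin_borel_meas_on) auto

lemma link_mono_left:
  assumes l: "link \<Omega> p (meas_on \<mu> E) N" and s: "sets \<mu> = sets borel" "E \<in> sets borel" "E' \<in> sets borel" "E' \<subseteq> E"
    and N: "fin_borel N"
  shows "link \<Omega> p (meas_on \<mu> E') N"
proof -
  interpret N: finite_measure N using N by simp
  have [measurable_cong]: "sets \<mu> = sets borel" "sets N = sets borel" using s N by auto
  obtain C where C: "C < top" "\<And>f Df. C1_grad f Df \<Longrightarrow> (\<integral>\<^sup>+x. \<integral>\<^sup>+y. ennreal (\<bar>f x - f y\<bar> powr p) \<partial>N \<partial>meas_on \<mu> E)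
       \<le> C * (\<integral>\<^sup>+x\<in>\<Omega>. ennreal (norm (Df x) powr p) \<partial>lborel)"
    using l by (auto simp: link_def)
  show ?thesis unfolding link_def
  proof (intro exI[of _ C] conjI allI impI C(1))
    fix f :: "'a \<Rightarrow> real" and Df assume f: "C1_grad f Df"
    note [measurable] = C1_gradD(3,4)[OF f]
    have m: "(\<lambda>x. \<integral>\<^sup>+y. ennreal (\<bar>f x - f y\<bar> powr p) \<partial>N) \<in> borel_measurable \<mu>" by measurable
    have "(\<integral>\<^sup>+x. \<integral>\<^sup>+y. ennreal (\<bar>f x - f y\<bar> powr p) \<partial>N \<partial>meas_on \<mu> E')
       \<le> (\<integral>\<^sup>+x. \<integral>\<^sup>+y. ennreal (\<bar>f x - f y\<bar> powr p) \<partial>N \<partial>meas_on \<mu> E)"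
      using s m by (auto simp: nn_integral_meas_on intro!: nn_integral_mono mult_left_mono split: split_indicator)
    then show "(\<integral>\<^sup>+x. \<integral>\<^sup>+y. ennreal (\<bar>f x - f y\<bar> powr p) \<partial>N \<partial>meas_on \<mu> E')
       \<le> C * (\<integral>\<^sup>+x\<in>\<Omega>. ennreal (norm (Df x) powr p) \<partial>lborel)"
      using C(2)[OF f] by (rule order_trans)
  qed
qed

lemma link_Un_left:
  assumes l: "link \<Omega> p (meas_on \<mu> E) N" "link \<Omega> p (meas_on \<mu> F) N"
    and s: "sets \<mu> = sets borel" "E \<in> sets borel" "F \<in> sets borel"
    and N: "fin_borel N"
  shows "link \<Omega> p (meas_on \<mu> (E \<union> F)) N"
proof -
  interpret N: finite_measure N using N by simp
  have [measurable_cong]: "sets \<mu> = sets borel" "sets N = sets borel" using s N by auto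
  obtain C where C: "C < top" "\<And>f Df. C1_grad f Df \<Longrightarrow> (\<integral>\<^sup>+x. \<integral>\<^sup>+y. ennreal (\<bar>f x - f y\<bar> powr p) \<partial>N \<partial>meas_on \<mu> E)
       \<le> C * (\<integral>\<^sup>+x\<in>\<Omega>. ennreal (norm (Df x) powr p) \<partial>lborel)"
    using l by (auto simp: link_def)
  obtain D where D: "D < top" "\<And>f Df. C1_grad f Df \<Longrightarrow> (\<integral>\<^sup>+x. \<integral>\<^sup>+y. ennreal (\<bar>f x - f y\<bar> powr p) \<partial>N \<partial>meas_on \<mu> F)
       \<le> D * (\<integral>\<^sup>+x\<in>\<Omega>. ennreal (norm (Df x) powr p) \<partial>lborel)"
    using l by (auto simp: link_def)
  show ?thesis unfolding link_def
  proof (intro exI[of _ "C + D"] conjI allI impI)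
    show "C + D < top" using C D by simp
    fix f :: "'a \<Rightarrow> real" and Df assume f: "C1_grad f Df"
    note [measurable] = C1_gradD(3,4)[OF f]
    define h where "h x = (\<integral>\<^sup>+y. ennreal (\<bar>f x - f y\<bar> powr p) \<partial>N)" for x
    have h: "h \<in> borel_measurable \<mu>" unfolding h_def by measurable
    have "(\<integral>\<^sup>+x. h x \<partial>meas_on \<mu> (E \<union> F)) \<le> (\<integral>\<^sup>+x. h x * indicator E x + h x * indicator F x \<partial>\<mu>)"
      using s h by (auto simp: nn_integral_meas_on intro!: nn_integral_mono split: split_indicator)
    also have "\<dots> = (\<integral>\<^sup>+x. h x \<partial>meas_on \<mu> E) + (\<integral>\<^sup>+x. h x \<partial>meas_on \<mu> F)"
      using s h by (subst nn_integral_add) (auto simp: nn_integral_meas_on)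
    also have "\<dots> \<le> C * (\<integral>\<^sup>+x\<in>\<Omega>. ennreal (norm (Df x) powr p) \<partial>lborel) + D * (\<integral>\<^sup>+x\<in>\<Omega>. ennreal (norm (Df x) powr p) \<partial>lborel)"
      using C(2)[OF f] D(2)[OF f] by (intro add_mono) (auto simp: h_def)
    finally show "(\<integral>\<^sup>+x. \<integral>\<^sup>+y. ennreal (\<bar>f x - f y\<bar> powr p) \<partial>N \<partial>meas_on \<mu> (E \<union> F))
       \<le> (C + D) * (\<integral>\<^sup>+x\<in>\<Omega>. ennreal (norm (Df x) powr p) \<partial>lborel)"
      by (simp add: h_def distrib_right)
  qed
qed

lemma nn_integral_lborel_translate:
  fixes g :: "'a::euclidean_space \<Rightarrow> ennreal"
  assumes [measurable]: "g \<in> borel_measurable borel"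
  shows "(\<integral>\<^sup>+x. g (c + x) \<partial>lborel) = (\<integral>\<^sup>+x. g x \<partial>lborel)"
proof -
  have "(\<integral>\<^sup>+x. g x \<partial>lborel) = (\<integral>\<^sup>+x. g x \<partial>distr lborel borel ((+) c))"
    by (simp add: lborel_distr_plus)
  also have "\<dots> = (\<integral>\<^sup>+x. g (c + x) \<partial>lborel)"
    by (rule nn_integral_distr) auto
  finally show ?thesis by simp
qed

text \<open>Write y = x + v. By convexity the segment stays in B, hence in \<Omega>; for fixed v and
  r the map x |-> x + r v preserves Lebesgue measure, so each pair (v, r) contributes at most the
  full gradient integral. What remains is an integral over r in (0, 1) and over a bounded set of
  v.\<close>

lemma link_convex:
  fixes B :: "'a::euclidean_space set"
  assumes p: "p > 1" and B: "convex B" "bounded B" "B \<in> sets borel" "B \<subseteq> \<Omega>" and \<Omega>: "\<Omega> \<in> sets borel"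
  shows "link \<Omega> p (meas_on lborel B) (meas_on lborel B)"
proof -
  obtain R where R: "R > 0" "B \<subseteq> ball 0 R"
    using bounded_subset_ballD[OF B(2), of 0] by auto
  define D where "D = 2 * R"
  define C where "C = ennreal (D powr p) * emeasure lborel (ball (0::'a) D)"
  note [measurable] = B(3) \<Omega>
  show ?thesis unfolding link_def
  proof (intro exI[of _ C] conjI allI impI)
    show "C < top" using emeasure_lborel_ball_finite[of "0::'a" D] by (simp add: C_def ennreal_mult_less_top)
    fix f :: "'a \<Rightarrow> real" and Df assume f: "C1_grad f Df"
    note [measurable] = C1_gradD(3,4)[OF f]
    define h where "h x y = ennreal (\<bar>f x - f y\<bar> powr p)" for x y
    have [measurable]: "case_prod h \<in> borel_measurable (borel \<Otimes>\<^sub>M borel)" unfolding h_def by measurable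
    define G where "G x = ennreal (norm (Df x) powr p)" for x
    have [measurable]: "G \<in> borel_measurable borel" unfolding G_def by measurable
    define I where "I = (\<integral>\<^sup>+x\<in>\<Omega>. G x \<partial>lborel)"
    have "(\<integral>\<^sup>+x. \<integral>\<^sup>+y. h x y \<partial>meas_on lborel B \<partial>meas_on lborel B)
        = (\<integral>\<^sup>+x. (\<integral>\<^sup>+y. h x y * indicator B y * indicator B x \<partial>lborel) \<partial>lborel)"
      by (simp add: nn_integral_meas_on nn_integral_multc)
    also have "\<dots> = (\<integral>\<^sup>+x. (\<integral>\<^sup>+v. h x (x + v) * indicator B (x + v) * indicator B x \<partial>lborel) \<partial>lborel)"
      by (intro nn_integral_cong nn_integral_lborel_translate[symmetric]) measurable
    also have "\<dots> = (\<integral>\<^sup>+v. (\<integral>\<^sup>+x. h x (x + v) * indicator B (x + v) * indicator B x \<partial>lborel) \<partial>lborel)"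
      by (rule lborel_pair.Fubini'[symmetric]) measurable
    \<comment> \<open>Points of B differ by less than D = 2 R, so the integrand vanishes unless v
      lies in \<open>ball 0 D\<close>, where norm v is at most D.\<close>
    also have "\<dots> \<le> (\<integral>\<^sup>+v. ennreal (D powr p) * I * indicator (ball (0::'a) D) v \<partial>lborel)"
    proof (rule nn_integral_mono)
      fix v :: 'a
      show "(\<integral>\<^sup>+x. h x (x + v) * indicator B (x + v) * indicator B x \<partial>lborel) \<le> ennreal (D powr p) * I * indicator (ball (0::'a) D) v"
      proof (cases "v \<in> ball 0 D")
        case False
        have "h x (x + v) * indicator B (x + v) * indicator B x = 0" for x
        proof -
          have "\<not> (x \<in> B \<and> x + v \<in> B)"
          proof
            assume "x \<in> B \<and> x + v \<in> B"
            then have "norm x < R" "norm (x + v) < R" using R by auto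
            then have "norm v < D" using norm_triangle_ineq4[of "x + v" x] by (simp add: D_def)
            with False show False by simp
          qed
          then show ?thesis by (auto simp: indicator_def)
        qed
        then show ?thesis by (simp only: nn_integral_const) simp
      next
        case True
        have "h x (x + v) * indicator B (x + v) * indicator B x
          \<le> ennreal (norm v powr p) * (\<integral>\<^sup>+r. G (r *\<^sub>R v + x) * indicator \<Omega> (r *\<^sub>R v + x) * indicator {0<..<1} r \<partial>lborel)" for x
        proof (cases "x \<in> B \<and> x + v \<in> B")
          case xB: True
          have "r *\<^sub>R v + x \<in> \<Omega>" if "r \<in> {0<..<1}" for r :: real
          proof -
            have "(1 - r) *\<^sub>R x + r *\<^sub>R (x + v) \<in> B" using xB that B(1) by (intro convexD) auto
            then show ?thesis using B(4) by (auto simp: algebra_simps)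
          qed
          then have *: "G (r *\<^sub>R v + x) * indicator \<Omega> (r *\<^sub>R v + x) * indicator {0<..<1} r = G (x + r *\<^sub>R v) * indicator {0<..<1} r" for r
            by (auto simp: indicator_def add.commute)
          show ?thesis unfolding * using segment_increment_le[OF p _ _ f, of 1 1 x v] xB
            by (simp add: h_def G_def)
        qed (auto simp: indicator_def)
        then have "(\<integral>\<^sup>+x. h x (x + v) * indicator B (x + v) * indicator B x \<partial>lborel)
          \<le> (\<integral>\<^sup>+x. ennreal (norm v powr p) * (\<integral>\<^sup>+r. G (r *\<^sub>R v + x) * indicator \<Omega> (r *\<^sub>R v + x) * indicator {0<..<1} r \<partial>lborel) \<partial>lborel)"
          by (rule nn_integral_mono)
        also have "\<dots> = ennreal (norm v powr p) * (\<integral>\<^sup>+x. (\<integral>\<^sup>+r. G (r *\<^sub>R v + x) * indicator \<Omega> (r *\<^sub>R v + x) * indicator {0<..<1} r \<partial>lborel) \<partial>lborel)"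
          by (rule nn_integral_cmult) measurable
        also have "(\<integral>\<^sup>+x. (\<integral>\<^sup>+r. G (r *\<^sub>R v + x) * indicator \<Omega> (r *\<^sub>R v + x) * indicator {0<..<1} r \<partial>lborel) \<partial>lborel)
           = (\<integral>\<^sup>+(r::real). (\<integral>\<^sup>+x. G (r *\<^sub>R v + x) * indicator \<Omega> (r *\<^sub>R v + x) * indicator {0<..<1} r \<partial>lborel) \<partial>lborel)"
          by (rule lborel_pair.Fubini') measurable
        also have "\<dots> = (\<integral>\<^sup>+(r::real). I * indicator {0<..<1} r \<partial>lborel)"
          unfolding I_def
          by (subst nn_integral_multc, measurable)
             (subst nn_integral_lborel_translate[where g = "\<lambda>x. G x * indicator \<Omega> x"], auto)
        also have "\<dots> = I" by (subst nn_integral_cmult_indicator) auto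
        also have "ennreal (norm v powr p) * I \<le> ennreal (D powr p) * I"
          using True p by (intro mult_right_mono ennreal_leI powr_mono2) auto
        finally show ?thesis using True by simp
      qed
    qed
    also have "\<dots> = C * I" by (subst nn_integral_cmult_indicator) (auto simp: C_def mult_ac)
    finally show "(\<integral>\<^sup>+x. \<integral>\<^sup>+y. ennreal (\<bar>f x - f y\<bar> powr p) \<partial>meas_on lborel B \<partial>meas_on lborel B)
       \<le> C * (\<integral>\<^sup>+x\<in>\<Omega>. ennreal (norm (Df x) powr p) \<partial>lborel)"
      by (simp add: h_def I_def G_def)
  qed
qed

text \<open>The image of M times dt on (0, s) under (x, t) |-> x + t n is at most C times Lebesgue
  measure, expressed through integrals of nonnegative Borel functions.\<close>

definition flow_bound :: "'a::euclidean_space measure \<Rightarrow> 'a \<Rightarrow> real \<Rightarrow> ennreal \<Rightarrow> bool" where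
  "flow_bound M n s C \<longleftrightarrow> (\<forall>G\<in>borel_measurable borel.
     (\<integral>\<^sup>+x. (\<integral>\<^sup>+t\<in>{0<..<s}. G (x + t *\<^sub>R n) \<partial>lborel) \<partial>M) \<le> C * (\<integral>\<^sup>+z. G z \<partial>lborel))"

text \<open>The intermediate point x + t n, averaged over t in (a, s), joins x to z in B. The first
  leg is a segment inside \<Omega>, controlled by the gradient along it; the second joins two points
  of B. Integrated over M, both legs turn into Lebesgue integrals by
  \<open>flow_bound\<close>.\<close>

lemma link_flow:
  fixes B :: "'a::euclidean_space set"
  assumes p: "p > 1" and M: "fin_borel M" and as: "0 \<le> a" "a < s"
    and B: "bounded B" "B \<in> sets borel" and \<Omega>: "\<Omega> \<in> sets borel"
    and lB: "link \<Omega> p (meas_on lborel B) (meas_on lborel B)"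
    and fb: "flow_bound M n s C" "C < top"
    and in\<Omega>: "AE x in M. \<forall>t\<in>{0<..<s}. x + t *\<^sub>R n \<in> \<Omega>"
    and inB: "AE x in M. \<forall>t\<in>{a<..<s}. x + t *\<^sub>R n \<in> B"
  shows "link \<Omega> p M (meas_on lborel B)"
proof -
  define N where "N = meas_on lborel B"
  define T where "T = meas_on lborel {a<..<s}"
  have N: "fin_borel N" unfolding N_def using B by (intro fin_borel_lborel_on)
  have T: "fin_borel T" unfolding T_def by (intro fin_borel_lborel_on) auto
  interpret M: finite_measure M using M by simp
  interpret N: finite_measure N using N by simp
  interpret T: finite_measure T using T by simp
  interpret NT: pair_sigma_finite N T by standard
  have [measurable_cong]: "sets M = sets borel" "sets N = sets borel" "sets T = sets borel" using M N T by auto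
  obtain C2 where C2: "C2 < top" "\<And>f Df. C1_grad f Df \<Longrightarrow> (\<integral>\<^sup>+x. \<integral>\<^sup>+y. ennreal (\<bar>f x - f y\<bar> powr p) \<partial>N \<partial>N)
       \<le> C2 * (\<integral>\<^sup>+x\<in>\<Omega>. ennreal (norm (Df x) powr p) \<partial>lborel)"
    using lB by (auto simp: link_def N_def)
  note [measurable] = B(2) \<Omega>
  define c where "c = ennreal (2 powr p)"
  define k where "k = ennreal (s powr (p - 1) * norm n powr p)"
  define L where "L = emeasure N (space N)"
  define w where "w = emeasure T (space T)"
  have w: "w = ennreal (s - a)" unfolding w_def T_def using as by (subst emeasure_meas_on) auto
  have L: "L < top" unfolding L_def using N.emeasure_finite by (simp add: less_top[symmetric])
  define CC where "CC = c * (L * w * k * C + C * C2) / w"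
  show ?thesis unfolding link_def N_def[symmetric]
  proof (intro exI[of _ CC] conjI allI impI)
    have "c * (L * w * k * C + C * C2) < top" using C2(1) fb(2) L
      by (simp add: c_def k_def w ennreal_mult_less_top)
    then show "CC < top" unfolding CC_def using w as by (intro ennreal_divide_lt_top) auto
    fix f :: "'a \<Rightarrow> real" and Df assume f: "C1_grad f Df"
    note [measurable] = C1_gradD(3,4)[OF f]
    define h where "h x y = ennreal (\<bar>f x - f y\<bar> powr p)" for x y
    have [measurable]: "case_prod h \<in> borel_measurable (borel \<Otimes>\<^sub>M borel)" unfolding h_def by measurable
    define G where "G x = ennreal (norm (Df x) powr p)" for x
    have [measurable]: "G \<in> borel_measurable borel" unfolding G_def by measurable
    define I where "I = (\<integral>\<^sup>+x\<in>\<Omega>. G x \<partial>lborel)"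
    \<comment> \<open>The cut-off by B makes the Lebesgue integral of \<Psi> equal to the double
      integral over B.\<close>
    define \<Psi> where "\<Psi> z = (\<integral>\<^sup>+y. h z y \<partial>N) * indicator B z" for z
    have [measurable]: "\<Psi> \<in> borel_measurable borel" unfolding \<Psi>_def by measurable
    have 1: "(\<integral>\<^sup>+x. \<integral>\<^sup>+t. h x (x + t *\<^sub>R n) \<partial>T \<partial>M) \<le> w * k * (C * I)"
    proof -
      have "AE x in M. (\<integral>\<^sup>+t. h x (x + t *\<^sub>R n) \<partial>T) \<le> w * k * (\<integral>\<^sup>+r\<in>{0<..<s}. G (x + r *\<^sub>R n) * indicator \<Omega> (x + r *\<^sub>R n) \<partial>lborel)"
        using in\<Omega>
      proof eventually_elim
        case (elim x)
        have e: "(\<integral>\<^sup>+r\<in>{0<..<s}. G (x + r *\<^sub>R n) * indicator \<Omega> (x + r *\<^sub>R n) \<partial>lborel) = (\<integral>\<^sup>+r\<in>{0<..<s}. G (x + r *\<^sub>R n) \<partial>lborel)"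
          using elim by (intro nn_integral_cong) (auto simp: indicator_def)
        have "(\<integral>\<^sup>+t. h x (x + t *\<^sub>R n) \<partial>T) = (\<integral>\<^sup>+t\<in>{a<..<s}. h x (x + t *\<^sub>R n) \<partial>lborel)"
          unfolding T_def by (rule nn_integral_meas_on) auto
        also have "\<dots> \<le> (\<integral>\<^sup>+t. (k * (\<integral>\<^sup>+r\<in>{0<..<s}. G (x + r *\<^sub>R n) \<partial>lborel)) * indicator {a<..<s} t \<partial>lborel)"
          using segment_increment_le[OF p _ _ f, of _ s x n] as
          by (intro nn_integral_mono) (auto simp: h_def G_def k_def split: split_indicator)
        also have "\<dots> = w * k * (\<integral>\<^sup>+r\<in>{0<..<s}. G (x + r *\<^sub>R n) \<partial>lborel)"
          using as by (subst nn_integral_cmult_indicator) (auto simp: w mult_ac)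
        finally show ?case by (simp add: e)
      qed
      then have "(\<integral>\<^sup>+x. \<integral>\<^sup>+t. h x (x + t *\<^sub>R n) \<partial>T \<partial>M) \<le> (\<integral>\<^sup>+x. w * k * (\<integral>\<^sup>+r\<in>{0<..<s}. G (x + r *\<^sub>R n) * indicator \<Omega> (x + r *\<^sub>R n) \<partial>lborel) \<partial>M)"
        by (rule nn_integral_mono_AE)
      also have "\<dots> = w * k * (\<integral>\<^sup>+x. (\<integral>\<^sup>+r\<in>{0<..<s}. G (x + r *\<^sub>R n) * indicator \<Omega> (x + r *\<^sub>R n) \<partial>lborel) \<partial>M)"
        by (rule nn_integral_cmult) measurable
      also have "\<dots> \<le> w * k * (C * I)"
        using fb(1)[unfolded flow_bound_def, rule_format, of "\<lambda>x. G x * indicator \<Omega> x"]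
        by (intro mult_left_mono) (auto simp: I_def)
      finally show ?thesis .
    qed
    have 2: "(\<integral>\<^sup>+x. \<integral>\<^sup>+t. \<integral>\<^sup>+z. h (x + t *\<^sub>R n) z \<partial>N \<partial>T \<partial>M) \<le> C * (C2 * I)"
    proof -
      have "AE x in M. (\<integral>\<^sup>+t. \<integral>\<^sup>+z. h (x + t *\<^sub>R n) z \<partial>N \<partial>T) \<le> (\<integral>\<^sup>+t\<in>{0<..<s}. \<Psi> (x + t *\<^sub>R n) \<partial>lborel)"
        using inB
      proof eventually_elim
        case (elim x)
        have "(\<integral>\<^sup>+t. \<integral>\<^sup>+z. h (x + t *\<^sub>R n) z \<partial>N \<partial>T) = (\<integral>\<^sup>+t\<in>{a<..<s}. (\<integral>\<^sup>+z. h (x + t *\<^sub>R n) z \<partial>N) \<partial>lborel)"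
          unfolding T_def by (rule nn_integral_meas_on) auto
        also have "\<dots> \<le> (\<integral>\<^sup>+t\<in>{0<..<s}. \<Psi> (x + t *\<^sub>R n) \<partial>lborel)"
          using elim as by (intro nn_integral_mono) (auto simp: \<Psi>_def split: split_indicator)
        finally show ?case .
      qed
      then have "(\<integral>\<^sup>+x. \<integral>\<^sup>+t. \<integral>\<^sup>+z. h (x + t *\<^sub>R n) z \<partial>N \<partial>T \<partial>M) \<le> (\<integral>\<^sup>+x. (\<integral>\<^sup>+t\<in>{0<..<s}. \<Psi> (x + t *\<^sub>R n) \<partial>lborel) \<partial>M)"
        by (rule nn_integral_mono_AE)
      also have "\<dots> \<le> C * (\<integral>\<^sup>+z. \<Psi> z \<partial>lborel)"
        using fb(1)[unfolded flow_bound_def, rule_format, of \<Psi>] by simp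
      also have "(\<integral>\<^sup>+z. \<Psi> z \<partial>lborel) = (\<integral>\<^sup>+x. \<integral>\<^sup>+y. h x y \<partial>N \<partial>N)"
        unfolding \<Psi>_def by (subst (2) N_def, subst nn_integral_meas_on) auto
      also have "\<dots> \<le> C2 * I" using C2(2)[OF f] by (simp add: h_def I_def G_def)
      finally show ?thesis by (simp add: mult_left_mono)
    qed
    \<comment> \<open>w is the length of (a, s); multiplying by it inserts the average over the
      intermediate point.\<close>
    have "w * (\<integral>\<^sup>+x. \<integral>\<^sup>+z. h x z \<partial>N \<partial>M) = (\<integral>\<^sup>+x. \<integral>\<^sup>+z. \<integral>\<^sup>+t. h x z \<partial>T \<partial>N \<partial>M)"
      by (simp add: w_def nn_integral_cmult mult.commute[of _ "emeasure T _"])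
    also have "\<dots> \<le> (\<integral>\<^sup>+x. \<integral>\<^sup>+z. \<integral>\<^sup>+t. c * (h x (x + t *\<^sub>R n) + h (x + t *\<^sub>R n) z) \<partial>T \<partial>N \<partial>M)"
      using p unfolding h_def c_def by (intro nn_integral_mono abs_diff_powr_le_ennreal) auto
    also have "\<dots> = (\<integral>\<^sup>+x. \<integral>\<^sup>+t. \<integral>\<^sup>+z. c * (h x (x + t *\<^sub>R n) + h (x + t *\<^sub>R n) z) \<partial>N \<partial>T \<partial>M)"
      by (intro nn_integral_cong NT.Fubini'[symmetric]) measurable
    also have "\<dots> = (\<integral>\<^sup>+x. \<integral>\<^sup>+t. c * (L * h x (x + t *\<^sub>R n) + (\<integral>\<^sup>+z. h (x + t *\<^sub>R n) z \<partial>N)) \<partial>T \<partial>M)"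
      by (simp add: nn_integral_cmult nn_integral_add L_def mult.commute[of _ "emeasure N _"])
    also have "\<dots> = c * (L * (\<integral>\<^sup>+x. \<integral>\<^sup>+t. h x (x + t *\<^sub>R n) \<partial>T \<partial>M) + (\<integral>\<^sup>+x. \<integral>\<^sup>+t. \<integral>\<^sup>+z. h (x + t *\<^sub>R n) z \<partial>N \<partial>T \<partial>M))"
      by (simp add: nn_integral_cmult nn_integral_add)
    also have "\<dots> \<le> c * (L * (w * k * (C * I)) + C * (C2 * I))"
      by (intro mult_left_mono add_mono 1 2) auto
    also have "\<dots> = c * (L * w * k * C + C * C2) * I" by (simp add: algebra_simps)
    finally have "(\<integral>\<^sup>+x. \<integral>\<^sup>+z. h x z \<partial>N \<partial>M) \<le> c * (L * w * k * C + C * C2) * I / w"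
      by (intro ennreal_le_divide_mult) (use w as in auto)
    also have "\<dots> = CC * I" by (simp add: CC_def divide_ennreal_def mult_ac)
    finally show "(\<integral>\<^sup>+x. \<integral>\<^sup>+z. ennreal (\<bar>f x - f z\<bar> powr p) \<partial>N \<partial>M) \<le> CC * (\<integral>\<^sup>+x\<in>\<Omega>. ennreal (norm (Df x) powr p) \<partial>lborel)"
      by (simp add: h_def I_def G_def)
  qed
qed

section \<open>Hausdorff measure of graphs\<close>

definition perp :: "'a::euclidean_space \<Rightarrow> 'a \<Rightarrow> 'a" where
  "perp n z = z - (z \<bullet> n) *\<^sub>R n"

lemma perp_simps:
  assumes "norm n = 1"
  shows "perp n (x + t *\<^sub>R n) = perp n x" "perp n x \<bullet> n = 0" "perp n (x - y) = perp n x - perp n y"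
    "perp n (x + y) = perp n x + perp n y" "perp n (c *\<^sub>R x) = c *\<^sub>R perp n x" "perp (- n) x = perp n x"
  using assms by (auto simp: perp_def algebra_simps inner_diff_left inner_add_left dot_square_norm)

lemma norm_perp_add:
  assumes "norm n = 1"
  shows "(norm (perp n x + t *\<^sub>R n))\<^sup>2 = (norm (perp n x))\<^sup>2 + t\<^sup>2"
proof -
  have "n \<bullet> n = 1" "perp n x \<bullet> n = 0" "n \<bullet> perp n x = 0"
    using assms perp_simps(2)[OF assms, of x] by (simp_all add: dot_square_norm inner_commute)
  then show ?thesis
    unfolding power2_norm_eq_inner by (simp add: inner_add_left inner_add_right power2_eq_square)
qed

lemma norm_perp_le:
  assumes "norm n = 1" shows "norm (perp n x) \<le> norm x" "norm (perp n x) \<le> norm (perp n x + t *\<^sub>R n)"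
proof -
  show *: "norm (perp n x) \<le> norm (perp n x + t *\<^sub>R n)" for t
    by (rule power2_le_imp_le) (auto simp: norm_perp_add[OF assms])
  show "norm (perp n x) \<le> norm x" using *[of "x \<bullet> n"] by (simp add: perp_def)
qed

text \<open>The balls of radius r around P are disjoint and lie in one ball of radius R; the volume
  of the unit ball cancels from the comparison.\<close>

lemma card_packing_le:
  fixes P :: "'a::euclidean_space set"
  assumes P: "finite P" "r > 0" "\<And>x y. x \<in> P \<Longrightarrow> y \<in> P \<Longrightarrow> x \<noteq> y \<Longrightarrow> dist x y \<ge> 2 * r"
    and R: "\<And>x. x \<in> P \<Longrightarrow> dist c x + r \<le> R" "R > 0"
  shows "real (card P) * r ^ DIM('a) \<le> R ^ DIM('a)"
proof -
  have fm: "ball x r \<in> fmeasurable lborel" for x :: 'a and r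
    using emeasure_lborel_ball_finite[of x r] by (auto simp: fmeasurable_def)
  have "measure lborel (\<Union>x\<in>P. ball x r) = (\<Sum>x\<in>P. measure lborel (ball x r))"
  proof (rule measure_UNION')
    show "pairwise (\<lambda>i j. disjnt (ball i r) (ball j r)) P"
    proof (rule pairwiseI)
      fix x y assume "x \<in> P" "y \<in> P" "x \<noteq> y"
      then have "dist x y \<ge> 2 * r" using P by auto
      then show "disjnt (ball x r) (ball y r)"
        using dist_triangle_less_add[of x _ r y r] by (force simp: disjnt_def)
    qed
  qed (use P fm in auto)
  moreover have "measure lborel (\<Union>x\<in>P. ball x r) \<le> measure lborel (ball c R)"
  proof (rule measure_mono_fmeasurable)
    show "(\<Union>x\<in>P. ball x r) \<subseteq> ball c R"
    proof
      fix z assume "z \<in> (\<Union>x\<in>P. ball x r)"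
      then obtain x where "x \<in> P" "dist x z < r" by auto
      with R(1)[of x] dist_triangle[of c z x] show "z \<in> ball c R" by auto
    qed
  qed (use fm in \<open>auto intro!: borel_open open_UN\<close>)
  moreover have mb: "measure lborel (ball x \<rho>) = unit_ball_vol DIM('a) * \<rho> ^ DIM('a)" if "\<rho> > 0" for x :: 'a and \<rho>
    using content_ball[of \<rho> x] that by simp
  have "(\<Sum>x\<in>P. measure lborel (ball x r)) = unit_ball_vol DIM('a) * (real (card P) * r ^ DIM('a))"
    unfolding mb[OF P(2)] by simp
  ultimately have "unit_ball_vol DIM('a) * (real (card P) * r ^ DIM('a)) \<le> unit_ball_vol DIM('a) * R ^ DIM('a)"
    unfolding mb[OF R(2)] by linarith
  moreover have "unit_ball_vol DIM('a) > 0" by simp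
  ultimately show ?thesis by (rule mult_left_le_imp_le)
qed

text \<open>S is a piece of a Lipschitz graph over the hyperplane orthogonal to n: the projection
  has an inverse with Lipschitz constant \<Lambda>. In this form the property passes to subsets at
  once.\<close>

definition graph_like :: "'a::euclidean_space \<Rightarrow> real \<Rightarrow> 'a set \<Rightarrow> bool" where
  "graph_like n \<Lambda> S \<longleftrightarrow> norm n = 1 \<and> \<Lambda> \<ge> 1 \<and> (\<forall>x\<in>S. \<forall>y\<in>S. norm (x - y) \<le> \<Lambda> * norm (perp n (x - y)))"

text \<open>Stacking translates of the projected points along \<open>n\<close> turns the \<open>(d - 1)\<close>-dimensional
  packing problem into a \<open>d\<close>-dimensional one, so no hyperplane type is needed.\<close>
lemma card_separated_graph_le:
  fixes T :: "'a::euclidean_space set"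
  assumes g: "graph_like n \<Lambda> T" and T: "finite T" and \<delta>: "0 < \<delta>" "\<delta> \<le> \<eta>"
    and sep: "\<And>x y. x \<in> T \<Longrightarrow> y \<in> T \<Longrightarrow> x \<noteq> y \<Longrightarrow> dist x y \<ge> \<delta>"
    and \<eta>: "\<And>x y. x \<in> T \<Longrightarrow> y \<in> T \<Longrightarrow> norm (perp n (x - y)) \<le> \<eta>"
  shows "real (card T) * \<delta> ^ (DIM('a) - 1) \<le> (8 ^ DIM('a) * \<Lambda> ^ (DIM('a) - 1)) * \<eta> ^ (DIM('a) - 1)"
proof (cases "T = {}")
  case True
  then show ?thesis using \<delta> g by (auto simp: graph_like_def)
next
  case False
  then obtain t0 where t0: "t0 \<in> T" by auto
  have n: "norm n = 1" and \<Lambda>: "\<Lambda> \<ge> 1" using g by (auto simp: graph_like_def)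
  \<comment> \<open>Points of T at distance at least \<delta> have projections at distance at least
    \<delta>/\<Lambda>.\<close>
  define \<rho> where "\<rho> = \<delta> / \<Lambda>"
  have \<rho>: "0 < \<rho>" "\<rho> \<le> \<delta>" using \<delta> \<Lambda> by (auto simp: \<rho>_def field_simps mult_le_cancel_left1)
  \<comment> \<open>m layers at spacing \<rho> give a stack whose height is comparable to the width
    \<eta> of the projection; the factor m >= \<eta>/\<rho> lowers the exponent in the volume
    comparison from d to d - 1.\<close>
  define m where "m = nat \<lceil>\<eta> / \<rho>\<rceil>"
  have \<eta>\<rho>: "\<eta> / \<rho> \<ge> 0" using \<delta> \<rho> by auto
  have m: "\<eta> / \<rho> \<le> real m" "real m \<le> \<eta> / \<rho> + 1"
    unfolding m_def using \<eta>\<rho> by linarith+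
  define c where "c tk = perp n (fst tk) + (real (snd tk) * \<rho>) *\<^sub>R n" for tk :: "'a \<times> nat"
  have psep: "norm (perp n (x - y)) \<ge> \<rho>" if "x \<in> T" "y \<in> T" "x \<noteq> y" for x y
  proof -
    have "\<delta> \<le> norm (x - y)" using sep[OF that] by (simp add: dist_norm)
    also have "\<dots> \<le> \<Lambda> * norm (perp n (x - y))" using g that by (auto simp: graph_like_def)
    finally show ?thesis using \<Lambda> by (simp add: \<rho>_def field_simps)
  qed
  have csep: "dist (c a) (c b) \<ge> \<rho>" if "a \<in> T \<times> {..<m}" "b \<in> T \<times> {..<m}" "a \<noteq> b" for a b
  proof (cases "fst a = fst b")
    case True
    then have "snd a \<noteq> snd b" using that by (auto simp: prod_eq_iff)
    then have "1 \<le> \<bar>real (snd a) - real (snd b)\<bar>" by linarith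
    then have "\<rho> \<le> \<bar>real (snd a) - real (snd b)\<bar> * \<rho>" using \<rho> by simp
    also have "\<dots> = dist (c a) (c b)"
      using True n \<rho> by (simp add: c_def dist_norm scaleR_diff_left[symmetric] abs_mult left_diff_distrib[symmetric])
    finally show ?thesis .
  next
    case False
    have "\<rho> \<le> norm (perp n (fst a - fst b))" using psep that False by auto
    also have "\<dots> \<le> norm (perp n (fst a - fst b) + (real (snd a) * \<rho> - real (snd b) * \<rho>) *\<^sub>R n)"
      by (rule norm_perp_le[OF n])
    also have "\<dots> = dist (c a) (c b)"
      by (simp add: c_def dist_norm perp_simps[OF n] algebra_simps)
    finally show ?thesis .
  qed
  have inj: "inj_on c (T \<times> {..<m})"
    using csep \<rho> by (intro inj_onI) (metis dist_self not_le)
  have "real (card (c ` (T \<times> {..<m}))) * (\<rho> / 2) ^ DIM('a) \<le> (4 * \<eta>) ^ DIM('a)"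
  proof (rule card_packing_le)
    fix z assume "z \<in> c ` (T \<times> {..<m})"
    then obtain t k where z: "z = c (t, k)" "t \<in> T" "k < m" by auto
    have "dist (perp n t0) z = norm (perp n (t0 - t) - (real k * \<rho>) *\<^sub>R n)"
      by (simp add: z c_def dist_norm perp_simps[OF n] algebra_simps)
    also have "\<dots> \<le> norm (perp n (t0 - t)) + norm ((real k * \<rho>) *\<^sub>R n)" by (rule norm_triangle_ineq4)
    also have "\<dots> \<le> \<eta> + real m * \<rho>" using \<eta>[OF t0 z(2)] z n \<rho> by (intro add_mono) auto
    also have "\<dots> \<le> \<eta> + (\<eta> / \<rho> + 1) * \<rho>" using m \<rho> by (intro add_mono mult_right_mono) auto
    also have "\<dots> = 2 * \<eta> + \<rho>" using \<rho> by (simp add: field_simps)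
    finally show "dist (perp n t0) z + \<rho> / 2 \<le> 4 * \<eta>" using \<rho> \<delta> by auto
  next
    fix x y assume "x \<in> c ` (T \<times> {..<m})" "y \<in> c ` (T \<times> {..<m})" "x \<noteq> y"
    then obtain a b where "a \<in> T \<times> {..<m}" "b \<in> T \<times> {..<m}" "x = c a" "y = c b" "a \<noteq> b" by auto
    then show "dist x y \<ge> 2 * (\<rho> / 2)" using csep[of a b] by simp
  qed (use T \<rho> \<delta> in auto)
  also have "card (c ` (T \<times> {..<m})) = card T * m" using inj by (simp add: card_image card_cartesian_product)
  finally have 1: "real (card T) * real m * (\<rho> / 2) ^ DIM('a) \<le> (4 * \<eta>) ^ DIM('a)" by simp
  obtain d where d: "DIM('a) = Suc d" using DIM_positive[where 'a='a] by (metis Suc_pred)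
  have "real (card T) * (\<eta> / \<rho>) * (\<rho> / 2) ^ DIM('a) \<le> real (card T) * real m * (\<rho> / 2) ^ DIM('a)"
    using m \<rho> by (intro mult_right_mono mult_left_mono) auto
  with 1 have "real (card T) * (\<eta> / \<rho>) * (\<rho> / 2) ^ Suc d \<le> (4 * \<eta>) ^ Suc d" by (simp add: d)
  moreover have "real (card T) * (\<eta> / \<rho>) * (\<rho> / 2) ^ Suc d = (\<eta> / 2 ^ Suc d) * (real (card T) * \<rho> ^ d)"
    using \<rho> by (simp add: power_divide field_simps)
  moreover have "(4 * \<eta>) ^ Suc d = (\<eta> / 2 ^ Suc d) * (8 ^ Suc d * \<eta> ^ d)"
  proof -
    have "(8::real) ^ Suc d = 4 ^ Suc d * 2 ^ Suc d" by (simp add: power_mult_distrib[symmetric])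
    then show ?thesis by (simp add: power_mult_distrib field_simps)
  qed
  ultimately have "(\<eta> / 2 ^ Suc d) * (real (card T) * \<rho> ^ d) \<le> (\<eta> / 2 ^ Suc d) * (8 ^ Suc d * \<eta> ^ d)" by linarith
  then have "real (card T) * \<rho> ^ d \<le> 8 ^ Suc d * \<eta> ^ d"
    using \<delta> by (subst (asm) mult_le_cancel_left_pos) auto
  then have "\<Lambda> ^ d * (real (card T) * \<rho> ^ d) \<le> \<Lambda> ^ d * (8 ^ Suc d * \<eta> ^ d)"
    using \<Lambda> by (intro mult_left_mono) auto
  moreover have "\<Lambda> ^ d * \<rho> ^ d = \<delta> ^ d" using \<Lambda> by (simp add: \<rho>_def power_divide)
  ultimately show ?thesis by (simp add: d mult_ac)
qed

text \<open>The bound N provides a separated subset of largest cardinality; it is a \<delta>-net,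
  since a point of S farther than \<delta> from it could be added.\<close>

lemma maximal_separated_subset:
  fixes S :: "'a::metric_space set" and N :: real
  assumes \<delta>: "\<delta> > 0" and bd: "\<And>T. T \<subseteq> S \<Longrightarrow> finite T \<Longrightarrow> (\<And>x y. x \<in> T \<Longrightarrow> y \<in> T \<Longrightarrow> x \<noteq> y \<Longrightarrow> dist x y \<ge> \<delta>) \<Longrightarrow> real (card T) \<le> N"
  obtains T where "T \<subseteq> S" "finite T" "\<And>x y. x \<in> T \<Longrightarrow> y \<in> T \<Longrightarrow> x \<noteq> y \<Longrightarrow> dist x y \<ge> \<delta>"
    "S \<subseteq> (\<Union>t\<in>T. cball t \<delta>)"
proof -
  define Q where "Q T \<longleftrightarrow> T \<subseteq> S \<and> finite T \<and> (\<forall>x\<in>T. \<forall>y\<in>T. x \<noteq> y \<longrightarrow> dist x y \<ge> \<delta>)" for T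
  have 1: "Q {}" by (simp add: Q_def)
  have 2: "\<forall>T. Q T \<longrightarrow> card T < Suc (nat \<lfloor>N\<rfloor>)"
    using bd unfolding Q_def by (simp add: le_nat_floor less_Suc_eq_le)
  obtain T where "Q T \<and> (\<forall>T'. Q T' \<longrightarrow> card T' \<le> card T)"
    using ex_has_greatest_nat[OF 1 2] ..
  then have T: "Q T" "\<And>T'. Q T' \<Longrightarrow> card T' \<le> card T" by auto
  show ?thesis
  proof
    show "T \<subseteq> S" "finite T" using T by (auto simp: Q_def)
    show "\<And>x y. x \<in> T \<Longrightarrow> y \<in> T \<Longrightarrow> x \<noteq> y \<Longrightarrow> dist x y \<ge> \<delta>" using T by (auto simp: Q_def)
    show "S \<subseteq> (\<Union>t\<in>T. cball t \<delta>)"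
    proof
      fix x assume x: "x \<in> S"
      show "x \<in> (\<Union>t\<in>T. cball t \<delta>)"
      proof (rule ccontr)
        assume "x \<notin> (\<Union>t\<in>T. cball t \<delta>)"
        then have far: "\<And>t. t \<in> T \<Longrightarrow> dist t x > \<delta>" by auto
        show False
        proof (cases "x \<in> T")
          case False
          have "Q (insert x T)" using T(1) x far by (force simp: Q_def dist_commute)
          from T(2)[OF this] False show False using T(1) by (simp add: Q_def)
        next
          case True
          with far[OF this] \<delta> show False by simp
        qed
      qed
    qed
  qed
qed

lemma haus_coef_nonneg: "haus_coef s \<ge> 0"
  unfolding haus_coef_def by (intro divide_nonneg_pos Gamma_real_pos) (auto simp: add_nonneg_pos)

text \<open>Balls of radius \<delta> around a maximal \<delta>-separated subset cover S. Their
  number is at most a constant times (\<eta>/\<delta>)^(d-1), so the sum of the (d-1)-st powers of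
  the radii is bounded independently of \<delta>.\<close>

lemma haus_outer_graph_le:
  fixes S :: "'a::euclidean_space set"
  assumes g: "graph_like n \<Lambda> S" and \<eta>: "\<eta> > 0" "\<And>x y. x \<in> S \<Longrightarrow> y \<in> S \<Longrightarrow> norm (perp n (x - y)) \<le> \<eta>"
  shows "haus_outer (DIM('a) - 1) S \<le> ennreal (haus_coef (DIM('a) - 1) * (8 ^ DIM('a) * \<Lambda> ^ (DIM('a) - 1)) * \<eta> ^ (DIM('a) - 1))"
proof -
  define s where "s = DIM('a) - 1"
  define K where "K = 8 ^ DIM('a) * \<Lambda> ^ s"
  show ?thesis unfolding haus_outer_def s_def[symmetric] K_def[symmetric]
  proof (rule SUP_least)
    fix \<delta>0 :: real assume \<delta>0: "\<delta>0 \<in> {0<..}"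
    \<comment> \<open>The balls have diameter 2 \<delta>, which must not exceed \<delta>0, and the
      packing bound requires \<delta> <= \<eta>.\<close>
    define \<delta> where "\<delta> = min (\<delta>0 / 2) \<eta>"
    have \<delta>: "0 < \<delta>" "\<delta> \<le> \<eta>" "2 * \<delta> \<le> \<delta>0" using \<delta>0 \<eta> by (auto simp: \<delta>_def)
    have bd: "real (card T) * \<delta> ^ s \<le> K * \<eta> ^ s" if "T \<subseteq> S" "finite T" "\<And>x y. x \<in> T \<Longrightarrow> y \<in> T \<Longrightarrow> x \<noteq> y \<Longrightarrow> dist x y \<ge> \<delta>" for T
    proof -
      have "graph_like n \<Lambda> T" using g that(1) unfolding graph_like_def by blast
      then show ?thesis unfolding K_def s_def
        using that \<eta>(2)[OF subsetD[OF that(1)] subsetD[OF that(1)]] by (intro card_separated_graph_le \<delta>) auto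
    qed
    obtain T where T: "T \<subseteq> S" "finite T" "\<And>x y. x \<in> T \<Longrightarrow> y \<in> T \<Longrightarrow> x \<noteq> y \<Longrightarrow> dist x y \<ge> \<delta>"
      "S \<subseteq> (\<Union>t\<in>T. cball t \<delta>)"
    proof (rule maximal_separated_subset[where S = S and \<delta> = \<delta> and N = "K * \<eta> ^ s / \<delta> ^ s"])
      show "real (card T) \<le> K * \<eta> ^ s / \<delta> ^ s" if "T \<subseteq> S" "finite T" "\<And>x y. x \<in> T \<Longrightarrow> y \<in> T \<Longrightarrow> x \<noteq> y \<Longrightarrow> dist x y \<ge> \<delta>" for T
        using bd[OF that] \<delta>(1) by (simp add: pos_le_divide_eq)
    qed (use \<delta>(1) in auto)
    obtain e where e: "bij_betw e {0..<card T} T" using ex_bij_betw_nat_finite[OF T(2)] by auto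
    \<comment> \<open>The padding sets are empty; the case distinction in \<open>haus_outer\<close>
      makes them contribute 0 also for s = 0, where the power would be 1.\<close>
    define C where "C i = (if i < card T then cball (e i) \<delta> else {})" for i
    have "S \<subseteq> (\<Union>i. C i)"
    proof
      fix x assume "x \<in> S"
      then obtain t where t: "t \<in> T" "x \<in> cball t \<delta>" using T by blast
      then obtain i where "i < card T" "e i = t" using bij_betw_imp_surj_on[OF e] by (metis atLeastLessThan_iff imageE)
      with t show "x \<in> (\<Union>i. C i)" by (auto simp: C_def)
    qed
    moreover have "bounded (C i) \<and> diameter (C i) \<le> \<delta>0" for i
      using \<delta> \<delta>0 by (auto simp: C_def diameter_cball)
    ultimately have "(INF C\<in>{C :: nat \<Rightarrow> 'a set. S \<subseteq> (\<Union>n. C n) \<and> (\<forall>n. bounded (C n) \<and> diameter (C n) \<le> \<delta>0)}.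
        (\<Sum>n. ennreal (haus_coef s * (if C n = {} then 0 else (diameter (C n) / 2) ^ s))))
      \<le> (\<Sum>n. ennreal (haus_coef s * (if C n = {} then 0 else (diameter (C n) / 2) ^ s)))"
      by (intro INF_lower) auto
    also have "\<dots> = (\<Sum>n\<in>{..<card T}. ennreal (haus_coef s * (if C n = {} then 0 else (diameter (C n) / 2) ^ s)))"
      by (rule suminf_finite) (auto simp: C_def)
    also have "\<dots> = (\<Sum>n\<in>{..<card T}. ennreal (haus_coef s * \<delta> ^ s))"
      using \<delta>(1) by (intro sum.cong refl) (auto simp: C_def diameter_cball)
    also have "\<dots> = ennreal (real (card T) * (haus_coef s * \<delta> ^ s))"
      using haus_coef_nonneg[of s] \<delta>(1) by (simp add: ennreal_mult ennreal_of_nat_eq_real_of_nat)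
    also have "\<dots> \<le> ennreal (haus_coef s * K * \<eta> ^ s)"
    proof (rule ennreal_leI)
      have "haus_coef s * (real (card T) * \<delta> ^ s) \<le> haus_coef s * (K * \<eta> ^ s)"
        using bd[OF T(1-3)] haus_coef_nonneg[of s] by (intro mult_left_mono) auto
      then show "real (card T) * (haus_coef s * \<delta> ^ s) \<le> haus_coef s * K * \<eta> ^ s" by (simp add: mult_ac)
    qed
    finally show "(INF C\<in>{C :: nat \<Rightarrow> 'a set. S \<subseteq> (\<Union>n. C n) \<and> (\<forall>n. bounded (C n) \<and> diameter (C n) \<le> \<delta>0)}.
        (\<Sum>n. ennreal (haus_coef s * (if C n = {} then 0 else (diameter (C n) / 2) ^ s))))
      \<le> ennreal (haus_coef s * K * \<eta> ^ s)" .
  qed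
qed

section \<open>Surface measure transported along a direction\<close>

lemma sets_hausdorff_measure[simp, measurable_cong]: "sets (hausdorff_measure s) = sets borel"
  by (simp add: hausdorff_measure_def sets_measure_of_conv)
    (metis sets.sigma_sets_eq space_borel)

lemma space_hausdorff_measure[simp]: "space (hausdorff_measure s) = UNIV"
  by (simp add: hausdorff_measure_def space_measure_of_conv)

text \<open>\<open>measure_of\<close> yields either the given set function or zero, and the bound is
  true in both cases.\<close>

lemma emeasure_hausdorff_le: "emeasure (hausdorff_measure s) A \<le> haus_outer s A"
  unfolding hausdorff_measure_def by (auto simp: emeasure_measure_of_conv)

text \<open>For each t the translation by t e preserves Lebesgue measure, so every slice contributes
  at most the full integral of G.\<close>

lemma flow_bound_lborel:
  fixes E :: "'a::euclidean_space set"
  assumes E: "E \<in> sets borel" and s: "s > 0"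
  shows "flow_bound (meas_on lborel E) e s (ennreal s)"
  unfolding flow_bound_def
proof
  fix G :: "'a \<Rightarrow> ennreal" assume [measurable]: "G \<in> borel_measurable borel"
  note [measurable] = E
  have "(\<integral>\<^sup>+x. (\<integral>\<^sup>+t\<in>{0<..<s}. G (x + t *\<^sub>R e) \<partial>lborel) \<partial>meas_on lborel E)
    = (\<integral>\<^sup>+x\<in>E. (\<integral>\<^sup>+t\<in>{0<..<s}. G (x + t *\<^sub>R e) \<partial>lborel) \<partial>lborel)"
    by (rule nn_integral_meas_on) auto
  also have "\<dots> \<le> (\<integral>\<^sup>+x. (\<integral>\<^sup>+t\<in>{0<..<s}. G (x + t *\<^sub>R e) \<partial>lborel) \<partial>lborel)"
    by (intro nn_integral_mono) (auto split: split_indicator)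
  also have "\<dots> = (\<integral>\<^sup>+t. (\<integral>\<^sup>+x. G (x + t *\<^sub>R e) * indicator {0<..<s} t \<partial>lborel) \<partial>lborel)"
    by (rule lborel_pair.Fubini'[symmetric]) measurable
  also have "\<dots> = (\<integral>\<^sup>+t. (\<integral>\<^sup>+x. G (t *\<^sub>R e + x) \<partial>lborel) * indicator {0<..<s} t \<partial>lborel)"
    by (subst nn_integral_multc) (auto simp: add.commute)
  also have "\<dots> = (\<integral>\<^sup>+t. (\<integral>\<^sup>+x. G x \<partial>lborel) * indicator {0<..<s} t \<partial>lborel)"
    by (subst nn_integral_lborel_translate) auto
  also have "\<dots> = ennreal s * (\<integral>\<^sup>+x. G x \<partial>lborel)"
    using s by (subst nn_integral_cmult_indicator) (auto simp: mult.commute)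
  finally show "(\<integral>\<^sup>+x. (\<integral>\<^sup>+t\<in>{0<..<s}. G (x + t *\<^sub>R e) \<partial>lborel) \<partial>meas_on lborel E) \<le> ennreal s * (\<integral>\<^sup>+z. G z \<partial>lborel)" .
qed

text \<open>A set is covered by countably many non-overlapping cubes whose total volume exceeds its
  measure by arbitrarily little, so a bound on cubes extends to all Borel sets inside a fixed
  box.\<close>

lemma emeasure_le_of_cubes:
  fixes \<nu> :: "'a::euclidean_space measure" and C :: ennreal
  assumes sets: "sets \<nu> = sets borel" and C: "C < top"
    and cubes: "\<And>u v l. l \<ge> 0 \<Longrightarrow> (\<And>i. i \<in> Basis \<Longrightarrow> v \<bullet> i - u \<bullet> i = l) \<Longrightarrow> emeasure \<nu> (cbox u v) \<le> C * ennreal (l ^ DIM('a))"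
    and A: "A \<in> sets borel" "A \<subseteq> cbox (- R *\<^sub>R One) (R *\<^sub>R One)" and R: "R > 0"
  shows "emeasure \<nu> A \<le> C * emeasure lborel A"
proof (rule ennreal_le_epsilon)
  fix e :: real assume e: "0 < e" and fin: "C * emeasure lborel A < top"
  obtain c where c: "C = ennreal c" "c \<ge> 0" using C by (cases C) auto
  \<comment> \<open>The summand 1 covers c = 0 and gives c * e' <= e.\<close>
  define e' where "e' = e / (c + 1)"
  have e': "e' > 0" using e c by (simp add: e'_def)
  have bA: "bounded A" using A(2) bounded_cbox bounded_subset by blast
  have lmA: "A \<in> lmeasurable" using A bA by (auto intro: bounded_set_imp_lmeasurable)
  define a b where "a = - R *\<^sub>R (One::'a)" and "b = R *\<^sub>R (One::'a)"
  have abi: "b \<bullet> i - a \<bullet> i = 2 * R" if "i \<in> Basis" for i using that by (simp add: a_def b_def)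
  have bne: "box a b \<noteq> {}" using R by (auto simp: box_ne_empty a_def b_def)
  obtain \<D> where D: "countable \<D>"
    "\<And>K. K \<in> \<D> \<Longrightarrow> K \<subseteq> cbox a b \<and> K \<noteq> {} \<and> (\<exists>c d. K = cbox c d)"
    "pairwise (\<lambda>A B. interior A \<inter> interior B = {}) \<D>"
    "\<And>u v. cbox u v \<in> \<D> \<Longrightarrow> \<exists>n. \<forall>i \<in> Basis. v \<bullet> i - u \<bullet> i = (b \<bullet> i - a \<bullet> i)/2^n"
    "\<And>K. \<lbrakk>K \<in> \<D>; box a b \<noteq> {}\<rbrakk> \<Longrightarrow> interior K \<noteq> {}"
    "A \<subseteq> \<Union>\<D>" "\<Union>\<D> \<in> lmeasurable" "measure lebesgue (\<Union>\<D>) \<le> measure lebesgue A + e'"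
    using measurable_outer_intervals_bounded[OF lmA _ e', of a b] A(2) unfolding a_def b_def by metis
  have cb: "K \<in> sets borel \<and> emeasure \<nu> K \<le> C * emeasure lborel (interior K)" if K: "K \<in> \<D>" for K
  proof -
    obtain u v where uv: "K = cbox u v" using D(2)[OF K] by auto
    obtain n where n: "\<forall>i \<in> Basis. v \<bullet> i - u \<bullet> i = 2 * R / 2^n" using D(4)[of u v] K uv abi by auto
    have "v \<bullet> i - u \<bullet> i \<ge> 0" if "i \<in> Basis" for i using n that R by simp
    then have "emeasure lborel (interior K) = ennreal (\<Prod>i\<in>Basis. v \<bullet> i - u \<bullet> i)"
      unfolding uv by (simp add: interior_cbox emeasure_lborel_box_eq inner_diff_left)
    also have "(\<Prod>i\<in>Basis. v \<bullet> i - u \<bullet> i) = (2 * R / 2 ^ n) ^ DIM('a)" using n by simp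
    finally have "emeasure lborel (interior K) = ennreal ((2 * R / 2 ^ n) ^ DIM('a))" .
    moreover have "emeasure \<nu> K \<le> C * ennreal ((2 * R / 2 ^ n) ^ DIM('a))"
      unfolding uv by (rule cubes) (use n R in auto)
    ultimately show ?thesis by (simp add: uv)
  qed
  define F where "F n = (if n \<in> to_nat_on \<D> ` \<D> then from_nat_into \<D> n else {})" for n
  have FD: "F n = {} \<or> F n \<in> \<D>" for n
    by (auto simp: F_def D(1))
  have Fin: "emeasure \<nu> (F n) \<le> C * emeasure lborel (interior (F n))" "F n \<in> sets borel" for n
    using FD[of n] cb[of "F n"] by auto
  have UF: "\<Union>\<D> = (\<Union>n. F n)"
  proof
    show "\<Union>\<D> \<subseteq> (\<Union>n. F n)"
    proof
      fix x assume "x \<in> \<Union>\<D>"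
      then obtain K where K: "K \<in> \<D>" "x \<in> K" by auto
      then have "F (to_nat_on \<D> K) = K" using D(1) by (auto simp: F_def)
      with K show "x \<in> (\<Union>n. F n)" by blast
    qed
    show "(\<Union>n. F n) \<subseteq> \<Union>\<D>" using FD by blast
  qed
  have dj: "disjoint_family (\<lambda>n. interior (F n))"
    unfolding disjoint_family_on_def
  proof (intro ballI impI)
    fix m n :: nat assume "m \<noteq> n"
    show "interior (F m) \<inter> interior (F n) = {}"
    proof (cases "m \<in> to_nat_on \<D> ` \<D> \<and> n \<in> to_nat_on \<D> ` \<D>")
      case True
      then obtain K L where KL: "K \<in> \<D>" "L \<in> \<D>" "m = to_nat_on \<D> K" "n = to_nat_on \<D> L" by auto
      with \<open>m \<noteq> n\<close> have "K \<noteq> L" by auto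
      with KL D(3) have "interior K \<inter> interior L = {}" by (auto simp: pairwise_def)
      with KL D(1) show ?thesis by (auto simp: F_def)
    qed (auto simp: F_def)
  qed
  \<comment> \<open>Neighbouring cubes share faces: \<nu> is summed over the closed cubes by
    subadditivity, Lebesgue measure over their disjoint interiors.\<close>
  have "emeasure \<nu> A \<le> emeasure \<nu> (\<Union>n. F n)"
    using D(6) UF Fin sets by (intro emeasure_mono) auto
  also have "\<dots> \<le> (\<Sum>n. emeasure \<nu> (F n))"
    using Fin sets by (intro emeasure_subadditive_countably) auto
  also have "\<dots> \<le> (\<Sum>n. C * emeasure lborel (interior (F n)))"
    using Fin by (intro suminf_le) auto
  also have "\<dots> = C * emeasure lborel (\<Union>n. interior (F n))"
    using suminf_emeasure[OF _ dj, of lborel] by (simp add: ennreal_suminf_cmult image_subset_iff)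
  also have "\<dots> \<le> C * emeasure lebesgue (\<Union>\<D>)"
  proof (intro mult_left_mono)
    have "emeasure lborel (\<Union>n. interior (F n)) = emeasure lebesgue (\<Union>n. interior (F n))"
      by (simp add: emeasure_completion)
    also have "\<dots> \<le> emeasure lebesgue (\<Union>\<D>)"
    proof (rule emeasure_mono)
      show "(\<Union>n. interior (F n)) \<subseteq> \<Union>\<D>" unfolding UF using interior_subset by blast
    qed (use D(7) in auto)
    finally show "emeasure lborel (\<Union>n. interior (F n)) \<le> emeasure lebesgue (\<Union>\<D>)" .
  qed auto
  also have "\<dots> \<le> C * (emeasure lborel A + ennreal e')"
  proof (intro mult_left_mono)
    have "emeasure lebesgue (\<Union>\<D>) = ennreal (measure lebesgue (\<Union>\<D>))"
      using D(7) by (intro emeasure_eq_measure2)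
    also have "\<dots> \<le> ennreal (measure lebesgue A + e')" by (intro ennreal_leI D(8))
    also have "\<dots> = emeasure lebesgue A + ennreal e'"
      using lmA e' by (simp add: emeasure_eq_measure2)
    also have "emeasure lebesgue A = emeasure lborel A" using A by simp
    finally show "emeasure lebesgue (\<Union>\<D>) \<le> emeasure lborel A + ennreal e'" .
  qed auto
  also have "\<dots> = C * emeasure lborel A + C * ennreal e'" by (simp add: distrib_left)
  also have "\<dots> \<le> C * emeasure lborel A + ennreal e"
  proof (intro add_left_mono)
    have "c * e' \<le> e" using c e by (simp add: e'_def field_simps)
    then show "C * ennreal e' \<le> ennreal e" using c e' by (simp add: ennreal_mult[symmetric] ennreal_leI)
  qed
  finally show "emeasure \<nu> A \<le> C * emeasure lborel A + ennreal e" .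
qed

text \<open>Let \<nu> be the image of surface measure times dt. A Borel set of diameter \<eta> is
  reached only from base points whose projections lie in a ball of radius \<eta>, a piece of surface
  of measure O(\<eta>^(d-1)), and each of these spends time at most 2 \<eta> in it. Hence \<nu> is
  at most a constant times \<eta>^d on such sets, in particular on cubes, and
  \<open>emeasure_le_of_cubes\<close> turns this into domination by Lebesgue measure.\<close>

lemma flow_bound_surface:
  fixes S :: "'a::euclidean_space set"
  defines "H \<equiv> hausdorff_measure (DIM('a) - 1) :: 'a measure"
  assumes g: "graph_like n \<Lambda> S" and S: "S \<in> sets borel" "bounded S" and s: "s > 0"
  shows "emeasure H S < top" "\<exists>C<top. flow_bound (meas_on H S) n s C"
proof -
  have n: "norm n = 1" and \<Lambda>: "\<Lambda> \<ge> 1" using g by (auto simp: graph_like_def)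
  obtain \<rho> where \<rho>: "\<rho> > 0" "\<And>x. x \<in> S \<Longrightarrow> norm x \<le> \<rho>" using S(2) by (auto simp: bounded_pos)
  define q where "q = DIM('a) - 1"
  have d: "DIM('a) = Suc q" using DIM_positive[where 'a='a] by (simp add: q_def)
  define K where "K = haus_coef q * (8 ^ DIM('a) * \<Lambda> ^ q)"
  have K0: "K \<ge> 0" using haus_coef_nonneg[of q] \<Lambda> by (simp add: K_def)
  have Hle: "emeasure H S' \<le> ennreal (K * \<eta> ^ q)"
    if "S' \<subseteq> S" "\<eta> > 0" "\<And>x y. x \<in> S' \<Longrightarrow> y \<in> S' \<Longrightarrow> norm (perp n (x - y)) \<le> \<eta>" for S' \<eta>
  proof -
    have "graph_like n \<Lambda> S'" using g that(1) unfolding graph_like_def by blast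
    from haus_outer_graph_le[OF this that(2,3)] show ?thesis
      unfolding H_def q_def[symmetric] K_def by (intro order_trans[OF emeasure_hausdorff_le]) auto
  qed
  show fin: "emeasure H S < top"
  proof -
    have "norm (perp n (x - y)) \<le> 2 * \<rho>" if "x \<in> S" "y \<in> S" for x y
      using norm_perp_le(1)[OF n, of "x - y"] norm_triangle_ineq4[of x y] \<rho>(2)[OF that(1)] \<rho>(2)[OF that(2)] by linarith
    then have "emeasure H S \<le> ennreal (K * (2 * \<rho>) ^ q)" using \<rho> by (intro Hle) auto
    then show ?thesis using ennreal_less_top le_less_trans by blast
  qed
  have setsH: "sets H = sets borel" by (simp add: H_def)
  define M where "M = meas_on H S"
  define T where "T = meas_on lborel {0<..<s}"
  have M: "fin_borel M" unfolding M_def using fin S setsH by (intro fin_borel_meas_on) auto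
  have T: "fin_borel T" unfolding T_def by (intro fin_borel_lborel_on) auto
  interpret M: finite_measure M using M by simp
  interpret T: finite_measure T using T by simp
  have [measurable_cong]: "sets M = sets borel" "sets T = sets borel" "sets H = sets borel" using M T setsH by auto
  note [measurable] = S(1)
  define \<nu> where "\<nu> = distr (M \<Otimes>\<^sub>M T) borel (\<lambda>(x, t). x + t *\<^sub>R n)"
  have sets\<nu>: "sets \<nu> = sets borel" by (simp add: \<nu>_def)
  have int\<nu>: "(\<integral>\<^sup>+z. G z \<partial>\<nu>) = (\<integral>\<^sup>+x. (\<integral>\<^sup>+t\<in>{0<..<s}. G (x + t *\<^sub>R n) \<partial>lborel) \<partial>M)"
    if [measurable]: "G \<in> borel_measurable borel" for G
  proof -
    have "(\<integral>\<^sup>+z. G z \<partial>\<nu>) = (\<integral>\<^sup>+(x, t). G (x + t *\<^sub>R n) \<partial>(M \<Otimes>\<^sub>M T))"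
      unfolding \<nu>_def by (subst nn_integral_distr) (auto simp: case_prod_beta')
    also have "\<dots> = (\<integral>\<^sup>+x. (\<integral>\<^sup>+t. G (x + t *\<^sub>R n) \<partial>T) \<partial>M)"
      by (subst T.nn_integral_fst[symmetric]) auto
    also have "\<dots> = (\<integral>\<^sup>+x. (\<integral>\<^sup>+t\<in>{0<..<s}. G (x + t *\<^sub>R n) \<partial>lborel) \<partial>M)"
      unfolding T_def by (intro nn_integral_cong nn_integral_meas_on) auto
    finally show ?thesis .
  qed
  have key: "emeasure \<nu> A \<le> ennreal (K * 2 ^ DIM('a) * \<eta> ^ DIM('a))"
    if A[measurable]: "A \<in> sets borel" and \<eta>: "\<eta> > 0" "\<And>x y. x \<in> A \<Longrightarrow> y \<in> A \<Longrightarrow> norm (x - y) \<le> \<eta>" for A \<eta>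
  proof (cases "A = {}")
    case False
    then obtain x1 where x1: "x1 \<in> A" by auto
    \<comment> \<open>Moving along n does not change the projection, so a line through x can meet A
      only if the projection of x is within \<eta> of that of x1.\<close>
    define S' where "S' = {x \<in> S. norm (perp n (x - x1)) \<le> \<eta>}"
    have [measurable]: "S' \<in> sets borel" unfolding S'_def perp_def by measurable
    have inner: "(\<integral>\<^sup>+t\<in>{0<..<s}. indicator A (x + t *\<^sub>R n) \<partial>lborel) * indicator S x \<le> ennreal (2 * \<eta>) * indicator S' x" for x
    proof (cases "x \<in> S \<and> (\<exists>t. x + t *\<^sub>R n \<in> A)")
      case True
      then obtain t0 where t0: "x \<in> S" "x + t0 *\<^sub>R n \<in> A" by auto
      have "(x + t0 *\<^sub>R n) - x1 = (x - x1) + t0 *\<^sub>R n" by simp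
      then have "perp n (x - x1) = perp n ((x + t0 *\<^sub>R n) - x1)" by (simp only: perp_simps(1)[OF n])
      then have "norm (perp n (x - x1)) \<le> norm ((x + t0 *\<^sub>R n) - x1)" using norm_perp_le(1)[OF n] by metis
      then have xS': "x \<in> S'" using \<eta>(2)[OF t0(2) x1] t0 by (simp add: S'_def)
      have "(\<integral>\<^sup>+t\<in>{0<..<s}. indicator A (x + t *\<^sub>R n) \<partial>lborel) \<le> (\<integral>\<^sup>+t. indicator {t0 - \<eta>..t0 + \<eta>} t \<partial>lborel)"
      proof (rule nn_integral_mono)
        fix t :: real
        have "\<bar>t - t0\<bar> \<le> \<eta>" if "x + t *\<^sub>R n \<in> A"
          using \<eta>(2)[OF that t0(2)] n by (simp add: scaleR_diff_left[symmetric])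
        then show "indicator A (x + t *\<^sub>R n) * indicator {0<..<s} t \<le> (indicator {t0 - \<eta>..t0 + \<eta>} t :: ennreal)"
          by (auto simp: indicator_def abs_le_iff)
      qed
      also have "\<dots> = ennreal (2 * \<eta>)" using \<eta> by simp
      finally show ?thesis using t0 xS' by simp
    qed (auto simp: indicator_def)
    have S'd: "norm (perp n (x - y)) \<le> 2 * \<eta>" if "x \<in> S'" "y \<in> S'" for x y
    proof -
      have "perp n (x - y) = perp n (x - x1) - perp n (y - x1)" by (simp add: perp_simps[OF n])
      then show ?thesis using norm_triangle_ineq4[of "perp n (x - x1)" "perp n (y - x1)"] that by (simp add: S'_def)
    qed
    have "emeasure \<nu> A = (\<integral>\<^sup>+z. indicator A z \<partial>\<nu>)" using sets\<nu> by simp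
    also have "\<dots> = (\<integral>\<^sup>+x\<in>S. (\<integral>\<^sup>+t\<in>{0<..<s}. indicator A (x + t *\<^sub>R n) \<partial>lborel) \<partial>H)"
      by (subst int\<nu>, simp) (unfold M_def, rule nn_integral_meas_on, auto)
    also have "\<dots> \<le> (\<integral>\<^sup>+x. ennreal (2 * \<eta>) * indicator S' x \<partial>H)"
      by (intro nn_integral_mono inner)
    also have "\<dots> = ennreal (2 * \<eta>) * emeasure H S'" by (subst nn_integral_cmult_indicator) auto
    also have "\<dots> \<le> ennreal (2 * \<eta>) * ennreal (K * (2 * \<eta>) ^ q)"
      using \<eta> S'd by (intro mult_left_mono Hle) (auto simp: S'_def)
    also have "\<dots> = ennreal (K * 2 ^ DIM('a) * \<eta> ^ DIM('a))"
      using \<eta> K0 by (subst ennreal_mult[symmetric]) (auto simp: d power_mult_distrib mult_ac)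
    finally show ?thesis .
  qed simp
  \<comment> \<open>A cube of side l has diameter at most d l, which accounts for the factor
    d^d.\<close>
  define C where "C = ennreal (K * 2 ^ DIM('a) * real DIM('a) ^ DIM('a))"
  have cubes: "emeasure \<nu> (cbox u v) \<le> C * ennreal (l ^ DIM('a))"
    if l: "l \<ge> 0" and uv: "\<And>i. i \<in> Basis \<Longrightarrow> v \<bullet> i - u \<bullet> i = l" for u v l
  proof -
    have nl: "norm (x - y) \<le> real DIM('a) * l" if "x \<in> cbox u v" "y \<in> cbox u v" for x y
    proof -
      have "norm (x - y) \<le> (\<Sum>i\<in>Basis. \<bar>(x - y) \<bullet> i\<bar>)" by (rule norm_le_l1)
      also have "\<dots> \<le> (\<Sum>i\<in>(Basis::'a set). l)"
      proof (rule sum_mono)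
        fix i :: 'a assume i: "i \<in> Basis"
        show "\<bar>(x - y) \<bullet> i\<bar> \<le> l" using that i uv[OF i] by (auto simp: mem_box inner_diff_left abs_le_iff) (smt (verit))+
      qed
      finally show ?thesis by simp
    qed
    show ?thesis
    proof (cases "l = 0")
      case False
      have "emeasure \<nu> (cbox u v) \<le> ennreal (K * 2 ^ DIM('a) * (real DIM('a) * l) ^ DIM('a))"
        using nl False l by (intro key) auto
      also have "\<dots> = C * ennreal (l ^ DIM('a))"
        using K0 l by (simp add: C_def ennreal_mult[symmetric] power_mult_distrib mult_ac)
      finally show ?thesis .
    next
      case True
      \<comment> \<open>A degenerate cube is a single point; \<open>key\<close> asks for a positive
        diameter bound, so it is applied with e tending to 0.\<close>
      have "emeasure \<nu> (cbox u v) \<le> ennreal (K * 2 ^ DIM('a) * e ^ DIM('a))" if "e > 0" for e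
      proof (rule key)
        show "norm (x - y) \<le> e" if "x \<in> cbox u v" "y \<in> cbox u v" for x y
          using nl[OF that] True \<open>e > 0\<close> by (simp only: mult_zero_right)
      qed (use that in auto)
      then have lim: "\<forall>\<^sub>F e in at_right 0. emeasure \<nu> (cbox u v) \<le> ennreal (K * 2 ^ DIM('a) * e ^ DIM('a))"
        by (intro eventually_at_right_less[THEN eventually_mono]) auto
      have "((\<lambda>e::real. ennreal (K * 2 ^ DIM('a) * e ^ DIM('a))) \<longlongrightarrow> ennreal (K * 2 ^ DIM('a) * 0 ^ DIM('a))) (at_right 0)"
        by (intro tendsto_ennrealI tendsto_intros)
      from tendsto_lowerbound[OF this lim] show ?thesis by (simp add: d)
    qed
  qed
  \<comment> \<open>Flow lines of length s starting in S stay in the cube Q of half side R, so \<nu>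
    is carried by Q and the cube lemma, which speaks of bounded sets, is applied to A \<inter>
    Q.\<close>
  define R where "R = \<rho> + s"
  have R: "R > 0" using \<rho> s by (simp add: R_def)
  define Q where "Q = cbox (- R *\<^sub>R One) (R *\<^sub>R (One::'a))"
  have le: "emeasure \<nu> A \<le> C * emeasure lborel A" if A[measurable]: "A \<in> sets borel" for A
  proof -
    have [measurable]: "Q \<in> sets borel" by (simp add: Q_def)
    have "emeasure \<nu> A = (\<integral>\<^sup>+z. indicator A z \<partial>\<nu>)" using sets\<nu> by simp
    also have "\<dots> = (\<integral>\<^sup>+x\<in>S. (\<integral>\<^sup>+t\<in>{0<..<s}. indicator A (x + t *\<^sub>R n) \<partial>lborel) \<partial>H)"
      by (subst int\<nu>, simp) (unfold M_def, rule nn_integral_meas_on, auto)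
    also have "\<dots> \<le> (\<integral>\<^sup>+x\<in>S. (\<integral>\<^sup>+t\<in>{0<..<s}. indicator (A \<inter> Q) (x + t *\<^sub>R n) \<partial>lborel) \<partial>H)"
    proof (intro nn_integral_mono)
      fix x
      have "x + t *\<^sub>R n \<in> Q" if "x \<in> S" "t \<in> {0<..<s}" for t
      proof -
        have "norm (x + t *\<^sub>R n) \<le> R" using norm_triangle_ineq[of x "t *\<^sub>R n"] \<rho>(2)[OF that(1)] that n by (simp add: R_def)
        then have "\<bar>(x + t *\<^sub>R n) \<bullet> i\<bar> \<le> R" if "i \<in> Basis" for i using Basis_le_norm[OF that] order_trans by blast
        then show ?thesis by (auto simp: Q_def mem_box abs_le_iff minus_le_iff)
      qed
      then have "(\<integral>\<^sup>+t\<in>{0<..<s}. indicator A (x + t *\<^sub>R n) \<partial>lborel) \<le> (\<integral>\<^sup>+t\<in>{0<..<s}. indicator (A \<inter> Q) (x + t *\<^sub>R n) \<partial>lborel)" if "x \<in> S"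
        using that by (intro nn_integral_mono) (auto split: split_indicator)
      then show "(\<integral>\<^sup>+t\<in>{0<..<s}. indicator A (x + t *\<^sub>R n) \<partial>lborel) * indicator S x \<le> (\<integral>\<^sup>+t\<in>{0<..<s}. indicator (A \<inter> Q) (x + t *\<^sub>R n) \<partial>lborel) * indicator S x"
        by (auto split: split_indicator)
    qed
    also have "\<dots> = (\<integral>\<^sup>+z. indicator (A \<inter> Q) z \<partial>\<nu>)"
      by (subst int\<nu>, simp) (unfold M_def, rule nn_integral_meas_on[symmetric], auto)
    also have "\<dots> = emeasure \<nu> (A \<inter> Q)" using sets\<nu> by simp
    also have "\<dots> \<le> C * emeasure lborel (A \<inter> Q)"
      by (rule emeasure_le_of_cubes[OF sets\<nu> _ cubes _ _ R]) (auto simp: C_def Q_def)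
    also have "\<dots> \<le> C * emeasure lborel A" by (intro mult_left_mono emeasure_mono) auto
    finally show ?thesis .
  qed
  show "\<exists>C<top. flow_bound (meas_on H S) n s C"
  proof (intro exI[of _ C] conjI)
    show "C < top" by (simp add: C_def)
    show "flow_bound (meas_on H S) n s C" unfolding flow_bound_def
    proof
      fix G :: "'a \<Rightarrow> ennreal" assume G: "G \<in> borel_measurable borel"
      have "(\<integral>\<^sup>+z. G z \<partial>\<nu>) \<le> (\<integral>\<^sup>+z. G z \<partial>scale_measure C lborel)"
        using le sets\<nu> by (intro nn_integral_mono_measure) (auto simp: le_measure)
      also have "\<dots> = C * (\<integral>\<^sup>+z. G z \<partial>lborel)" using G by (simp add: nn_integral_scale_measure)
      finally show "(\<integral>\<^sup>+x. (\<integral>\<^sup>+t\<in>{0<..<s}. G (x + t *\<^sub>R n) \<partial>lborel) \<partial>meas_on H S) \<le> C * (\<integral>\<^sup>+z. G z \<partial>lborel)"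
        using int\<nu>[OF G] by (simp add: M_def)
    qed
  qed
qed

section \<open>The Poincare-trace inequality\<close>

lemma C1_fn_Lipschitz_on_cball:
  fixes \<psi> :: "'a::euclidean_space \<Rightarrow> real"
  assumes "C1_fn \<psi>"
  obtains L where "L \<ge> 0" "\<And>x y. x \<in> cball 0 r \<Longrightarrow> y \<in> cball 0 r \<Longrightarrow> \<bar>\<psi> x - \<psi> y\<bar> \<le> L * norm (x - y)"
proof -
  obtain G where G: "\<And>y. (\<psi> has_derivative (\<lambda>q. G y \<bullet> q)) (at y)" "continuous_on UNIV G"
    using assms by (auto simp: C1_fn_def)
  have "compact (G ` cball 0 r)"
    using G(2) by (intro compact_continuous_image) (auto intro: continuous_on_subset)
  then obtain L where L: "L > 0" "\<And>y. y \<in> cball 0 r \<Longrightarrow> norm (G y) \<le> L"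
    by (force simp: bounded_pos dest!: compact_imp_bounded)
  show ?thesis
  proof
    show "L \<ge> 0" using L by simp
    fix x y :: 'a assume xy: "x \<in> cball 0 r" "y \<in> cball 0 r"
    have "norm (\<psi> x - \<psi> y) \<le> L * norm (x - y)"
    proof (rule differentiable_bound[of "cball 0 r" \<psi> "\<lambda>y q. G y \<bullet> q"])
      show "(\<psi> has_derivative (\<lambda>q. G z \<bullet> q)) (at z within cball 0 r)" for z
        using G(1) has_derivative_at_withinI by blast
      show "onorm ((\<bullet>) (G z)) \<le> L" if "z \<in> cball 0 r" for z
      proof (rule onorm_bound)
        show "norm (G z \<bullet> x) \<le> L * norm x" for x
          using order_trans[OF Cauchy_Schwarz_ineq2 mult_right_mono[OF L(2)[OF that] norm_ge_zero]] by simp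
      qed (use L in simp)
    qed (use xy in auto)
    then show "\<bar>\<psi> x - \<psi> y\<bar> \<le> L * norm (x - y)" by simp
  qed
qed

text \<open>The graph function is Lipschitz on bounded sets, so the boundary is
  \<open>graph_like\<close> near x0. On the closure of \<Omega> the subgraph inequality holds
  non-strictly by continuity, and a move of any positive length into the subgraph makes it
  strict.\<close>

lemma C1_boundary_chart:
  fixes \<Omega> :: "'a::euclidean_space set"
  assumes \<Omega>: "open \<Omega>" "C1_boundary \<Omega>" and x0: "x0 \<in> frontier \<Omega>"
  obtains r n \<Lambda> where "r > 0" "norm n = 1" "graph_like n \<Lambda> (frontier \<Omega> \<inter> ball x0 r)"
    "\<And>x t. x \<in> closure \<Omega> \<Longrightarrow> x \<in> ball x0 r \<Longrightarrow> t > 0 \<Longrightarrow> x + t *\<^sub>R n \<in> ball x0 r \<Longrightarrow> x + t *\<^sub>R n \<in> \<Omega>"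
proof -
  obtain r n \<psi> where r: "r > 0" and n: "norm n = 1" and \<psi>: "C1_fn \<psi>"
    and eq: "\<Omega> \<inter> ball x0 r = {x\<in>ball x0 r. (x - x0) \<bullet> n < \<psi> ((x - x0) - ((x - x0) \<bullet> n) *\<^sub>R n)}"
    using \<Omega>(2)[unfolded C1_boundary_def, rule_format, OF x0] by blast
  have mem: "x \<in> \<Omega> \<longleftrightarrow> (x - x0) \<bullet> n < \<psi> (perp n (x - x0))" if "x \<in> ball x0 r" for x
    using eq that unfolding perp_def by blast
  obtain L where L: "L \<ge> 0" "\<And>x y. x \<in> cball 0 r \<Longrightarrow> y \<in> cball 0 r \<Longrightarrow> \<bar>\<psi> x - \<psi> y\<bar> \<le> L * norm (x - y)"
    using C1_fn_Lipschitz_on_cball[OF \<psi>] by blast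
  have c\<psi>: "continuous_on UNIV \<psi>"
    using \<psi> by (auto simp: C1_fn_def continuous_on_eq_continuous_at intro!: has_derivative_continuous)
  have cF: "continuous_on UNIV (\<lambda>x. (x - x0) \<bullet> n - \<psi> (perp n (x - x0)))"
    unfolding perp_def by (intro continuous_intros continuous_on_compose2[OF c\<psi>]) auto
  have cl: "(x - x0) \<bullet> n \<le> \<psi> (perp n (x - x0))" if x: "x \<in> closure \<Omega>" "x \<in> ball x0 r" for x
  proof -
    obtain X where X: "\<And>k. X k \<in> \<Omega>" "X \<longlonglongrightarrow> x" using x(1) by (auto simp: closure_sequential)
    have "\<forall>\<^sub>F k in sequentially. X k \<in> ball x0 r" using topological_tendstoD[OF X(2)] x(2) by blast
    then have ev: "\<forall>\<^sub>F k in sequentially. (X k - x0) \<bullet> n - \<psi> (perp n (X k - x0)) \<le> 0"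
      by eventually_elim (use mem X(1) in force)
    have "(\<lambda>k. (X k - x0) \<bullet> n - \<psi> (perp n (X k - x0))) \<longlonglongrightarrow> (x - x0) \<bullet> n - \<psi> (perp n (x - x0))"
      using cF X(2) by (auto simp: continuous_on_eq_continuous_at isCont_def intro: continuous_imp_tendsto isCont_tendsto_compose[of x "\<lambda>x. (x - x0) \<bullet> n - \<psi> (perp n (x - x0))"])
    from tendsto_upperbound[OF this ev] show ?thesis by simp
  qed
  have fr: "(x - x0) \<bullet> n = \<psi> (perp n (x - x0))" if x: "x \<in> frontier \<Omega>" "x \<in> ball x0 r" for x
  proof -
    have "x \<notin> \<Omega>" "x \<in> closure \<Omega>" using x(1) \<Omega>(1) by (auto simp: frontier_def interior_open)
    then show ?thesis using mem[OF x(2)] cl[OF _ x(2)] by force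
  qed
  show ?thesis
  proof
    \<comment> \<open>\<Omega> lies below the graph with respect to n, so the inward direction is
      \<open>- n\<close>; both have the same projection.\<close>
    show "r > 0" "norm (- n) = 1" using r n by auto
    show "graph_like (- n) (1 + L) (frontier \<Omega> \<inter> ball x0 r)"
      unfolding graph_like_def
    proof (intro conjI ballI)
      fix x y assume xy: "x \<in> frontier \<Omega> \<inter> ball x0 r" "y \<in> frontier \<Omega> \<inter> ball x0 r"
      have b: "perp n (x - x0) \<in> cball 0 r" "perp n (y - x0) \<in> cball 0 r"
        using norm_perp_le(1)[OF n, of "x - x0"] norm_perp_le(1)[OF n, of "y - x0"] xy
        by (auto simp: dist_norm norm_minus_commute)
      have "(x - y) \<bullet> n = \<psi> (perp n (x - x0)) - \<psi> (perp n (y - x0))"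
        using fr[of x] fr[of y] xy by (simp add: inner_diff_left)
      then have "\<bar>(x - y) \<bullet> n\<bar> \<le> L * norm (perp n (x - y))"
        using L(2)[OF b] by (simp add: perp_simps[OF n])
      moreover have "x - y = perp n (x - y) + ((x - y) \<bullet> n) *\<^sub>R n" by (simp add: perp_def)
      then have "norm (x - y) \<le> norm (perp n (x - y)) + \<bar>(x - y) \<bullet> n\<bar>"
        using norm_triangle_ineq[of "perp n (x - y)" "((x - y) \<bullet> n) *\<^sub>R n"] n by simp
      ultimately show "norm (x - y) \<le> (1 + L) * norm (perp (- n) (x - y))"
        by (simp add: perp_simps[OF n] distrib_right)
    qed (use n L in auto)
    fix x t assume x: "x \<in> closure \<Omega>" "x \<in> ball x0 r" and t: "(t::real) > 0" "x + t *\<^sub>R (- n) \<in> ball x0 r"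
    have e: "x + t *\<^sub>R (- n) - x0 = (x - x0) + (- t) *\<^sub>R n" by simp
    have "perp n (x + t *\<^sub>R (- n) - x0) = perp n (x - x0)"
      unfolding e by (rule perp_simps(1)[OF n])
    moreover have "(x + t *\<^sub>R (- n) - x0) \<bullet> n = (x - x0) \<bullet> n - t"
      unfolding e inner_add_left using n by (simp add: dot_square_norm)
    ultimately show "x + t *\<^sub>R (- n) \<in> \<Omega>"
      using mem[OF t(2)] cl[OF x] t(1) by auto
  qed
qed

lemma link_zero_left:
  assumes "emeasure M (space M) = 0"
  shows "link \<Omega> p M N"
  unfolding link_def
proof (intro exI[of _ 0] conjI allI impI)
  have "AE x in M. P x" for P
    using assms by (intro AE_I[where N = "space M"]) auto
  then show "(\<integral>\<^sup>+x. \<integral>\<^sup>+y. ennreal (\<bar>f x - f y\<bar> powr p) \<partial>N \<partial>M) \<le> 0 * (\<integral>\<^sup>+x\<in>\<Omega>. ennreal (norm (Df x) powr p) \<partial>lborel)" for f Df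
    by (simp add: nn_integral_0_iff_AE cong: nn_integral_cong_AE)
       (metis (mono_tags, lifting) nn_integral_cong_AE nn_integral_0_iff_AE nn_integral_const mult_zero_left order_refl)
qed simp

text \<open>All points near x0 are pushed inwards in the chart direction: the segments of length s
  remain in \<Omega> and end in one fixed ball around y = x0 + s n. \<open>link_flow\<close> links
  the interior points near x0 to that ball by translation invariance, and the boundary points by the
  flow bound for surfaces.\<close>

lemma link_frontier_ball:
  fixes \<Omega> :: "'a::euclidean_space set"
  defines "H \<equiv> hausdorff_measure (DIM('a) - 1) :: 'a measure"
  assumes p: "p > 1" and \<Omega>: "open \<Omega>" "C1_boundary \<Omega>" and x0: "x0 \<in> frontier \<Omega>"
  obtains U y \<rho> where "open U" "x0 \<in> U" "\<rho> > 0" "ball y \<rho> \<subseteq> \<Omega>" "emeasure H (frontier \<Omega> \<inter> U) < top"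
    "link \<Omega> p (meas_on lborel (\<Omega> \<inter> U)) (meas_on lborel (ball y \<rho>))"
    "link \<Omega> p (meas_on H (frontier \<Omega> \<inter> U)) (meas_on lborel (ball y \<rho>))"
proof -
  obtain r n \<Lambda> where r: "r > 0" and n: "norm n = 1" and g: "graph_like n \<Lambda> (frontier \<Omega> \<inter> ball x0 r)"
    and inn: "\<And>x t. x \<in> closure \<Omega> \<Longrightarrow> x \<in> ball x0 r \<Longrightarrow> t > 0 \<Longrightarrow> x + t *\<^sub>R n \<in> ball x0 r \<Longrightarrow> x + t *\<^sub>R n \<in> \<Omega>"
    using C1_boundary_chart[OF \<Omega> x0] by blast
  define s where "s = r / 2"
  define y where "y = x0 + s *\<^sub>R n"
  have x0c: "x0 \<in> closure \<Omega>" using x0 by (simp add: frontier_def)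
  have "y \<in> \<Omega>" unfolding y_def using r n x0c by (intro inn) (auto simp: s_def dist_norm)
  then obtain \<rho>1 where \<rho>1: "\<rho>1 > 0" "ball y \<rho>1 \<subseteq> \<Omega>" using \<Omega>(1) openE by blast
  define \<rho> where "\<rho> = min \<rho>1 s"
  have \<rho>: "\<rho> > 0" "ball y \<rho> \<subseteq> \<Omega>" "\<rho> \<le> s" using \<rho>1 r by (auto simp: \<rho>_def s_def)
  have s: "s > 0" using r by (simp add: s_def)
  define U where "U = ball x0 (\<rho> / 2)"
  \<comment> \<open>For t in (a, s) and x in U, the point x + t n is off y by less than \<rho>/2
    because of x - x0 and by less than \<rho>/2 because of s - t.\<close>
  define a where "a = s - \<rho> / 2"
  have as: "0 \<le> a" "a < s" using \<rho> by (auto simp: a_def)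
  have in1: "x + t *\<^sub>R n \<in> \<Omega>" if "x \<in> closure \<Omega>" "x \<in> U" "t \<in> {0<..<s}" for x t
  proof (rule inn)
    have d: "dist x0 x < \<rho> / 2" using that by (simp add: U_def)
    then show "x \<in> ball x0 r" using \<rho> r by (auto simp: s_def)
    have "dist x0 (x + t *\<^sub>R n) \<le> dist x0 x + dist x (x + t *\<^sub>R n)" by (rule dist_triangle)
    also have "dist x (x + t *\<^sub>R n) = t" using n that by (simp add: dist_norm)
    finally show "x + t *\<^sub>R n \<in> ball x0 r" using d that \<rho> by (auto simp: s_def)
  qed (use that in auto)
  have in2: "x + t *\<^sub>R n \<in> ball y \<rho>" if "x \<in> U" "t \<in> {a<..<s}" for x t
  proof -
    have "y - (x + t *\<^sub>R n) = (x0 - x) + (s - t) *\<^sub>R n" by (simp add: y_def algebra_simps)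
    then have "dist y (x + t *\<^sub>R n) = norm ((x0 - x) + (s - t) *\<^sub>R n)" by (simp only: dist_norm)
    then have "dist y (x + t *\<^sub>R n) \<le> dist x0 x + \<bar>s - t\<bar>"
      using norm_triangle_ineq[of "x0 - x" "(s - t) *\<^sub>R n"] n by (simp add: dist_norm[of x0])
    then show ?thesis using that by (auto simp: U_def a_def)
  qed
  have lB: "link \<Omega> p (meas_on lborel (ball y \<rho>)) (meas_on lborel (ball y \<rho>))"
    using \<rho> \<Omega> p by (intro link_convex) auto
  have gU: "graph_like n \<Lambda> (frontier \<Omega> \<inter> U)"
  proof -
    have "frontier \<Omega> \<inter> U \<subseteq> frontier \<Omega> \<inter> ball x0 r" using \<rho> r by (auto simp: U_def s_def)
    then show ?thesis using g unfolding graph_like_def by blast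
  qed
  have bU: "frontier \<Omega> \<inter> U \<in> sets borel" "bounded (frontier \<Omega> \<inter> U)" "\<Omega> \<inter> U \<in> sets borel" "bounded (\<Omega> \<inter> U)"
    using \<Omega> unfolding U_def
    by (auto intro!: sets.Int borel_closed borel_open frontier_closed intro: bounded_subset[OF bounded_ball])
  note fs = flow_bound_surface[OF gU bU(1,2) s, folded H_def]
  obtain C where C: "C < top" "flow_bound (meas_on H (frontier \<Omega> \<inter> U)) n s C" using fs(2) by auto
  have setsH: "sets H = sets borel" by (simp add: H_def)
  show ?thesis
  proof
    show "open U" "x0 \<in> U" using \<rho> by (auto simp: U_def)
    show "emeasure H (frontier \<Omega> \<inter> U) < top" by (rule fs(1))
    show "link \<Omega> p (meas_on lborel (\<Omega> \<inter> U)) (meas_on lborel (ball y \<rho>))"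
    proof (rule link_flow[OF p _ as _ _ _ lB flow_bound_lborel])
      show "fin_borel (meas_on lborel (\<Omega> \<inter> U))" using bU by (intro fin_borel_lborel_on)
      show "AE x in meas_on lborel (\<Omega> \<inter> U). \<forall>t\<in>{0<..<s}. x + t *\<^sub>R n \<in> \<Omega>"
        using bU in1[OF subsetD[OF closure_subset]] by (subst AE_meas_on) (auto intro!: AE_I2)
      show "AE x in meas_on lborel (\<Omega> \<inter> U). \<forall>t\<in>{a<..<s}. x + t *\<^sub>R n \<in> ball y \<rho>"
        using bU in2 by (subst AE_meas_on) (auto intro!: AE_I2)
    qed (use bU s \<Omega> in auto)
    show "link \<Omega> p (meas_on H (frontier \<Omega> \<inter> U)) (meas_on lborel (ball y \<rho>))"
    proof (rule link_flow[OF p _ as _ _ _ lB C(2,1)])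
      show "fin_borel (meas_on H (frontier \<Omega> \<inter> U))" using bU setsH fs(1) by (intro fin_borel_meas_on)
      show "AE x in meas_on H (frontier \<Omega> \<inter> U). \<forall>t\<in>{0<..<s}. x + t *\<^sub>R n \<in> \<Omega>"
        using bU setsH in1 by (subst AE_meas_on) (auto intro!: AE_I2 simp: frontier_def)
      show "AE x in meas_on H (frontier \<Omega> \<inter> U). \<forall>t\<in>{a<..<s}. x + t *\<^sub>R n \<in> ball y \<rho>"
        using bU setsH in2 by (subst AE_meas_on) (auto intro!: AE_I2)
    qed (use bU s \<Omega> in auto)
  qed (use \<rho> in auto)
qed

text \<open>Having linked balls is an equivalence relation that holds between nearby points, and
  \<Omega> is connected. The radii are existentially quantified because transitivity shrinks the two
  balls at the middle point to a common one.\<close>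

lemma link_balls_connected:
  fixes \<Omega> :: "'a::euclidean_space set"
  assumes p: "p > 1" and \<Omega>: "open \<Omega>" "connected \<Omega>" and y: "y \<in> \<Omega>" and z: "z \<in> \<Omega>"
  shows "\<exists>\<rho>>0. \<exists>\<rho>'>0. ball y \<rho> \<subseteq> \<Omega> \<and> ball z \<rho>' \<subseteq> \<Omega> \<and> link \<Omega> p (meas_on lborel (ball y \<rho>)) (meas_on lborel (ball z \<rho>'))"
proof -
  define R where "R y z \<longleftrightarrow> (\<exists>\<rho>>0. \<exists>\<rho>'>0. ball y \<rho> \<subseteq> \<Omega> \<and> ball z \<rho>' \<subseteq> \<Omega> \<and> link \<Omega> p (meas_on lborel (ball y \<rho>)) (meas_on lborel (ball z \<rho>')))" for y z
  have fb: "fin_borel (meas_on lborel (ball y \<rho>))" for y :: 'a and \<rho> by (intro fin_borel_lborel_on) auto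
  have sub: "link \<Omega> p (meas_on lborel (ball y' \<rho>')) N" if "link \<Omega> p (meas_on lborel (ball y \<rho>)) N" "ball y' \<rho>' \<subseteq> ball y \<rho>" "fin_borel N" for y y' \<rho> \<rho>' N
    by (rule link_mono_left[OF that(1)]) (use that in auto)
  have "R y z"
  proof (rule connected_equivalence_relation[OF \<Omega>(2) y z])
    show "R b a" if "R a b" for a b
      using that link_sym[OF fb fb] unfolding R_def by blast
    show "R a c" if "R a b" "R b c" for a b c
    proof -
      obtain \<rho>1 \<rho>2 where 1: "\<rho>1 > 0" "\<rho>2 > 0" "ball a \<rho>1 \<subseteq> \<Omega>" "link \<Omega> p (meas_on lborel (ball a \<rho>1)) (meas_on lborel (ball b \<rho>2))"
        using \<open>R a b\<close> by (auto simp: R_def)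
      obtain \<rho>3 \<rho>4 where 2: "\<rho>3 > 0" "\<rho>4 > 0" "ball c \<rho>4 \<subseteq> \<Omega>" "link \<Omega> p (meas_on lborel (ball b \<rho>3)) (meas_on lborel (ball c \<rho>4))"
        using \<open>R b c\<close> by (auto simp: R_def)
      define m where "m = min \<rho>2 \<rho>3"
      have m: "m > 0" "ball b m \<subseteq> ball b \<rho>2" "ball b m \<subseteq> ball b \<rho>3" using 1 2 by (auto simp: m_def)
      have "link \<Omega> p (meas_on lborel (ball a \<rho>1)) (meas_on lborel (ball b m))"
        by (rule link_sym[OF fb fb sub[OF link_sym[OF fb fb 1(4)] m(2) fb]])
      then have "link \<Omega> p (meas_on lborel (ball a \<rho>1)) (meas_on lborel (ball c \<rho>4))"
        if "link \<Omega> p (meas_on lborel (ball b m)) (meas_on lborel (ball c \<rho>4))"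
          "emeasure (meas_on lborel (ball b m)) (space (meas_on lborel (ball b m))) \<noteq> 0"
        by (rule link_trans[OF p fb fb fb that(2) _ that(1)])
      moreover have "link \<Omega> p (meas_on lborel (ball b m)) (meas_on lborel (ball c \<rho>4))"
        by (rule sub[OF 2(4) m(3) fb])
      moreover have "emeasure (meas_on lborel (ball b m)) (space (meas_on lborel (ball b m))) \<noteq> 0"
        using m(1) content_ball_pos[of m b] by (auto simp: emeasure_meas_on measure_def)
      ultimately have "link \<Omega> p (meas_on lborel (ball a \<rho>1)) (meas_on lborel (ball c \<rho>4))"
        by blast
      then show ?thesis unfolding R_def using 1 2 by blast
    qed
    show "\<exists>T. openin (top_of_set \<Omega>) T \<and> a \<in> T \<and> (\<forall>x\<in>T. R a x)" if a: "a \<in> \<Omega>" for a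
    proof -
      obtain \<rho> where \<rho>: "\<rho> > 0" "ball a \<rho> \<subseteq> \<Omega>" using \<Omega>(1) a openE by blast
      have l: "link \<Omega> p (meas_on lborel (ball a \<rho>)) (meas_on lborel (ball a \<rho>))"
        using \<rho> \<Omega> p by (intro link_convex) auto
      have "R a x" if x: "x \<in> ball a \<rho>" for x
      proof -
        obtain e where e: "e > 0" "ball x e \<subseteq> ball a \<rho>" using x openE[OF open_ball] by blast
        have "link \<Omega> p (meas_on lborel (ball a \<rho>)) (meas_on lborel (ball x e))"
          by (rule link_sym[OF fb fb sub[OF l e(2) fb]])
        then show ?thesis unfolding R_def using \<rho> e by blast
      qed
      then show ?thesis using \<rho> \<Omega>(1) by (intro exI[of _ "ball a \<rho>"]) (auto simp: openin_open_eq)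
    qed
  qed
  then show ?thesis by (simp add: R_def)
qed

text \<open>Compactness as an induction principle: a local property that survives finite unions
  holds on some neighbourhood of K.\<close>

lemma compact_union_property:
  assumes K: "compact K" and loc: "\<And>x. x \<in> K \<Longrightarrow> \<exists>U. open U \<and> x \<in> U \<and> P U"
    and e: "P {}" and un: "\<And>U V. open U \<Longrightarrow> open V \<Longrightarrow> P U \<Longrightarrow> P V \<Longrightarrow> P (U \<union> V)"
  shows "\<exists>U. open U \<and> K \<subseteq> U \<and> P U"
proof -
  define \<U> where "\<U> = {U. open U \<and> P U}"
  have "K \<subseteq> \<Union>\<U>" using loc by (fastforce simp: \<U>_def)
  moreover have "\<And>U. U \<in> \<U> \<Longrightarrow> open U" by (simp add: \<U>_def)
  ultimately obtain \<V> where V: "\<V> \<subseteq> \<U>" "finite \<V>" "K \<subseteq> \<Union>\<V>"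
    by (rule compactE[OF K])
  have "open (\<Union>\<V>) \<and> P (\<Union>\<V>)" using V(2,1)
  proof (induction \<V>)
    case (insert U \<V>)
    then show ?case using un[of U "\<Union>\<V>"] by (auto simp: \<U>_def)
  qed (simp add: e)
  then show ?thesis using V(3) by blast
qed

lemma link_empty: "link \<Omega> p (meas_on \<mu> {}) N"
proof (rule link_zero_left)
  have "emeasure (meas_on \<mu> {}) (space \<mu>) = emeasure \<mu> ({} \<inter> space \<mu>)"
    by (rule emeasure_meas_on) simp_all
  then show "emeasure (meas_on \<mu> {}) (space (meas_on \<mu> {})) = 0" by simp
qed

text \<open>Compactness of the closure links all of \<Omega> and all of its boundary to a single
  ball; finiteness of the boundary measure is carried through the same covering. The double integral
  is then an integral over that ball, and the constant a is the value of f at a point where the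
  inner integral does not exceed its average.\<close>

proposition Poincare_trace:
  fixes \<Omega> :: "'a::euclidean_space set"
  defines "H \<equiv> hausdorff_measure (DIM('a) - 1) :: 'a measure"
  assumes p: "p > 1" and \<Omega>: "open \<Omega>" "bounded \<Omega>" "connected \<Omega>" "\<Omega> \<noteq> {}" "C1_boundary \<Omega>"
  shows "emeasure H (frontier \<Omega>) < top"
    and "\<exists>C<top. \<forall>f Df. C1_grad f Df \<longrightarrow> (\<exists>a.
      (\<integral>\<^sup>+x\<in>\<Omega>. ennreal (\<bar>f x - a\<bar> powr p) \<partial>lborel) + (\<integral>\<^sup>+x\<in>frontier \<Omega>. ennreal (\<bar>f x - a\<bar> powr p) \<partial>H)
        \<le> C * (\<integral>\<^sup>+x\<in>\<Omega>. ennreal (norm (Df x) powr p) \<partial>lborel))"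
proof -
  obtain z0 \<rho>0 where z0: "\<rho>0 > 0" "ball z0 \<rho>0 \<subseteq> \<Omega>" using \<Omega>(1,4) openE by blast
  have z0\<Omega>: "z0 \<in> \<Omega>" using z0 by auto
  have fb: "fin_borel (meas_on lborel (ball y \<rho>))" for y :: 'a and \<rho> by (intro fin_borel_lborel_on) auto
  have sub: "link \<Omega> p (meas_on lborel (ball y' \<rho>')) N" if "link \<Omega> p (meas_on lborel (ball y \<rho>)) N" "ball y' \<rho>' \<subseteq> ball y \<rho>" "fin_borel N" for y y' \<rho> \<rho>' N
    by (rule link_mono_left[OF that(1)]) (use that in auto)
  have ne: "emeasure (meas_on lborel (ball b m)) (space (meas_on lborel (ball b m))) \<noteq> 0" if "m > 0" for b :: 'a and m
    using that content_ball_pos[of m b] by (auto simp: emeasure_meas_on measure_def)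
  have self: "link \<Omega> p (meas_on lborel (ball y \<rho>)) (meas_on lborel (ball y \<rho>))" if "ball y \<rho> \<subseteq> \<Omega>" for y \<rho>
    using that \<Omega> p by (intro link_convex) auto
  define N where "N = meas_on lborel (ball z0 \<rho>0)"
  have fN: "fin_borel N" unfolding N_def by (rule fb)
  have toN: "link \<Omega> p (meas_on lborel (ball y \<rho>)) N" if \<rho>: "\<rho> > 0" "ball y \<rho> \<subseteq> \<Omega>" for y \<rho>
  proof -
    have "y \<in> \<Omega>" using \<rho> by auto
    then obtain \<rho>1 \<rho>2 where 1: "\<rho>1 > 0" "\<rho>2 > 0" "link \<Omega> p (meas_on lborel (ball y \<rho>1)) (meas_on lborel (ball z0 \<rho>2))"
      using link_balls_connected[OF p \<Omega>(1,3) _ z0\<Omega>] by blast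
    \<comment> \<open>The radii obtained at y and z0 are unrelated to \<rho> and \<rho>0. Both pairs
      of concentric balls are cut down to a common one, and the ends are reconnected through
      \<open>link_convex\<close>.\<close>
    define m1 m2 where "m1 = min \<rho> \<rho>1" and "m2 = min \<rho>2 \<rho>0"
    have m: "m1 > 0" "ball y m1 \<subseteq> ball y \<rho>" "ball y m1 \<subseteq> ball y \<rho>1" "m2 > 0" "ball z0 m2 \<subseteq> ball z0 \<rho>2" "ball z0 m2 \<subseteq> ball z0 \<rho>0"
      using 1 z0 \<rho> by (auto simp: m1_def m2_def)
    have a: "link \<Omega> p (meas_on lborel (ball y \<rho>)) (meas_on lborel (ball y m1))"
      by (rule link_sym[OF fb fb sub[OF self[OF \<rho>(2)] m(2) fb]])
    have b: "link \<Omega> p (meas_on lborel (ball y m1)) (meas_on lborel (ball z0 m2))"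
      by (rule link_sym[OF fb fb sub[OF link_sym[OF fb fb sub[OF 1(3) m(3) fb]] m(5) fb]])
    have c: "link \<Omega> p (meas_on lborel (ball z0 m2)) N"
      unfolding N_def by (rule sub[OF self[OF z0(2)] m(6) fb])
    show ?thesis
      by (rule link_trans[OF p fb fb fN ne[OF m(4)] link_trans[OF p fb fb fb ne[OF m(1)] a b] c])
  qed
  have setsH[measurable_cong, simp]: "sets H = sets borel" by (simp add: H_def)
  define P where "P U \<longleftrightarrow> open U \<and> emeasure H (frontier \<Omega> \<inter> U) < top \<and> link \<Omega> p (meas_on lborel (\<Omega> \<inter> U)) N
      \<and> link \<Omega> p (meas_on H (frontier \<Omega> \<inter> U)) N" for U
  have bor: "frontier \<Omega> \<inter> U \<in> sets borel" "\<Omega> \<inter> U \<in> sets borel" "frontier \<Omega> \<in> sets borel" "\<Omega> \<in> sets borel" if "open U" for U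
    using that \<Omega>(1) by (auto intro!: sets.Int borel_closed borel_open frontier_closed)
  have fr\<Omega>: "frontier \<Omega> \<inter> \<Omega> = {}" using \<Omega>(1) by (auto simp: frontier_def interior_open)
  have loc: "\<exists>U. open U \<and> x \<in> U \<and> P U" if x: "x \<in> closure \<Omega>" for x
  proof (cases "x \<in> \<Omega>")
    case True
    then obtain e where e: "e > 0" "ball x e \<subseteq> \<Omega>" using \<Omega>(1) openE by blast
    then have eq: "\<Omega> \<inter> ball x e = ball x e" "frontier \<Omega> \<inter> ball x e = {}" using fr\<Omega> by auto
    have "P (ball x e)" unfolding P_def eq using toN[OF e] by (auto intro: link_empty)
    then show ?thesis using e by (intro exI[of _ "ball x e"]) auto
  next
    case False
    then have "x \<in> frontier \<Omega>" using x \<Omega>(1) by (simp add: frontier_def interior_open)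
    then obtain U y \<rho> where U: "open U" "x \<in> U" "\<rho> > 0" "ball y \<rho> \<subseteq> \<Omega>" "emeasure H (frontier \<Omega> \<inter> U) < top"
      "link \<Omega> p (meas_on lborel (\<Omega> \<inter> U)) (meas_on lborel (ball y \<rho>))"
      "link \<Omega> p (meas_on H (frontier \<Omega> \<inter> U)) (meas_on lborel (ball y \<rho>))"
      by (rule link_frontier_ball[OF p \<Omega>(1,5), folded H_def])
    have "link \<Omega> p (meas_on lborel (\<Omega> \<inter> U)) N"
      using bor[OF U(1)] \<Omega>(2) by (intro link_trans[OF p _ fb fN ne[OF U(3)] U(6) toN[OF U(3,4)]] fin_borel_lborel_on) auto
    moreover have "link \<Omega> p (meas_on H (frontier \<Omega> \<inter> U)) N"
      using bor[OF U(1)] U(5) by (intro link_trans[OF p _ fb fN ne[OF U(3)] U(7) toN[OF U(3,4)]] fin_borel_meas_on) auto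
    ultimately show ?thesis using U by (auto simp: P_def)
  qed
  have "\<exists>U. open U \<and> closure \<Omega> \<subseteq> U \<and> P U"
  proof (rule compact_union_property[OF _ loc])
    show "compact (closure \<Omega>)" using \<Omega>(2) by simp
    show "P {}" by (simp add: P_def link_empty)
    show "P (U \<union> V)" if "P U" "P V" for U V
    proof -
      have UV: "open U" "open V" using that by (auto simp: P_def)
      note b = bor[OF UV(1)] bor[OF UV(2)]
      have "emeasure H ((frontier \<Omega> \<inter> U) \<union> (frontier \<Omega> \<inter> V)) \<le> emeasure H (frontier \<Omega> \<inter> U) + emeasure H (frontier \<Omega> \<inter> V)"
        using b by (intro emeasure_subadditive) auto
      also have "\<dots> < top" using that by (simp add: P_def)
      finally have "emeasure H (frontier \<Omega> \<inter> (U \<union> V)) < top" by (simp only: Int_Un_distrib)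
      moreover have "link \<Omega> p (meas_on lborel (\<Omega> \<inter> (U \<union> V))) N" "link \<Omega> p (meas_on H (frontier \<Omega> \<inter> (U \<union> V))) N"
        unfolding Int_Un_distrib using that[unfolded P_def] b fN setsH sets_lborel
        by (blast intro: link_Un_left)+
      ultimately show ?thesis using open_Un[OF UV] by (simp add: P_def)
    qed
  qed
  then obtain U where U: "closure \<Omega> \<subseteq> U" "P U" by blast
  then have eqs: "\<Omega> \<inter> U = \<Omega>" "frontier \<Omega> \<inter> U = frontier \<Omega>" using closure_subset by (auto simp: frontier_def)
  note PU = U(2)[unfolded P_def eqs]
  show fin: "emeasure H (frontier \<Omega>) < top" using PU by (elim conjE)
  define M1 where "M1 = meas_on lborel \<Omega>"
  define M2 where "M2 = meas_on H (frontier \<Omega>)"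
  have fM1: "fin_borel M1" unfolding M1_def
    using bor(4)[OF \<Omega>(1)] \<Omega>(2) by (rule fin_borel_lborel_on)
  have fM2: "fin_borel M2" unfolding M2_def
    using setsH bor(3)[OF \<Omega>(1)] fin by (rule fin_borel_meas_on)
  have "link \<Omega> p M1 N" unfolding M1_def using PU by (elim conjE)
  then have l1: "link \<Omega> p N M1" by (rule link_sym[OF fM1 fN])
  have "link \<Omega> p M2 N" unfolding M2_def using PU by (elim conjE)
  then have l2: "link \<Omega> p N M2" by (rule link_sym[OF fM2 fN])
  note l = l1 l2 and fM = fM1 fM2
  obtain C1 where C1: "C1 < top" "\<And>f Df. C1_grad f Df \<Longrightarrow> (\<integral>\<^sup>+x. \<integral>\<^sup>+y. ennreal (\<bar>f x - f y\<bar> powr p) \<partial>M1 \<partial>N)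
       \<le> C1 * (\<integral>\<^sup>+x\<in>\<Omega>. ennreal (norm (Df x) powr p) \<partial>lborel)"
    using l by (auto simp: link_def)
  obtain C2 where C2: "C2 < top" "\<And>f Df. C1_grad f Df \<Longrightarrow> (\<integral>\<^sup>+x. \<integral>\<^sup>+y. ennreal (\<bar>f x - f y\<bar> powr p) \<partial>M2 \<partial>N)
       \<le> C2 * (\<integral>\<^sup>+x\<in>\<Omega>. ennreal (norm (Df x) powr p) \<partial>lborel)"
    using l by (auto simp: link_def)
  interpret N: finite_measure N using fN by simp
  interpret M1: finite_measure M1 using fM by simp
  interpret M2: finite_measure M2 using fM by simp
  have [measurable_cong]: "sets N = sets borel" "sets M1 = sets borel" "sets M2 = sets borel" using fN fM by auto
  define b where "b = emeasure N (space N)"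
  have b: "b \<noteq> 0" "b < top" using ne[OF z0(1)] N.emeasure_finite[of "space N"] by (auto simp: b_def N_def less_top[symmetric])
  show "\<exists>C<top. \<forall>f Df. C1_grad f Df \<longrightarrow> (\<exists>a.
      (\<integral>\<^sup>+x\<in>\<Omega>. ennreal (\<bar>f x - a\<bar> powr p) \<partial>lborel) + (\<integral>\<^sup>+x\<in>frontier \<Omega>. ennreal (\<bar>f x - a\<bar> powr p) \<partial>H)
        \<le> C * (\<integral>\<^sup>+x\<in>\<Omega>. ennreal (norm (Df x) powr p) \<partial>lborel))"
  proof (intro exI[of _ "(C1 + C2) / b"] conjI allI impI)
    show "(C1 + C2) / b < top" using C1 C2 b by (intro ennreal_divide_lt_top) auto
    fix f :: "'a \<Rightarrow> real" and Df assume f: "C1_grad f Df"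
    note [measurable] = C1_gradD(3,4)[OF f]
    define J where "J = (\<integral>\<^sup>+x\<in>\<Omega>. ennreal (norm (Df x) powr p) \<partial>lborel)"
    define K where "K = (C1 + C2) * J"
    define \<Theta> where "\<Theta> y = (\<integral>\<^sup>+x. ennreal (\<bar>f y - f x\<bar> powr p) \<partial>M1) + (\<integral>\<^sup>+x. ennreal (\<bar>f y - f x\<bar> powr p) \<partial>M2)" for y
    have [measurable]: "\<Theta> \<in> borel_measurable N" unfolding \<Theta>_def by measurable
    have "(\<integral>\<^sup>+y. \<Theta> y \<partial>N) = (\<integral>\<^sup>+y. (\<integral>\<^sup>+x. ennreal (\<bar>f y - f x\<bar> powr p) \<partial>M1) \<partial>N) + (\<integral>\<^sup>+y. (\<integral>\<^sup>+x. ennreal (\<bar>f y - f x\<bar> powr p) \<partial>M2) \<partial>N)"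
      unfolding \<Theta>_def by (rule nn_integral_add) measurable
    also have "\<dots> \<le> C1 * J + C2 * J" using C1(2)[OF f] C2(2)[OF f] unfolding J_def by (rule add_mono)
    finally have int: "(\<integral>\<^sup>+y. \<Theta> y \<partial>N) \<le> K" by (simp add: K_def distrib_right)
    have "\<exists>y. \<Theta> y \<le> K / b"
    proof (rule ccontr)
      assume "\<not> (\<exists>y. \<Theta> y \<le> K / b)"
      then have gt: "K / b < \<Theta> y" for y by (simp add: not_le)
      \<comment> \<open>The strict comparison of integrals requires K / b to be finite, which is
        forced by K / b < \<Theta> z0.\<close>
      have Kb: "K / b \<noteq> top" using gt[of z0] by auto
      have c: "(\<integral>\<^sup>+y. K / b \<partial>N) = K"
        using b ennreal_divide_times[of K b b] by (simp add: b_def[symmetric] mult_divide_eq_ennreal less_top)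
      have "K \<noteq> top" using Kb b by (metis ennreal_top_divide less_irrefl)
      have "(\<integral>\<^sup>+y. K / b \<partial>N) < (\<integral>\<^sup>+y. \<Theta> y \<partial>N)"
      proof (rule nn_integral_less)
        show "(\<integral>\<^sup>+y. K / b \<partial>N) \<noteq> \<infinity>" using c \<open>K \<noteq> top\<close> by simp
        show "AE y in N. K / b \<le> \<Theta> y" using gt by (auto intro: less_imp_le)
        show "\<not> (AE y in N. \<Theta> y \<le> K / b)"
        proof
          assume "AE y in N. \<Theta> y \<le> K / b"
          then have "AE y in N. (1::ennreal) = 0" by eventually_elim (use gt leD in blast)
          then have "(\<integral>\<^sup>+y. 1 \<partial>N) = (\<integral>\<^sup>+y. 0 \<partial>N)" by (rule nn_integral_cong_AE)
          then show False using b by (simp add: b_def)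
        qed
      qed measurable
      with c int show False by simp
    qed
    then obtain y where y: "\<Theta> y \<le> K / b" by auto
    have "(\<integral>\<^sup>+x\<in>\<Omega>. ennreal (\<bar>f x - f y\<bar> powr p) \<partial>lborel) + (\<integral>\<^sup>+x\<in>frontier \<Omega>. ennreal (\<bar>f x - f y\<bar> powr p) \<partial>H) = \<Theta> y"
      unfolding \<Theta>_def M1_def M2_def using bor[OF \<Omega>(1)]
      by (subst (1 2) nn_integral_meas_on) (auto simp: abs_minus_commute)
    also have "\<dots> \<le> (C1 + C2) / b * J" using y by (simp add: K_def divide_ennreal_def mult_ac)
    finally show "\<exists>a. (\<integral>\<^sup>+x\<in>\<Omega>. ennreal (\<bar>f x - a\<bar> powr p) \<partial>lborel) + (\<integral>\<^sup>+x\<in>frontier \<Omega>. ennreal (\<bar>f x - a\<bar> powr p) \<partial>H)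
        \<le> (C1 + C2) / b * (\<integral>\<^sup>+x\<in>\<Omega>. ennreal (norm (Df x) powr p) \<partial>lborel)"
      unfolding J_def by blast
  qed
qed

section \<open>Smooth test functions\<close>

lemma smooth_fn_differentiable: "smooth_fn f \<Longrightarrow> f differentiable (at x)"
  unfolding smooth_fn_def by (metis dderiv.simps(1))

lemma has_derivative_grad:
  assumes "f differentiable (at x)"
  shows "(f has_derivative (\<lambda>h. grad f x \<bullet> h)) (at x)"
proof -
  have d: "(f has_derivative frechet_derivative f (at x)) (at x)"
    using assms frechet_derivative_works by blast
  have lin: "linear (frechet_derivative f (at x))" using d has_derivative_linear by blast
  have "frechet_derivative f (at x) h = grad f x \<bullet> h" for h
  proof -
    have "frechet_derivative f (at x) h = frechet_derivative f (at x) (\<Sum>b\<in>Basis. (h \<bullet> b) *\<^sub>R b)"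
      by (simp add: euclidean_representation)
    also have "\<dots> = (\<Sum>b\<in>Basis. (h \<bullet> b) * frechet_derivative f (at x) b)"
      by (simp add: linear_sum[OF lin] linear_scale[OF lin])
    also have "\<dots> = grad f x \<bullet> h"
      by (simp add: grad_def inner_sum_left inner_commute[of h] mult.commute)
    finally show ?thesis .
  qed
  then have "frechet_derivative f (at x) = (\<lambda>h. grad f x \<bullet> h)" by blast
  with d show ?thesis by simp
qed

lemma frechet_derivative_eq_grad:
  assumes "f differentiable (at x)"
  shows "frechet_derivative f (at x) b = grad f x \<bullet> b"
  using frechet_derivative_at[OF has_derivative_grad[OF assms]] by metis

lemma smooth_fn_C1_grad:
  assumes "smooth_fn f"
  shows "C1_grad f (grad f)"
proof -
  have "continuous_on UNIV (\<lambda>x. frechet_derivative f (at x) b)" for b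
  proof -
    have "dderiv [b] f differentiable (at x)" for x using assms unfolding smooth_fn_def by blast
    then have "(\<lambda>x. frechet_derivative f (at x) b) differentiable (at x)" for x by simp
    then show ?thesis
      by (auto simp: continuous_on_eq_continuous_at intro!: differentiable_imp_continuous_within)
  qed
  then have "continuous_on UNIV (grad f)" unfolding grad_def by (intro continuous_intros)
  then show ?thesis
    using has_derivative_grad[OF smooth_fn_differentiable[OF assms]] by (simp add: C1_grad_def)
qed

section \<open>Linear combinations and supports of test functions\<close>

lemma dderiv_lincomb:
  assumes f: "smooth_fn f" and g: "smooth_fn g"
  shows "dderiv vs (\<lambda>x. a * f x + b * g x) = (\<lambda>x. a * dderiv vs f x + b * dderiv vs g x)"
proof (induction vs)
  case (Cons v vs)
  show ?case
  proof
    fix x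
    have df: "dderiv vs f differentiable (at x)" and dg: "dderiv vs g differentiable (at x)"
      using f g by (auto simp: smooth_fn_def)
    have "((\<lambda>x. a * dderiv vs f x + b * dderiv vs g x) has_derivative
      (\<lambda>h. a * frechet_derivative (dderiv vs f) (at x) h + b * frechet_derivative (dderiv vs g) (at x) h)) (at x)"
      using df dg by (intro derivative_intros) (auto simp: frechet_derivative_works[symmetric])
    from frechet_derivative_at[OF this]
    show "dderiv (v # vs) (\<lambda>x. a * f x + b * g x) x = a * dderiv (v # vs) f x + b * dderiv (v # vs) g x"
      by (simp add: Cons.IH) metis
  qed
qed simp

lemma smooth_fn_lincomb:
  assumes f: "smooth_fn f" and g: "smooth_fn g"
  shows "smooth_fn (\<lambda>x. a * f x + b * g x)"
  unfolding smooth_fn_def dderiv_lincomb[OF f g]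
  using f g by (auto simp: smooth_fn_def intro!: derivative_intros)

lemma grad_lincomb:
  assumes f: "smooth_fn f" and g: "smooth_fn g"
  shows "grad (\<lambda>x. a * f x + b * g x) x = a *\<^sub>R grad f x + b *\<^sub>R grad g x"
proof -
  have "frechet_derivative (\<lambda>x. a * f x + b * g x) (at x) v = a * frechet_derivative f (at x) v + b * frechet_derivative g (at x) v" for v
    using fun_cong[OF dderiv_lincomb[OF f g, of "[v]" a b], of x] by simp
  then show ?thesis
    by (simp add: grad_def scaleR_add_left sum.distrib scaleR_sum_right)
qed

lemma test_fn_lincomb:
  assumes f: "test_fn S f" and g: "test_fn S g"
  shows "test_fn S (\<lambda>x. a * f x + b * g x)"
proof -
  have sub: "tsupp (\<lambda>x. a * f x + b * g x) \<subseteq> tsupp f \<union> tsupp g"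
  proof -
    have "{x. a * f x + b * g x \<noteq> 0} \<subseteq> {x. f x \<noteq> 0} \<union> {x. g x \<noteq> 0}" by auto
    then have "closure {x. a * f x + b * g x \<noteq> 0} \<subseteq> closure ({x. f x \<noteq> 0} \<union> {x. g x \<noteq> 0})" by (rule closure_mono)
    then show ?thesis by (simp add: tsupp_def closure_Un)
  qed
  have "compact (tsupp f \<union> tsupp g)" using f g by (auto simp: test_fn_def)
  moreover have "closed (tsupp (\<lambda>x. a * f x + b * g x))" by (simp add: tsupp_def)
  ultimately have "compact (tsupp (\<lambda>x. a * f x + b * g x))" using sub
    by (metis compact_Int_closed inf.absorb2)
  with f g sub show ?thesis by (auto simp: test_fn_def intro: smooth_fn_lincomb)
qed

lemma dderiv_zero: "dderiv vs (\<lambda>x. 0) = (\<lambda>x. 0)"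
  by (induction vs) (auto simp: frechet_derivative_const)

lemma test_fn_zero: "test_fn S (\<lambda>x. 0)"
  by (auto simp: test_fn_def smooth_fn_def dderiv_zero tsupp_def)

lemma grad_outside_support:
  assumes "x \<notin> tsupp f"
  shows "f x = 0" "grad f x = 0"
proof -
  have "{x. f x \<noteq> 0} \<subseteq> tsupp f" by (simp add: tsupp_def closure_subset)
  then show "f x = 0" using assms by auto
  have "open (- tsupp f)" by (simp add: tsupp_def open_Compl)
  then have "(f has_derivative (\<lambda>h. 0)) (at x)"
    using assms \<open>{x. f x \<noteq> 0} \<subseteq> tsupp f\<close>
    by (intro has_derivative_transform_within_open[of "\<lambda>x. 0" _ _ _ "- tsupp f" f]) auto
  then have "frechet_derivative f (at x) = (\<lambda>h. 0)" using frechet_derivative_at by metis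
  then show "grad f x = 0" by (simp add: grad_def)
qed

lemma test_fn_bounded:
  assumes "test_fn S f"
  obtains B where "B \<ge> 0" "\<And>x. \<bar>f x\<bar> \<le> B" "\<And>x. norm (grad f x) \<le> B"
proof -
  have K: "compact (tsupp f)" and s: "smooth_fn f" using assms by (auto simp: test_fn_def)
  note c = C1_gradD(1,2)[OF smooth_fn_C1_grad[OF s]]
  have "compact (f ` tsupp f)" "compact (grad f ` tsupp f)"
    using c K by (auto intro!: compact_continuous_image intro: continuous_on_subset)
  then obtain B1 B2 where B: "B1 > 0" "\<And>x. x \<in> tsupp f \<Longrightarrow> norm (f x) \<le> B1" "B2 > 0" "\<And>x. x \<in> tsupp f \<Longrightarrow> norm (grad f x) \<le> B2"
    by (metis bounded_pos compact_imp_bounded imageI)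
  show ?thesis
  proof
    show "max B1 B2 \<ge> 0" using B by simp
    show "\<bar>f x\<bar> \<le> max B1 B2" for x using B(1) B(2)[of x] grad_outside_support(1)[of x f] by (cases "x \<in> tsupp f") auto
    show "norm (grad f x) \<le> max B1 B2" for x using B(3) B(4)[of x] grad_outside_support(2)[of x f] by (cases "x \<in> tsupp f") auto
  qed
qed

lemma test_fn_UNIV: "test_fn S f \<Longrightarrow> test_fn UNIV f"
  by (simp add: test_fn_def)

section \<open>Integration by parts\<close>

lemma integrable_lborel_bounded_support:
  fixes g :: "'a::euclidean_space \<Rightarrow> real"
  assumes "g \<in> borel_measurable borel" "\<And>x. \<bar>g x\<bar> \<le> B" "compact K" "\<And>x. x \<notin> K \<Longrightarrow> g x = 0"
  shows "integrable lborel g"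
proof (rule Bochner_Integration.integrable_bound)
  have "emeasure lborel K < \<infinity>" using assms(3) emeasure_compact_finite by auto
  moreover have "K \<in> sets borel" using assms(3) by (intro borel_closed compact_imp_closed)
  ultimately show "integrable lborel (\<lambda>x. B * indicator K x :: real)"
    by (intro integrable_mult_right integrable_real_indicator) auto
  have B: "B \<ge> 0" using assms(2)[of undefined] by linarith
  show "AE x in lborel. norm (g x) \<le> norm (B * indicator K x :: real)"
  proof (rule AE_I2)
    fix x show "norm (g x) \<le> norm (B * indicator K x :: real)"
      using assms(2)[of x] assms(4)[of x] B by (cases "x \<in> K") auto
  qed
qed (use assms(1) in simp)

text \<open>The integral of a derivative vanishes because Lebesgue measure is translation invariant.\<close>
lemma integral_directional_derivative_eq_0:
  fixes f :: "'a::euclidean_space \<Rightarrow> real"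
  assumes f: "C1_grad f Df" and K: "compact K" and out: "\<And>x. x \<notin> K \<Longrightarrow> f x = 0 \<and> Df x = 0"
  shows "(\<integral>x. Df x \<bullet> b \<partial>lborel) = 0"
proof -
  note [measurable] = C1_gradD(3,4)[OF f] and c = C1_gradD(1,2)[OF f]
  have "compact (Df ` K)" using c(2) K by (auto intro!: compact_continuous_image intro: continuous_on_subset)
  then obtain B where B0: "B > 0" "\<And>x. x \<in> K \<Longrightarrow> norm (Df x) \<le> B" by (metis bounded_pos compact_imp_bounded imageI)
  have B: "norm (Df x) \<le> B" for x using B0 out[of x] by (cases "x \<in> K") auto
  have "compact (f ` K)" using c(1) K by (auto intro!: compact_continuous_image intro: continuous_on_subset)
  then obtain B' where B0': "B' > 0" "\<And>x. x \<in> K \<Longrightarrow> norm (f x) \<le> B'" by (metis bounded_pos compact_imp_bounded imageI)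
  have B': "\<bar>f x\<bar> \<le> B'" for x using B0' out[of x] by (cases "x \<in> K") auto
  obtain R where R: "R > 0" "\<And>x. x \<in> K \<Longrightarrow> norm x \<le> R" using K compact_imp_bounded bounded_pos by metis
  \<comment> \<open>The steps are at most 1, so all difference quotients vanish outside this
    enlarged ball, which supports the dominating function.\<close>
  define Q where "Q = cball (0::'a) (R + norm b)"
  have fint: "integrable lborel f"
    using B' K out by (intro integrable_lborel_bounded_support) auto
  define t where "t n = 1 / real (Suc n)" for n
  have t: "t n > 0" "t n \<le> 1" "t n \<noteq> 0" for n by (auto simp: t_def)
  define q where "q n x = (f (t n *\<^sub>R b + x) - f x) / t n" for n x
  have [measurable]: "q n \<in> borel_measurable borel" for n unfolding q_def by measurable
  have shift: "integrable lborel (\<lambda>x. f (v + x))" "(\<integral>x. f (v + x) \<partial>lborel) = (\<integral>x. f x \<partial>lborel)" for v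
    using fint integrable_distr_eq[of "(+) v" lborel borel f] integral_distr[of "(+) v" lborel borel f]
    by (simp_all add: lborel_distr_plus)
  have q0: "(\<integral>x. q n x \<partial>lborel) = 0" for n
    unfolding q_def using shift fint by simp
  have qout: "q n x = 0" if "x \<notin> Q" for n x
  proof -
    have "x \<notin> K" using R(2)[of x] that by (auto simp: Q_def intro: add_increasing2)
    moreover have "t n *\<^sub>R b + x \<notin> K"
    proof
      assume "t n *\<^sub>R b + x \<in> K"
      then have "norm (t n *\<^sub>R b + x) \<le> R" by (rule R(2))
      moreover have "norm x \<le> norm (t n *\<^sub>R b + x) + norm (t n *\<^sub>R b)"
        using norm_triangle_ineq4[of "t n *\<^sub>R b + x" "t n *\<^sub>R b"] by simp
      moreover have "norm (t n *\<^sub>R b) \<le> norm b" using t[of n] by (simp add: mult_left_le_one_le)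
      ultimately show False using that by (simp add: Q_def)
    qed
    ultimately show ?thesis by (simp add: q_def out)
  qed
  have qB: "\<bar>q n x\<bar> \<le> B * norm b" for n x
  proof -
    have "norm (f (t n *\<^sub>R b + x) - f x) \<le> B * norm ((t n *\<^sub>R b + x) - x)"
    proof (rule differentiable_bound[of UNIV f "\<lambda>y q. Df y \<bullet> q"])
      show "(f has_derivative (\<lambda>q. Df z \<bullet> q)) (at z within UNIV)" for z
        using f by (simp add: C1_grad_def)
      show "onorm ((\<bullet>) (Df z)) \<le> B" for z
      proof (rule onorm_bound)
        show "norm (Df z \<bullet> x) \<le> B * norm x" for x
          using order_trans[OF Cauchy_Schwarz_ineq2 mult_right_mono[OF B norm_ge_zero]] by simp
      qed (use B0 in simp)
    qed auto
    then show ?thesis using t(1)[of n] by (simp add: q_def field_simps abs_mult)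
  qed
  have lim: "(\<lambda>n. q n x) \<longlonglongrightarrow> Df x \<bullet> b" for x
  proof -
    have "(f has_derivative (\<lambda>h. Df x \<bullet> h)) (at x)" using f by (simp add: C1_grad_def)
    from directional_derivative_LIMSEQ[OF this] show ?thesis unfolding q_def t_def .
  qed
  have "(\<lambda>n. \<integral>x. q n x \<partial>lborel) \<longlonglongrightarrow> (\<integral>x. Df x \<bullet> b \<partial>lborel)"
  proof (rule integral_dominated_convergence)
    show "integrable lborel (\<lambda>x. (B * norm b) * indicator Q x :: real)"
      using emeasure_lborel_cball_finite[of "0::'a" "R + norm b"]
      by (intro integrable_mult_right integrable_real_indicator) (auto simp: Q_def)
    show "AE x in lborel. norm (q n x) \<le> (B * norm b) * indicator Q x" for n
      using qB[of n] qout[of _ n] by (intro AE_I2) (auto split: split_indicator)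
    show "AE x in lborel. (\<lambda>n. q n x) \<longlonglongrightarrow> Df x \<bullet> b" by (intro AE_I2 lim)
  qed measurable
  then show ?thesis unfolding q0 by (simp add: LIMSEQ_const_iff)
qed

text \<open>The derivative of the product has integral zero. The product is compactly supported in
  \<Omega> because \<zeta> is, so integrals over \<Omega> and over the whole space agree, whatever
  values \<phi> takes on the boundary.\<close>

lemma test_fn_integration_by_parts:
  fixes \<Omega> :: "'a::euclidean_space set"
  assumes \<phi>: "test_fn UNIV \<phi>" and \<zeta>: "test_fn \<Omega> \<zeta>" and \<Omega>: "open \<Omega>"
  shows "(\<integral>x. \<phi> x * (grad \<zeta> x \<bullet> b) \<partial>lebesgue_on \<Omega>) = - (\<integral>x. (grad \<phi> x \<bullet> b) * \<zeta> x \<partial>lebesgue_on \<Omega>)"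
proof -
  have s\<phi>: "C1_grad \<phi> (grad \<phi>)" and s\<zeta>: "C1_grad \<zeta> (grad \<zeta>)"
    using assms by (auto simp: test_fn_def intro: smooth_fn_C1_grad)
  note [measurable] = C1_gradD(3,4)[OF s\<phi>] C1_gradD(3,4)[OF s\<zeta>]
  define K where "K = tsupp \<zeta>"
  have K: "compact K" "K \<subseteq> \<Omega>" using \<zeta> by (auto simp: K_def test_fn_def)
  have out: "\<zeta> x = 0" "grad \<zeta> x = 0" if "x \<notin> K" for x using grad_outside_support[of x \<zeta>] that by (auto simp: K_def)
  have out\<Omega>: "\<zeta> x = 0" "grad \<zeta> x = 0" if "x \<notin> \<Omega>" for x using out[of x] that K by auto
  obtain B1 where B1: "B1 \<ge> 0" "\<And>x. \<bar>\<phi> x\<bar> \<le> B1" "\<And>x. norm (grad \<phi> x) \<le> B1" using test_fn_bounded[OF \<phi>] by metis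
  obtain B2 where B2: "B2 \<ge> 0" "\<And>x. \<bar>\<zeta> x\<bar> \<le> B2" "\<And>x. norm (grad \<zeta> x) \<le> B2" using test_fn_bounded[OF \<zeta>] by metis
  have i1: "integrable lborel (\<lambda>x. \<phi> x * (grad \<zeta> x \<bullet> b))"
  proof (rule integrable_lborel_bounded_support[OF _ _ K(1)])
    show "\<bar>\<phi> x * (grad \<zeta> x \<bullet> b)\<bar> \<le> B1 * (B2 * norm b)" for x
      unfolding abs_mult using B1 B2 order_trans[OF Cauchy_Schwarz_ineq2 mult_right_mono[OF B2(3) norm_ge_zero]]
      by (intro mult_mono) auto
  qed (auto simp: out)
  have i2: "integrable lborel (\<lambda>x. (grad \<phi> x \<bullet> b) * \<zeta> x)"
  proof (rule integrable_lborel_bounded_support[OF _ _ K(1)])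
    show "\<bar>(grad \<phi> x \<bullet> b) * \<zeta> x\<bar> \<le> (B1 * norm b) * B2" for x
      unfolding abs_mult using B1 B2 order_trans[OF Cauchy_Schwarz_ineq2 mult_right_mono[OF B1(3) norm_ge_zero]]
      by (intro mult_mono) auto
  qed (auto simp: out)
  have "C1_grad (\<lambda>x. \<phi> x * \<zeta> x) (\<lambda>x. \<phi> x *\<^sub>R grad \<zeta> x + \<zeta> x *\<^sub>R grad \<phi> x)"
    unfolding C1_grad_def
  proof (intro conjI allI)
    fix x
    have "(\<phi> has_derivative (\<lambda>h. grad \<phi> x \<bullet> h)) (at x)" "(\<zeta> has_derivative (\<lambda>h. grad \<zeta> x \<bullet> h)) (at x)"
      using s\<phi> s\<zeta> by (auto simp: C1_grad_def)
    then have "((\<lambda>x. \<phi> x * \<zeta> x) has_derivative (\<lambda>h. \<phi> x * (grad \<zeta> x \<bullet> h) + (grad \<phi> x \<bullet> h) * \<zeta> x)) (at x)"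
      by (rule has_derivative_mult)
    then show "((\<lambda>x. \<phi> x * \<zeta> x) has_derivative (\<lambda>h. (\<phi> x *\<^sub>R grad \<zeta> x + \<zeta> x *\<^sub>R grad \<phi> x) \<bullet> h)) (at x)"
      by (simp add: inner_add_left mult.commute)
    show "continuous_on UNIV (\<lambda>x. \<phi> x *\<^sub>R grad \<zeta> x + \<zeta> x *\<^sub>R grad \<phi> x)"
      using C1_gradD(1,2)[OF s\<phi>] C1_gradD(1,2)[OF s\<zeta>] by (intro continuous_intros)
  qed
  then have "(\<integral>x. (\<phi> x *\<^sub>R grad \<zeta> x + \<zeta> x *\<^sub>R grad \<phi> x) \<bullet> b \<partial>lborel) = 0"
    by (rule integral_directional_derivative_eq_0[OF _ K(1)]) (simp add: out)
  then have sum0: "(\<integral>x. \<phi> x * (grad \<zeta> x \<bullet> b) \<partial>lborel) + (\<integral>x. (grad \<phi> x \<bullet> b) * \<zeta> x \<partial>lborel) = 0"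
    using i1 i2 by (simp add: inner_add_left mult.commute)
  have conv: "(\<integral>x. g x \<partial>lebesgue_on \<Omega>) = (\<integral>x. g x \<partial>lborel)"
    if "g \<in> borel_measurable borel" "\<And>x. x \<notin> \<Omega> \<Longrightarrow> g x = 0" for g :: "'a \<Rightarrow> real"
  proof -
    have "(\<integral>x. g x \<partial>lebesgue_on \<Omega>) = (\<integral>x. indicator \<Omega> x *\<^sub>R g x \<partial>lebesgue)"
      using \<Omega> by (intro integral_restrict_space) auto
    also have "(\<lambda>x. indicator \<Omega> x *\<^sub>R g x) = g" using that(2) by (auto simp: fun_eq_iff indicator_def)
    also have "(\<integral>x. g x \<partial>lebesgue) = (\<integral>x. g x \<partial>lborel)" using that(1) by (intro integral_completion) auto
    finally show ?thesis .
  qed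
  show ?thesis using sum0
    by (subst (1 2) conv) (auto simp: out\<Omega>)
qed

section \<open>Uniform convexity and limits in Lebesgue spaces\<close>

lemma mult_le_powr_add:
  fixes a b p q :: real
  assumes "p > 1" "q = p / (p - 1)" "a \<ge> 0" "b \<ge> 0"
  shows "a * b \<le> a powr q + b powr p"
proof -
  have q: "q > 1" "1/q + 1/p = 1" using assms(1) unfolding assms(2) by (simp_all add: field_simps)
  have "a * b \<le> a powr q / q + b powr p / p"
    using Youngs_inequality[OF q(1) assms(1) q(2)] assms by auto
  also have "\<dots> \<le> a powr q / 1 + b powr p / 1"
    using q assms(1) by (intro add_mono divide_left_mono) auto
  also have "\<dots> = a powr q + b powr p" by simp
  finally show ?thesis .
qed

text \<open>Two tangent steps through the midpoint z, where the slope is strictly larger than at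
  m.\<close>

lemma powr_strict_tangent:
  fixes m y p :: real
  assumes p: "p > 1" and m: "0 \<le> m" "m < y"
  shows "m powr p + p * m powr (p - 1) * (y - m) < y powr p"
proof -
  define z where "z = (m + y) / 2"
  have z: "m < z" "z < y" using m by (auto simp: z_def)
  have 1: "m powr p + p * m powr (p - 1) * (z - m) \<le> z powr p"
    by (rule powr_tangent) (use p m z in auto)
  have 2: "z powr p + p * z powr (p - 1) * (y - z) \<le> y powr p"
    by (rule powr_tangent) (use p m z in auto)
  have "m powr (p - 1) < z powr (p - 1)" using p m z by (intro powr_less_mono2) auto
  then have "p * m powr (p - 1) * (y - z) < p * z powr (p - 1) * (y - z)"
    using p z by (intro mult_strict_right_mono mult_strict_left_mono) auto
  with 1 2 show ?thesis by (simp add: algebra_simps)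
qed

text \<open>Tangents at the midpoint m: their linear terms cancel, and if x and y differ, one of
  them lies strictly above m.\<close>

lemma powr_midpoint:
  fixes x y p :: real
  assumes p: "p > 1" and xy: "0 \<le> x" "0 \<le> y"
  shows "((x + y) / 2) powr p \<le> (x powr p + y powr p) / 2"
    and "x \<noteq> y \<Longrightarrow> ((x + y) / 2) powr p < (x powr p + y powr p) / 2"
proof -
  define m where "m = (x + y) / 2"
  have m0: "m \<ge> 0" using xy by (simp add: m_def)
  have t: "m powr p + p * m powr (p - 1) * (h - m) \<le> h powr p" if "h \<ge> 0" for h
    by (rule powr_tangent) (use p m0 that in auto)
  have "p * m powr (p - 1) * (x - m) + p * m powr (p - 1) * (y - m) = p * m powr (p - 1) * ((x - m) + (y - m))"
    by (simp only: distrib_left)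
  also have "(x - m) + (y - m) = 0" by (simp add: m_def field_simps)
  finally have e: "p * m powr (p - 1) * (x - m) + p * m powr (p - 1) * (y - m) = 0" by simp
  obtain k where k: "k = (\<lambda>h. p * m powr (p - 1) * (h - m))" by blast
  note t = t[unfolded k[THEN fun_cong, symmetric]] and e = e[unfolded k[THEN fun_cong, symmetric]]
  show "((x + y) / 2) powr p \<le> (x powr p + y powr p) / 2"
  proof -
    have "2 * m powr p \<le> x powr p + y powr p" using t[OF xy(1)] t[OF xy(2)] e by linarith
    then show ?thesis unfolding m_def[symmetric] by simp
  qed
  assume "x \<noteq> y"
  then consider "m < x" | "m < y" by (fastforce simp: m_def)
  then have "2 * m powr p < x powr p + y powr p"
    using powr_strict_tangent[OF p m0, of x, unfolded k[THEN fun_cong, symmetric]]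
      powr_strict_tangent[OF p m0, of y, unfolded k[THEN fun_cong, symmetric]] t[OF xy(1)] t[OF xy(2)] e
    by cases linarith+
  then show "((x + y) / 2) powr p < (x powr p + y powr p) / 2" unfolding m_def[symmetric] by simp
qed

definition cvx_gap :: "real \<Rightarrow> 'a::euclidean_space \<Rightarrow> 'a \<Rightarrow> real" where
  "cvx_gap p a b = (norm a powr p + norm b powr p) / 2 - norm ((1/2) *\<^sub>R a + (1/2) *\<^sub>R b) powr p"

text \<open>Different norms give a positive gap by strict convexity of the power; for equal norms
  the parallelogram identity makes the midpoint strictly shorter.\<close>

lemma cvx_gap:
  fixes a b :: "'a::euclidean_space"
  assumes p: "p > 1"
  shows "cvx_gap p a b \<ge> 0" and "a \<noteq> b \<Longrightarrow> cvx_gap p a b > 0"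
proof -
  define c where "c = (1/2) *\<^sub>R a + (1/2) *\<^sub>R b"
  have c: "norm c \<le> (norm a + norm b) / 2"
    using norm_triangle_ineq[of "(1/2) *\<^sub>R a" "(1/2) *\<^sub>R b"] by (simp add: c_def)
  then have cp: "norm c powr p \<le> ((norm a + norm b) / 2) powr p" using p by (intro powr_mono2) auto
  show "cvx_gap p a b \<ge> 0"
    using cp powr_midpoint(1)[OF p, of "norm a" "norm b"] by (simp add: cvx_gap_def c_def)
  assume ab: "a \<noteq> b"
  show "cvx_gap p a b > 0"
  proof (cases "norm a = norm b")
    case False
    then show ?thesis
      using cp powr_midpoint(2)[OF p, of "norm a" "norm b"] by (simp add: cvx_gap_def c_def)
  next
    case True
    have "norm c \<noteq> norm a"
    proof
      assume eq: "norm c = norm a"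
      have "(a - b) \<bullet> (a - b) = 2 * (a \<bullet> a) + 2 * (b \<bullet> b) - 4 * (c \<bullet> c)"
        by (simp add: c_def inner_add_left inner_add_right inner_diff_left inner_diff_right inner_commute[of b a] field_simps)
      also have "c \<bullet> c = a \<bullet> a" using eq by (simp add: dot_square_norm)
      also have "b \<bullet> b = a \<bullet> a" using True by (simp add: dot_square_norm)
      finally have "(a - b) \<bullet> (a - b) = 0" by simp
      with ab show False by simp
    qed
    then have "norm c < norm a" using c True by simp
    then have "norm c powr p < norm a powr p" using p by (intro powr_less_mono2) auto
    then show ?thesis using True by (simp add: cvx_gap_def c_def)
  qed
qed

text \<open>By homogeneity this is a compactness statement on the unit sphere of
  \<open>norm a powr p + norm b powr p\<close>.\<close>
lemma norm_powr_uniformly_convex: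
  fixes p \<eta> :: real
  assumes p: "p > 1" and \<eta>: "\<eta> > 0"
  shows "\<exists>c\<ge>0. \<forall>a b :: 'a::euclidean_space.
    norm (a - b) powr p \<le> \<eta> * (norm a powr p + norm b powr p) + c * cvx_gap p a b"
proof -
  define K where "K = {ab :: 'a \<times> 'a. norm (fst ab) powr p + norm (snd ab) powr p = 1 \<and> norm (fst ab - snd ab) powr p \<ge> \<eta>}"
  have cont: "continuous_on UNIV (\<lambda>ab. norm (f ab) powr p)" if "continuous_on UNIV f" for f :: "'a \<times> 'a \<Rightarrow> 'a"
    using p by (intro continuous_on_powr' continuous_intros that) auto
  have "closed K" unfolding K_def
    by (intro closed_Collect_conj closed_Collect_eq closed_Collect_le continuous_on_add cont continuous_intros)
  moreover have "bounded K"
  proof (rule boundedI)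
    fix ab assume "ab \<in> K"
    then have "norm (fst ab) powr p \<le> 1" "norm (snd ab) powr p \<le> 1"
      by (simp_all add: K_def) (metis add.commute le_add_same_cancel2 powr_ge_zero)+
    then have "\<not> 1 powr p < norm (fst ab) powr p" "\<not> 1 powr p < norm (snd ab) powr p" by auto
    then have "norm (fst ab) \<le> 1" "norm (snd ab) \<le> 1"
      using p powr_less_mono2[of p 1 "norm (fst ab)"] powr_less_mono2[of p 1 "norm (snd ab)"] by (meson not_le zero_le_one order_trans less_trans zero_less_one)+
    then show "norm ab \<le> 2" using norm_Pair_le[of "fst ab" "snd ab"] by simp
  qed
  ultimately have K: "compact K" by (simp add: compact_eq_bounded_closed)
  have "continuous_on UNIV (\<lambda>ab::'a \<times> 'a. cvx_gap p (fst ab) (snd ab))"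
    unfolding cvx_gap_def divide_inverse by (intro continuous_intros cont)
  then have cg: "continuous_on K (\<lambda>ab. cvx_gap p (fst ab) (snd ab))" by (rule continuous_on_subset) simp
  have pos: "cvx_gap p (fst ab) (snd ab) > 0" if "ab \<in> K" for ab
  proof (rule cvx_gap(2)[OF p])
    show "fst ab \<noteq> snd ab" using that \<eta> by (auto simp: K_def)
  qed
  have "\<exists>d>0. \<forall>ab\<in>K. d \<le> cvx_gap p (fst ab) (snd ab)"
  proof (cases "K = {}")
    case False
    from continuous_attains_inf[OF K False cg] pos show ?thesis by blast
  qed (auto intro: exI[of _ 1])
  then obtain d where d: "d > 0" "\<And>ab. ab \<in> K \<Longrightarrow> d \<le> cvx_gap p (fst ab) (snd ab)" by blast
  have scale: "norm (r *\<^sub>R x) powr p = r powr p * norm x powr p" if "r \<ge> 0" for r and x :: 'a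
    using that by (simp add: powr_mult)
  \<comment> \<open>On K the gap is at least d, and norm (a - b) to the power p never exceeds 2^p
    times the sum of the two powers; hence the constant 2^p / d.\<close>
  show ?thesis
  proof (intro exI[of _ "2 powr p / d"] conjI allI)
    show "2 powr p / d \<ge> 0" using d by simp
    fix a b :: 'a
    define s where "s = norm a powr p + norm b powr p"
    have s0: "s \<ge> 0" by (simp add: s_def)
    have gap0: "cvx_gap p a b \<ge> 0" by (rule cvx_gap(1)[OF p])
    show "norm (a - b) powr p \<le> \<eta> * (norm a powr p + norm b powr p) + 2 powr p / d * cvx_gap p a b"
    proof (cases "norm (a - b) powr p \<le> \<eta> * s")
      case True
      have "0 \<le> 2 powr p / d * cvx_gap p a b" using gap0 d by simp
      with True show ?thesis by (simp add: s_def)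
    next
      case False
      have "s \<noteq> 0"
      proof
        assume "s = 0"
        then have "norm a powr p = 0" "norm b powr p = 0"
          unfolding s_def by (metis add_nonneg_eq_0_iff powr_ge_zero)+
        then have "a = 0" "b = 0" by auto
        with False show False using s0 \<eta> by simp
      qed
      with s0 have s: "s > 0" by simp
      \<comment> \<open>Scaling by r moves (a, b) to the unit sphere. All terms are homogeneous of
        degree p, so the bound on K scales back with the factor s.\<close>
      define r where "r = s powr (- 1 / p)"
      have "r powr p = s powr (- 1)" using p by (simp add: r_def powr_powr)
      then have r: "r \<ge> 0" "r powr p = 1 / s" using s by (auto simp: r_def powr_minus_divide)
      have gr: "cvx_gap p (r *\<^sub>R a) (r *\<^sub>R b) = cvx_gap p a b / s"
      proof -
        have "(1/2) *\<^sub>R (r *\<^sub>R a) + (1/2) *\<^sub>R (r *\<^sub>R b) = r *\<^sub>R ((1/2) *\<^sub>R a + (1/2) *\<^sub>R b)"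
          by (simp add: algebra_simps)
        then show ?thesis unfolding cvx_gap_def by (simp only: scale[OF r(1)] r(2)) (simp add: add_divide_distrib diff_divide_distrib)
      qed
      have "(r *\<^sub>R a, r *\<^sub>R b) \<in> K"
      proof -
        have "norm (r *\<^sub>R a) powr p + norm (r *\<^sub>R b) powr p = 1"
          unfolding scale[OF r(1)] r(2) distrib_left[symmetric] s_def[symmetric] using s by simp
        moreover have "norm (r *\<^sub>R a - r *\<^sub>R b) powr p \<ge> \<eta>"
          unfolding scaleR_diff_right[symmetric] scale[OF r(1)] r(2) using False s by (simp add: field_simps)
        ultimately show ?thesis by (simp add: K_def)
      qed
      from d(2)[OF this] have ds: "d * s \<le> cvx_gap p a b" using gr s by (simp add: field_simps)
      have "norm (a - b) powr p \<le> (norm a + norm b) powr p"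
        using p by (intro powr_mono2 norm_triangle_ineq4) auto
      also have "\<dots> \<le> 2 powr p * s" unfolding s_def by (rule powr_add_le) (use p in auto)
      also have "\<dots> \<le> 2 powr p / d * cvx_gap p a b" using ds d by (simp add: field_simps)
      also have "\<dots> \<le> \<eta> * s + 2 powr p / d * cvx_gap p a b" using s \<eta> by simp
      finally show ?thesis by (simp add: s_def)
    qed
  qed
qed

section \<open>Membership and strong limits in Lebesgue spaces\<close>

lemma le_enn2real:
  assumes "ennreal y \<le> z" "z \<noteq> \<infinity>"
  shows "y \<le> enn2real z"
  using assms by (cases z) (auto simp: ennreal_le_iff2)

lemma ennreal_le_suminf:
  fixes f :: "nat \<Rightarrow> ennreal"
  shows "f n \<le> suminf f"
  using sum_le_suminf[of f "{n}"] by simp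

lemma Cauchy_fast_subsequence:
  fixes d :: "nat \<Rightarrow> nat \<Rightarrow> real" and c :: "nat \<Rightarrow> real"
  assumes "\<And>e. e > 0 \<Longrightarrow> \<exists>N. \<forall>m\<ge>N. \<forall>n\<ge>N. d m n < e" and c: "\<And>n. c n > 0"
  obtains r where "strict_mono r" "\<And>n. d (r (Suc n)) (r n) < c n"
proof -
  obtain N where N: "\<And>k m n. m \<ge> N k \<Longrightarrow> n \<ge> N k \<Longrightarrow> d m n < c k"
    using assms(1)[OF c] by metis
  define r where "r = rec_nat (N 0) (\<lambda>k rk. max (Suc rk) (N (Suc k)))"
  have r: "r (Suc k) = max (Suc (r k)) (N (Suc k))" "r 0 = N 0" for k by (auto simp: r_def)
  have "r k \<ge> N k" for k by (cases k) (auto simp: r)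
  then have "d (r (Suc n)) (r n) < c n" for n
    using N[where k = n and m = "r (Suc n)" and n = "r n"] by (simp add: r(1)[of n] max.coboundedI1 le_SucI)
  moreover have "r k < r (Suc k)" for k by (auto simp: r)
  ultimately show ?thesis
    by (intro that[of r]) (auto simp: strict_mono_Suc_iff)
qed

lemma Lp_memD:
  assumes "Lp_mem M p f"
  shows "f \<in> borel_measurable M" "integrable M (\<lambda>x. norm (f x) powr p)"
  using assms by (auto simp: Lp_mem_def)

lemma Lp_mem_dominated:
  fixes f :: "'b \<Rightarrow> 'c::{real_normed_vector,second_countable_topology}"
    and g :: "'b \<Rightarrow> 'd::{real_normed_vector,second_countable_topology}"
  assumes "Lp_mem M p g" "f \<in> borel_measurable M" "AE x in M. norm (f x) \<le> norm (g x)" "p > 0"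
  shows "Lp_mem M p f"
  unfolding Lp_mem_def
proof (intro conjI assms(2) Bochner_Integration.integrable_bound[OF Lp_memD(2)[OF assms(1)]])
  show "AE x in M. norm (norm (f x) powr p) \<le> norm (norm (g x) powr p)"
    using assms(3) by eventually_elim (use assms(4) in \<open>auto intro: powr_mono2\<close>)
  show "(\<lambda>x. norm (f x) powr p) \<in> borel_measurable M" using assms(2) by measurable
qed

lemma Lp_mem_iff_nn:
  fixes f :: "'b \<Rightarrow> 'c::{real_normed_vector,second_countable_topology}"
  shows "Lp_mem M p f \<longleftrightarrow> f \<in> borel_measurable M \<and> (\<integral>\<^sup>+x. ennreal (norm (f x) powr p) \<partial>M) < \<infinity>"
  unfolding Lp_mem_def by (auto simp: integrable_iff_bounded)

lemma Lp_mem_norm: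
  fixes f :: "'b \<Rightarrow> 'c::{real_normed_vector,second_countable_topology}"
  shows "Lp_mem M p f \<Longrightarrow> Lp_mem M p (\<lambda>x. norm (f x))"
  unfolding Lp_mem_def by auto

lemma Lp_mem_scaleR:
  fixes f :: "'b \<Rightarrow> 'c::{real_normed_vector,second_countable_topology}"
  assumes "Lp_mem M p f"
  shows "Lp_mem M p (\<lambda>x. c *\<^sub>R f x)"
  using assms unfolding Lp_mem_def by (auto simp: powr_mult)

lemma Lp_mem_add:
  fixes f g :: "'b \<Rightarrow> 'c::{real_normed_vector,second_countable_topology}"
  assumes "Lp_mem M p f" "Lp_mem M p g" "p > 0"
  shows "Lp_mem M p (\<lambda>x. f x + g x)"
  unfolding Lp_mem_def
proof
  note [measurable] = Lp_memD(1)[OF assms(1)] Lp_memD(1)[OF assms(2)]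
  show "(\<lambda>x. f x + g x) \<in> borel_measurable M" by measurable
  have "integrable M (\<lambda>x. 2 powr p * (norm (f x) powr p + norm (g x) powr p))"
    using Lp_memD(2)[OF assms(1)] Lp_memD(2)[OF assms(2)] by auto
  then show "integrable M (\<lambda>x. norm (f x + g x) powr p)"
  proof (rule Bochner_Integration.integrable_bound)
    have "norm (f x + g x) powr p \<le> 2 powr p * (norm (f x) powr p + norm (g x) powr p)" for x
      using powr_mono2[of p "norm (f x + g x)" "norm (f x) + norm (g x)"] powr_add_le[of p "norm (f x)" "norm (g x)"] assms(3)
        norm_triangle_ineq[of "f x" "g x"] by force
    then show "AE x in M. norm (norm (f x + g x) powr p) \<le> norm (2 powr p * (norm (f x) powr p + norm (g x) powr p))"
      by (auto intro!: AE_I2 simp: abs_mult)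
  qed measurable
qed

lemma Lp_mem_diff:
  fixes f g :: "'b \<Rightarrow> 'c::{real_normed_vector,second_countable_topology}"
  assumes "Lp_mem M p f" "Lp_mem M p g" "p > 0"
  shows "Lp_mem M p (\<lambda>x. f x - g x)"
  using Lp_mem_add[OF assms(1) Lp_mem_scaleR[OF assms(2), of "-1"] assms(3)] by simp

lemma Lp_mem_const:
  assumes "finite_measure M"
  shows "Lp_mem M p (\<lambda>x. c)"
  using assms by (auto simp: Lp_mem_def intro: finite_measure.integrable_const)

lemma Lp_mem_bounded:
  fixes f :: "'b \<Rightarrow> 'c::{real_normed_vector,second_countable_topology}"
  assumes "finite_measure M" "f \<in> borel_measurable M" "\<And>x. norm (f x) \<le> B" "p > 0"
  shows "Lp_mem M p f"
proof (rule Lp_mem_dominated[OF Lp_mem_const[OF assms(1)]])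
  show "AE x in M. norm (f x) \<le> norm (B::real)"
    using order_trans[OF assms(3) abs_ge_self] by (intro AE_I2) simp
qed (use assms in auto)

lemma integrable_inner_Lp:
  fixes f g :: "'b \<Rightarrow> 'c::euclidean_space"
  assumes p: "p > 1" "q = p / (p - 1)" and fg: "Lp_mem M q f" "Lp_mem M p g"
  shows "integrable M (\<lambda>x. f x \<bullet> g x)"
proof -
  note [measurable] = Lp_memD(1)[OF fg(1)] Lp_memD(1)[OF fg(2)]
  show ?thesis
  proof (rule Bochner_Integration.integrable_bound)
  show "integrable M (\<lambda>x. norm (f x) powr q + norm (g x) powr p)"
    using fg by (auto simp: Lp_mem_def)
  have "norm (f x \<bullet> g x) \<le> norm (f x) powr q + norm (g x) powr p" for x
    using Cauchy_Schwarz_ineq2[of "f x" "g x"] mult_le_powr_add[OF p, of "norm (f x)" "norm (g x)"] by simp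
  then show "AE x in M. norm (f x \<bullet> g x) \<le> norm (norm (f x) powr q + norm (g x) powr p)" by simp
  qed measurable
qed

text \<open>One member of the sequence at finite distance from F is enough.\<close>

lemma Lp_mem_limit:
  fixes f :: "nat \<Rightarrow> 'b \<Rightarrow> 'c::{real_normed_vector,second_countable_topology}"
  assumes f: "\<And>n. Lp_mem M p (f n)" and F: "F \<in> borel_measurable M" and p: "p > 0"
    and lim: "(\<lambda>n. \<integral>\<^sup>+x. ennreal (norm (f n x - F x) powr p) \<partial>M) \<longlonglongrightarrow> 0"
  shows "Lp_mem M p F"
proof -
  have "\<forall>\<^sub>F n in sequentially. (\<integral>\<^sup>+x. ennreal (norm (f n x - F x) powr p) \<partial>M) < 1"
    using lim by (rule order_tendstoD) simp
  then obtain n where "(\<integral>\<^sup>+x. ennreal (norm (f n x - F x) powr p) \<partial>M) < 1"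
    by (auto simp: eventually_sequentially)
  then have "(\<integral>\<^sup>+x. ennreal (norm (f n x - F x) powr p) \<partial>M) < \<infinity>"
    using less_trans[OF _ ennreal_less_top[of 1]] by simp
  moreover have "(\<lambda>x. f n x - F x) \<in> borel_measurable M" using Lp_memD(1)[OF f[of n]] F by measurable
  ultimately have "Lp_mem M p (\<lambda>x. f n x - F x)" by (simp add: Lp_mem_iff_nn)
  from Lp_mem_diff[OF f[of n] this p] show ?thesis by simp
qed

text \<open>Young's inequality with a weight \<eta> plays the part of Hoelder's: the term with g is
  made small by \<eta>, the term with f n - F by n.\<close>

lemma tendsto_integral_inner_Lp:
  fixes f :: "nat \<Rightarrow> 'b \<Rightarrow> 'c::euclidean_space"
  assumes p: "p > 1" "q = p / (p - 1)" and g: "Lp_mem M q g" and f: "\<And>n. Lp_mem M p (f n)"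
    and F: "Lp_mem M p F"
    and lim: "(\<lambda>n. \<integral>\<^sup>+x. ennreal (norm (f n x - F x) powr p) \<partial>M) \<longlonglongrightarrow> 0"
  shows "(\<lambda>n. \<integral>x. g x \<bullet> f n x \<partial>M) \<longlonglongrightarrow> (\<integral>x. g x \<bullet> F x \<partial>M)"
proof (rule LIMSEQ_I)
  fix e :: real assume e: "e > 0"
  have q: "q > 1" using p(1) unfolding p(2) by (simp add: field_simps)
  define A where "A = (\<integral>x. norm (g x) powr q \<partial>M)"
  define B where "B n = (\<integral>x. norm (f n x - F x) powr p \<partial>M)" for n
  have A0: "A \<ge> 0" unfolding A_def by (intro Bochner_Integration.integral_nonneg) auto
  have d: "Lp_mem M p (\<lambda>x. f n x - F x)" for n using f F p by (intro Lp_mem_diff) auto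
  have Bn: "(\<integral>\<^sup>+x. ennreal (norm (f n x - F x) powr p) \<partial>M) = ennreal (B n)" for n
    unfolding B_def using Lp_memD(2)[OF d[of n]] by (intro nn_integral_eq_integral) auto
  have B0: "B n \<ge> 0" for n unfolding B_def by (intro Bochner_Integration.integral_nonneg) auto
  have Blim: "B \<longlonglongrightarrow> 0"
    using lim B0 unfolding Bn by (simp add: ennreal_tendsto_0_iff)
  \<comment> \<open>Chosen so that \<open>\<eta> powr q * A\<close> is at most e/2; the summand 1
    covers A = 0.\<close>
  define \<eta> where "\<eta> = (e / (2 * (A + 1))) powr (1 / q)"
  have \<eta>: "\<eta> > 0" using e A0 by (simp add: \<eta>_def)
  have \<eta>q: "\<eta> powr q = e / (2 * (A + 1))" using q e A0 by (simp add: \<eta>_def powr_powr)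
  have b: "\<bar>(\<integral>x. g x \<bullet> f n x \<partial>M) - (\<integral>x. g x \<bullet> F x \<partial>M)\<bar> \<le> \<eta> powr q * A + (1 / \<eta>) powr p * B n" for n
  proof -
    have "(\<integral>x. g x \<bullet> f n x \<partial>M) - (\<integral>x. g x \<bullet> F x \<partial>M) = (\<integral>x. g x \<bullet> (f n x - F x) \<partial>M)"
      using integrable_inner_Lp[OF p g f[of n]] integrable_inner_Lp[OF p g F] by (simp add: inner_diff_right)
    also have "\<bar>\<dots>\<bar> \<le> (\<integral>x. \<eta> powr q * norm (g x) powr q + (1 / \<eta>) powr p * norm (f n x - F x) powr p \<partial>M)"
    proof (rule order_trans[OF integral_abs_bound integral_mono])
      show "integrable M (\<lambda>x. \<bar>g x \<bullet> (f n x - F x)\<bar>)" using integrable_inner_Lp[OF p g d[of n]] by simp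
      show "integrable M (\<lambda>x. \<eta> powr q * norm (g x) powr q + (1 / \<eta>) powr p * norm (f n x - F x) powr p)"
        using Lp_memD(2)[OF g] Lp_memD(2)[OF d[of n]] by auto
      fix x
      have "\<bar>g x \<bullet> (f n x - F x)\<bar> \<le> norm (g x) * norm (f n x - F x)" by (rule Cauchy_Schwarz_ineq2)
      also have "\<dots> = (\<eta> * norm (g x)) * ((1 / \<eta>) * norm (f n x - F x))" using \<eta> by simp
      also have "\<dots> \<le> (\<eta> * norm (g x)) powr q + ((1 / \<eta>) * norm (f n x - F x)) powr p"
        using \<eta> by (intro mult_le_powr_add[OF p]) auto
      also have "\<dots> = \<eta> powr q * norm (g x) powr q + (1 / \<eta>) powr p * norm (f n x - F x) powr p"
        using \<eta> by (simp only: powr_mult)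
      finally show "\<bar>g x \<bullet> (f n x - F x)\<bar> \<le> \<dots>" .
    qed
    also have "\<dots> = \<eta> powr q * A + (1 / \<eta>) powr p * B n"
      using Lp_memD(2)[OF g] Lp_memD(2)[OF d[of n]] by (simp add: A_def B_def)
    finally show ?thesis .
  qed
  have "\<eta> powr q * A \<le> e / 2"
    unfolding \<eta>q using e A0 by (simp add: field_simps)
  moreover have "(\<lambda>n. (1 / \<eta>) powr p * B n) \<longlonglongrightarrow> (1 / \<eta>) powr p * 0" by (intro tendsto_intros Blim)
  then have "\<forall>\<^sub>F n in sequentially. (1 / \<eta>) powr p * B n < e / 2"
    by (rule order_tendstoD(2)) (use e in simp)
  ultimately have "\<forall>\<^sub>F n in sequentially. norm ((\<integral>x. g x \<bullet> f n x \<partial>M) - (\<integral>x. g x \<bullet> F x \<partial>M)) < e"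
    by (auto elim!: eventually_mono intro: le_less_trans[OF b])
  then show "\<exists>no. \<forall>n\<ge>no. norm ((\<integral>x. g x \<bullet> f n x \<partial>M) - (\<integral>x. g x \<bullet> F x \<partial>M)) < e"
    by (simp add: eventually_sequentially)
qed

text \<open>Riesz-Fischer with a rate. The sum of the terms (2^n |f(n+1) - f(n)|)^p is integrable,
  and its p-th root s bounds the n-th increment by 2^-n s. This yields the a.e. limit, convergence
  in the mean, and one p-integrable majorant S of all errors, with which nonlinear terms pass to the
  limit by dominated convergence.\<close>

lemma Lp_fast_Cauchy_limit:
  fixes f :: "nat \<Rightarrow> 'b \<Rightarrow> 'c::euclidean_space"
  assumes p: "p > 1" and f[measurable]: "\<And>n. f n \<in> borel_measurable M"
    and fast: "\<And>n. (\<integral>\<^sup>+x. ennreal (norm (f (Suc n) x - f n x) powr p) \<partial>M) \<le> ennreal (2 powr (- (p + 1) * n))"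
  obtains F S where "F \<in> borel_measurable M" "Lp_mem M p (S :: 'b \<Rightarrow> real)"
    "AE x in M. (\<lambda>n. f n x) \<longlonglongrightarrow> F x" "AE x in M. \<forall>n. norm (f n x - F x) \<le> S x"
    "(\<lambda>n. \<integral>\<^sup>+x. ennreal (norm (f n x - F x) powr p) \<partial>M) \<longlonglongrightarrow> 0"
proof -
  define a where "a n x = norm (f (Suc n) x - f n x)" for n x
  have [measurable]: "a n \<in> borel_measurable M" for n unfolding a_def by measurable
  \<comment> \<open>In the rate -(p+1) n the part p n pays for the weight 2^n under the power, and
    the remaining n makes the series geometric.\<close>
  define S0 where "S0 x = (\<Sum>n. ennreal ((2 ^ n * a n x) powr p))" for x
  have [measurable]: "S0 \<in> borel_measurable M" unfolding S0_def by measurable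
  have "(\<integral>\<^sup>+x. S0 x \<partial>M) = (\<Sum>n. \<integral>\<^sup>+x. ennreal ((2 ^ n * a n x) powr p) \<partial>M)"
    unfolding S0_def by (rule nn_integral_suminf) measurable
  also have "\<dots> \<le> (\<Sum>n. ennreal ((1/2) ^ n))"
  proof (rule suminf_le)
    fix n
    have "(\<integral>\<^sup>+x. ennreal ((2 ^ n * a n x) powr p) \<partial>M) = (\<integral>\<^sup>+x. ennreal ((2 ^ n) powr p) * ennreal (a n x powr p) \<partial>M)"
      by (intro nn_integral_cong) (simp add: powr_mult a_def ennreal_mult)
    also have "\<dots> = ennreal ((2 ^ n) powr p) * (\<integral>\<^sup>+x. ennreal (a n x powr p) \<partial>M)"
      by (rule nn_integral_cmult) measurable
    also have "\<dots> \<le> ennreal ((2 ^ n) powr p) * ennreal (2 powr (- (p + 1) * n))"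
      using fast[of n] by (intro mult_left_mono) (auto simp: a_def)
    also have "\<dots> = ennreal ((1/2) ^ n)"
    proof -
      have "(2 ^ n) powr p * 2 powr (- (p + 1) * n) = (2::real) powr (real n * p + (- (p + 1) * n))"
        by (simp add: powr_realpow[symmetric] powr_powr powr_add)
      also have "real n * p + (- (p + 1) * n) = - real n" by (simp add: algebra_simps)
      also have "(2::real) powr (- real n) = (1/2) ^ n"
        by (simp add: powr_minus powr_realpow power_one_over inverse_eq_divide)
      finally show ?thesis by (simp add: ennreal_mult[symmetric])
    qed
    finally show "(\<integral>\<^sup>+x. ennreal ((2 ^ n * a n x) powr p) \<partial>M) \<le> ennreal ((1/2) ^ n)" .
  qed auto
  also have "\<dots> = ennreal 2"
    using suminf_geometric[of "1/2::real"] by (subst suminf_ennreal2) (auto intro: summable_geometric)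
  finally have S0int: "(\<integral>\<^sup>+x. S0 x \<partial>M) \<le> 2" by simp
  then have "(\<integral>\<^sup>+x. S0 x \<partial>M) \<noteq> \<infinity>" by (auto simp: top_unique)
  then have S0fin: "AE x in M. S0 x \<noteq> \<infinity>" by (intro nn_integral_noteq_infinite) measurable
  define s where "s x = enn2real (S0 x) powr (1 / p)" for x
  have [measurable]: "s \<in> borel_measurable M" unfolding s_def by measurable
  have s0: "s x \<ge> 0" for x by (simp add: s_def)
  have as: "a n x \<le> (1/2) ^ n * s x" if x: "S0 x \<noteq> \<infinity>" for n x
  proof -
    have "ennreal ((2 ^ n * a n x) powr p) \<le> S0 x"
      unfolding S0_def by (rule ennreal_le_suminf)
    then have "(2 ^ n * a n x) powr p \<le> enn2real (S0 x)"
      by (rule le_enn2real[OF _ x])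
    then have "((2 ^ n * a n x) powr p) powr (1 / p) \<le> s x"
      unfolding s_def by (rule powr_mono2[rotated 2]) (use p in simp_all)
    moreover have "((2 ^ n * a n x) powr p) powr (1 / p) = 2 ^ n * a n x"
      unfolding powr_powr using p by (simp add: a_def)
    ultimately have "2 ^ n * a n x \<le> s x" by simp
    then show ?thesis by (simp add: field_simps power_one_over)
  qed
  \<comment> \<open>The bracket is the exact geometric sum of (1/2)^i for i from n to n + k - 1,
    which lets the induction close.\<close>
  have tele: "norm (f (n + k) x - f n x) \<le> s x * (2 * (1/2) ^ n - 2 * (1/2) ^ (n + k))" if x: "S0 x \<noteq> \<infinity>" for n k x
  proof (induction k)
    case (Suc k)
    have "norm (f (n + Suc k) x - f n x) \<le> a (n + k) x + norm (f (n + k) x - f n x)"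
      using norm_triangle_ineq[of "f (Suc (n + k)) x - f (n + k) x" "f (n + k) x - f n x"] by (simp add: a_def)
    also have "\<dots> \<le> (1/2) ^ (n + k) * s x + s x * (2 * (1/2) ^ n - 2 * (1/2) ^ (n + k))"
      using as[OF x, of "n + k"] Suc by simp
    also have "\<dots> = s x * (2 * (1/2) ^ n - 2 * (1/2) ^ (n + Suc k))" by (simp add: algebra_simps)
    finally show ?case .
  qed simp
  have tele': "norm (f m x - f n x) \<le> 2 * (1/2) ^ n * s x" if x: "S0 x \<noteq> \<infinity>" and "m \<ge> n" for m n x
  proof -
    have "norm (f m x - f n x) \<le> s x * (2 * (1/2) ^ n - 2 * (1/2) ^ m)"
      using tele[OF x, of n "m - n"] that by simp
    also have "\<dots> \<le> s x * (2 * (1/2) ^ n)" using s0 by (intro mult_left_mono) auto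
    finally show ?thesis by (simp add: mult_ac)
  qed
  define F where "F x = lim (\<lambda>n. f n x)" for x
  have [measurable]: "F \<in> borel_measurable M" unfolding F_def by measurable
  have conv: "(\<lambda>n. f n x) \<longlonglongrightarrow> F x" if x: "S0 x \<noteq> \<infinity>" for x
  proof -
    have "Cauchy (\<lambda>n. f n x)"
    proof (rule CauchyI)
      fix e :: real assume e: "e > 0"
      have "(\<lambda>n. 4 * (1/2) ^ n * s x) \<longlonglongrightarrow> 4 * 0 * s x" by (intro tendsto_intros LIMSEQ_realpow_zero) auto
      then have "\<forall>\<^sub>F n in sequentially. 4 * (1/2) ^ n * s x < e"
        by (rule order_tendstoD(2)) (use e in simp)
      then obtain N where N: "4 * (1/2) ^ N * s x < e" by (auto simp: eventually_sequentially)
      show "\<exists>N. \<forall>m\<ge>N. \<forall>n\<ge>N. norm (f m x - f n x) < e"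
      proof (intro exI allI impI)
        fix m n assume "m \<ge> N" "n \<ge> N"
        then have "norm (f m x - f N x) \<le> 2 * (1/2) ^ N * s x" "norm (f n x - f N x) \<le> 2 * (1/2) ^ N * s x"
          using tele'[OF x] by auto
        moreover have "norm (f m x - f n x) \<le> norm (f m x - f N x) + norm (f n x - f N x)"
          using norm_triangle_ineq4[of "f m x - f N x" "f n x - f N x"] by simp
        ultimately show "norm (f m x - f n x) < e" using N by linarith
      qed
    qed
    then show ?thesis unfolding F_def by (simp add: Cauchy_convergent convergent_LIMSEQ_iff[symmetric])
  qed
  have dist: "norm (f n x - F x) \<le> 2 * (1/2) ^ n * s x" if x: "S0 x \<noteq> \<infinity>" for n x
  proof -
    have "(\<lambda>m. norm (f m x - f n x)) \<longlonglongrightarrow> norm (F x - f n x)" by (intro tendsto_intros conv x)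
    moreover have "\<forall>\<^sub>F m in sequentially. norm (f m x - f n x) \<le> 2 * (1/2) ^ n * s x"
      using tele'[OF x] by (auto simp: eventually_sequentially)
    ultimately show ?thesis by (metis norm_minus_commute sequentially_bot tendsto_upperbound)
  qed
  have sp: "ennreal (s x powr p) \<le> S0 x" for x
    using p by (cases "S0 x") (auto simp: s_def powr_powr)
  show ?thesis
  proof
    show "Lp_mem M p (\<lambda>x. 2 * s x)"
    proof -
      have "(\<integral>\<^sup>+x. ennreal (norm (s x) powr p) \<partial>M) \<le> (\<integral>\<^sup>+x. S0 x \<partial>M)"
        using sp s0 by (intro nn_integral_mono) auto
      also have "\<dots> < \<infinity>" using \<open>(\<integral>\<^sup>+x. S0 x \<partial>M) \<noteq> \<infinity>\<close> by (simp add: less_top)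
      finally have "Lp_mem M p s" by (simp add: Lp_mem_iff_nn)
      from Lp_mem_scaleR[OF this, of 2] show ?thesis by simp
    qed
    show "AE x in M. (\<lambda>n. f n x) \<longlonglongrightarrow> F x" using S0fin by eventually_elim (rule conv)
    show "AE x in M. \<forall>n. norm (f n x - F x) \<le> 2 * s x"
      using S0fin
    proof eventually_elim
      case (elim x)
      have "2 * (1/2) ^ n * s x \<le> 2 * s x" for n
        using s0[of x] power_le_one[of "1/2::real" n] by (simp add: mult_left_le_one_le)
      then show ?case using dist[OF elim] order_trans by blast
    qed
    have le: "(\<integral>\<^sup>+x. ennreal (norm (f n x - F x) powr p) \<partial>M) \<le> ennreal ((2 * (1/2) ^ n) powr p * 2)" for n
    proof -
      have "(\<integral>\<^sup>+x. ennreal (norm (f n x - F x) powr p) \<partial>M) \<le> (\<integral>\<^sup>+x. ennreal ((2 * (1/2) ^ n) powr p) * S0 x \<partial>M)"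
      proof (rule nn_integral_mono_AE)
        show "AE x in M. ennreal (norm (f n x - F x) powr p) \<le> ennreal ((2 * (1/2) ^ n) powr p) * S0 x"
          using S0fin
        proof eventually_elim
          case (elim x)
          have "norm (f n x - F x) powr p \<le> (2 * (1/2) ^ n * s x) powr p"
            using dist[OF elim, of n] p by (intro powr_mono2) auto
          also have "\<dots> = (2 * (1/2) ^ n) powr p * s x powr p" by (simp only: powr_mult)
          finally have "ennreal (norm (f n x - F x) powr p) \<le> ennreal ((2 * (1/2) ^ n) powr p) * ennreal (s x powr p)"
            by (subst ennreal_mult[symmetric]) (auto intro: ennreal_leI)
          also have "\<dots> \<le> ennreal ((2 * (1/2) ^ n) powr p) * S0 x" by (intro mult_left_mono sp) auto
          finally show ?case .
        qed
      qed
      also have "\<dots> = ennreal ((2 * (1/2) ^ n) powr p) * (\<integral>\<^sup>+x. S0 x \<partial>M)" by (rule nn_integral_cmult) measurable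
      also have "\<dots> \<le> ennreal ((2 * (1/2) ^ n) powr p) * 2" by (intro mult_left_mono S0int) auto
      finally show ?thesis by (simp add: ennreal_mult)
    qed
    have "(\<lambda>n. (2 * (1/2) ^ n) powr p * 2) \<longlonglongrightarrow> (2 * 0) powr p * (2::real)"
      using p by (intro tendsto_mult tendsto_powr' tendsto_const LIMSEQ_realpow_zero) auto
    then have "(\<lambda>n. ennreal ((2 * (1/2) ^ n) powr p * 2)) \<longlonglongrightarrow> ennreal 0"
      using tendsto_ennrealI by fastforce
    then have lim0: "(\<lambda>n. ennreal ((2 * (1/2) ^ n) powr p * 2)) \<longlonglongrightarrow> 0" by simp
    show "(\<lambda>n. \<integral>\<^sup>+x. ennreal (norm (f n x - F x) powr p) \<partial>M) \<longlonglongrightarrow> 0"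
      by (rule tendsto_sandwich[OF _ _ tendsto_const lim0]) (use le in \<open>auto intro: always_eventually\<close>)
  qed measurable
qed

section \<open>The composed integrand\<close>

text \<open>M is the inverse of g extended by 0 below g(0), which builds the constraint m >= 0 into
  it. Strict monotonicity transfers continuity, and the two growth bounds exchange their roles under
  inversion.\<close>

lemma growth_inverse:
  fixes g :: "real \<Rightarrow> real" and \<beta> C :: real
  assumes cont: "continuous_on {0..} g" and mono: "strict_mono_on {0..} g" and \<beta>: "\<beta> > 0" and C: "C > 1"
    and gr: "\<And>m. m \<ge> 0 \<Longrightarrow> m powr \<beta> / C - C \<le> g m \<and> g m \<le> C * m powr \<beta> + C"
  obtains M where "\<And>s. M s \<ge> 0" "\<And>s. g (M s) = max s (g 0)" "continuous_on UNIV M" "mono M"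
    "\<And>s. M s \<le> (C * C * (1 + \<bar>s\<bar>)) powr (1 / \<beta>)"
    "\<And>s. s \<ge> C \<Longrightarrow> ((s - C) / C) powr (1 / \<beta>) \<le> M s"
proof -
  have inj: "a \<le> b \<longleftrightarrow> g a \<le> g b" "a < b \<longleftrightarrow> g a < g b" if "a \<ge> 0" "b \<ge> 0" for a b
    using mono that by (auto simp: strict_mono_on_leD strict_mono_on_less strict_mono_on_less_eq)
  have ex: "\<exists>m\<ge>0. g m = max s (g 0)" for s
  proof -
    \<comment> \<open>Solves b^\<beta>/C - C = |s| + |g 0|, so the lower growth bound makes g(b)
      large enough for the intermediate value theorem.\<close>
    define b where "b = (C * (\<bar>s\<bar> + \<bar>g 0\<bar> + C)) powr (1 / \<beta>)"
    have "b powr \<beta> = C * (\<bar>s\<bar> + \<bar>g 0\<bar> + C)" using C \<beta> by (simp add: b_def powr_powr)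
    then have "b powr \<beta> / C - C = \<bar>s\<bar> + \<bar>g 0\<bar>" using C by simp
    moreover have "b \<ge> 0" by (simp add: b_def)
    ultimately have "max s (g 0) \<le> g b" using gr[of b] by linarith
    moreover have "continuous_on {0..b} g" using cont by (rule continuous_on_subset) auto
    ultimately show ?thesis using IVT'[of g 0 "max s (g 0)" b] \<open>b \<ge> 0\<close> by auto
  qed
  define M where "M s = (SOME m. m \<ge> 0 \<and> g m = max s (g 0))" for s
  have M: "M s \<ge> 0 \<and> g (M s) = max s (g 0)" for s
    unfolding M_def using someI_ex[of "\<lambda>m. m \<ge> 0 \<and> g m = max s (g 0)"] ex[of s] by blast
  have ge0: "g 0 \<le> g a" if "a \<ge> 0" for a using inj(1)[of 0 a] that by simp
  have lim: "(M \<longlongrightarrow> M s) (at s)" for s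
  proof (rule order_tendstoI)
    fix a assume a: "a < M s"
    show "\<forall>\<^sub>F x in at s. a < M x"
    proof (cases "a < 0")
      case True
      then show ?thesis using M by (intro always_eventually) (meson less_le_trans)
    next
      case False
      then have "g a < max s (g 0)" using inj(2)[of a "M s"] M[of s] a by simp
      then have "g a < s" using ge0[of a] False by (auto simp: max_def split: if_splits)
      then have "\<forall>\<^sub>F x in at s. g a < x" by (rule order_tendstoD(1)[OF tendsto_ident_at])
      then show ?thesis
      proof eventually_elim
        case (elim x)
        then have "g a < g (M x)" using M[of x] by simp
        then show ?case using inj(2)[of a "M x"] M[of x] False by simp
      qed
    qed
  next
    fix a assume a: "M s < a"
    then have a0: "a \<ge> 0" using M[of s] by linarith
    have "max s (g 0) < g a" using inj(2)[of "M s" a] M[of s] a a0 by simp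
    then have "\<forall>\<^sub>F x in at s. x < g a" "g 0 < g a"
      by (auto intro: order_tendstoD(2)[OF tendsto_ident_at])
    then show "\<forall>\<^sub>F x in at s. M x < a"
    proof (elim eventually_mono)
      fix x assume "x < g a"
      then have "g (M x) < g a" using M[of x] \<open>g 0 < g a\<close> by simp
      then show "M x < a" using inj(2)[of "M x" a] M[of x] a0 by simp
    qed
  qed
  show ?thesis
  proof
    show "M s \<ge> 0" "g (M s) = max s (g 0)" for s using M by auto
    show "continuous_on UNIV M" using lim by (simp add: continuous_on_def)
    show "mono M" using M inj(1) by (intro monoI) (simp add: max.coboundedI1)
    show "M s \<le> (C * C * (1 + \<bar>s\<bar>)) powr (1 / \<beta>)" for s
    proof (cases "M s = 0")
      case False
      then have pos: "M s > 0" using M[of s] by linarith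
      then have "g 0 < g (M s)" using inj(2)[of 0 "M s"] by simp
      then have "g (M s) = s" using M[of s] by (auto simp: max_def split: if_splits)
      then have "M s powr \<beta> / C \<le> s + C" using gr[of "M s"] pos by simp
      also have "\<dots> \<le> C * (1 + \<bar>s\<bar>)"
        using mult_right_mono[of 1 C "\<bar>s\<bar>"] C unfolding distrib_left by simp
      finally have "M s powr \<beta> \<le> C * C * (1 + \<bar>s\<bar>)" using C by (simp add: field_simps)
      then have "(M s powr \<beta>) powr (1 / \<beta>) \<le> (C * C * (1 + \<bar>s\<bar>)) powr (1 / \<beta>)"
        using \<beta> by (intro powr_mono2) auto
      then show ?thesis using \<beta> pos by (simp add: powr_powr)
    qed simp
    show "((s - C) / C) powr (1 / \<beta>) \<le> M s" if "s \<ge> C" for s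
    proof -
      have "s \<le> C * M s powr \<beta> + C" using gr[of "M s"] M[of s] by linarith
      then have "(s - C) / C \<le> M s powr \<beta>" using C by (simp add: field_simps)
      then have "((s - C) / C) powr (1 / \<beta>) \<le> (M s powr \<beta>) powr (1 / \<beta>)"
        using \<beta> that C by (intro powr_mono2) auto
      then show ?thesis using \<beta> M[of s] by (simp add: powr_powr)
    qed
  qed
qed

text \<open>M is nondecreasing, so it supplies supporting slopes of E; M >= 0 makes E nondecreasing.
  Both together keep a composition of E with a convex function convex.\<close>

lemma monotone_antiderivative:
  fixes M :: "real \<Rightarrow> real"
  assumes cont: "continuous_on UNIV M" and mono: "mono M" and M0: "\<And>s. M s \<ge> 0" and Ma: "M a = 0"
  obtains E where "\<And>s. E s \<ge> 0" "E a = 0" "\<And>s s'. E s' \<ge> E s + M s * (s' - s)" "mono E"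
proof -
  define E where "E s = integral {a..s} M" for s
  have int: "M integrable_on {b..c}" for b c
    using cont by (intro integrable_continuous_real) (auto intro: continuous_on_subset)
  have E0: "E s \<ge> 0" for s unfolding E_def using M0 by (intro Henstock_Kurzweil_Integration.integral_nonneg int) auto
  have ge: "integral {b..c} M \<ge> M b * (c - b)" if "b \<le> c" for b c
  proof -
    have "((\<lambda>_. M b) has_integral M b * (c - b)) {b..c}"
      using has_integral_const_real[of "M b" b c] that by (simp add: mult.commute)
    from has_integral_le[OF this integrable_integral[OF int]] show ?thesis
      using monoD[OF mono] by auto
  qed
  have le: "integral {b..c} M \<le> M c * (c - b)" if "b \<le> c" for b c
  proof -
    have "((\<lambda>_. M c) has_integral M c * (c - b)) {b..c}"
      using has_integral_const_real[of "M c" b c] that by (simp add: mult.commute)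
    from has_integral_le[OF integrable_integral[OF int] this] show ?thesis
      using monoD[OF mono] by auto
  qed
  have comb: "E c = E b + integral {b..c} M" if "a \<le> b" "b \<le> c" for b c
    unfolding E_def using that Henstock_Kurzweil_Integration.integral_combine[OF _ _ int] by metis
  \<comment> \<open>Left of a the interval is empty and the integral is 0 by default, which is the
    right value of an antiderivative because M vanishes there.\<close>
  have Eneg: "E s = 0" if "s \<le> a" for s
    using that by (cases "s = a") (auto simp: E_def)
  have Mneg: "M s = 0" if "s \<le> a" for s using monoD[OF mono that] Ma M0[of s] by simp
  have tan: "E s' \<ge> E s + M s * (s' - s)" for s s'
  proof (cases "s \<le> a")
    case True
    then show ?thesis using Eneg Mneg E0 by simp
  next
    case s: False
    show ?thesis
    proof (cases "s \<le> s'")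
      case True
      then show ?thesis using comb[of s s'] ge[of s s'] s by simp
    next
      case False
      show ?thesis
      proof (cases "a \<le> s'")
        case True
        then have "E s = E s' + integral {s'..s} M" using comb[of s' s] False by simp
        moreover have "integral {s'..s} M \<le> M s * (s - s')" using le False by simp
        ultimately show ?thesis by (simp add: algebra_simps)
      next
        case s': False
        have "E s \<le> M s * (s - a)" using le[of a s] s by (simp add: E_def)
        also have "\<dots> \<le> M s * (s - s')" using s' M0 by (intro mult_left_mono) auto
        finally show ?thesis using E0[of s'] by (simp add: algebra_simps)
      qed
    qed
  qed
  have "mono E"
  proof (rule monoI)
    fix s s' :: real assume "s \<le> s'"
    then show "E s \<le> E s'" using tan[of s s'] M0[of s] by (smt (verit) mult_nonneg_nonneg)
  qed
  with E0 Eneg tan show ?thesis by (intro that) auto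
qed

lemma convex_on_gradient_inequality:
  fixes h :: "'a::euclidean_space \<Rightarrow> real"
  assumes cvx: "convex_on UNIV h" and d: "(h has_derivative (\<lambda>q. D \<bullet> q)) (at p)"
  shows "h q \<ge> h p + D \<bullet> (q - p)"
proof -
  define v where "v = q - p"
  define t where "t n = 1 / real (Suc n)" for n
  have t: "0 < t n" "t n \<le> 1" for n by (auto simp: t_def)
  from directional_derivative_LIMSEQ[OF d]
  have lim: "(\<lambda>n. (h (t n *\<^sub>R v + p) - h p) / t n) \<longlonglongrightarrow> D \<bullet> v" unfolding t_def .
  have "(h (t n *\<^sub>R v + p) - h p) / t n \<le> h q - h p" for n
  proof -
    have "h ((1 - t n) *\<^sub>R p + t n *\<^sub>R q) \<le> (1 - t n) * h p + t n * h q"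
      using t[of n] by (intro convex_onD[OF cvx]) auto
    moreover have "(1 - t n) *\<^sub>R p + t n *\<^sub>R q = t n *\<^sub>R v + p" by (simp add: v_def algebra_simps)
    ultimately have "h (t n *\<^sub>R v + p) - h p \<le> (h q - h p) * t n" by (simp add: algebra_simps)
    then show ?thesis using t[of n] by (simp add: divide_le_eq)
  qed
  then have "D \<bullet> v \<le> h q - h p" by (intro LIMSEQ_le_const2[OF lim]) auto
  then show ?thesis by (simp add: v_def)
qed

text \<open>In the two alternatives about the gradient, the hypothesis at p/2 is combined with the
  tangent at p/2 evaluated at p, that is h(p) >= h(p/2) + D(p/2) . p/2; hence the factor 2^\<alpha>.
  In the last alternative h(p/2) has to be added twice, each time bounded below by -C, hence 3
  C.\<close>

lemma Hamiltonian_coercive: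
  fixes h :: "'a::euclidean_space \<Rightarrow> real"
  assumes cvx: "convex_on UNIV h" and d: "\<And>p. (h has_derivative (\<lambda>q. D p \<bullet> q)) (at p)"
    and C: "C > 1" and \<alpha>: "\<alpha> > 1"
    and cases: "(\<forall>p. h p \<ge> norm p powr \<alpha> / C - C)
      \<or> (\<forall>p. D p \<bullet> p \<ge> norm p powr \<alpha> / C - C \<and> h p \<ge> - C)
      \<or> (\<forall>p. - h p + D p \<bullet> p \<ge> norm p powr \<alpha> / C - C \<and> h p \<ge> - C)"
  shows "h p \<ge> norm p powr \<alpha> / (C * 2 powr \<alpha>) - 3 * C"
proof -
  have le: "norm p powr \<alpha> / (C * 2 powr \<alpha>) \<le> norm p powr \<alpha> / C"
  proof (rule divide_left_mono)
    show "C \<le> C * 2 powr \<alpha>" using C \<alpha> ge_one_powr_ge_zero[of 2 \<alpha>] by simp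
  qed (use C in auto)
  have half: "norm ((1/2) *\<^sub>R p) powr \<alpha> / C = norm p powr \<alpha> / (C * 2 powr \<alpha>)"
    by (simp add: powr_divide)
  have tan: "h p \<ge> h ((1/2) *\<^sub>R p) + D ((1/2) *\<^sub>R p) \<bullet> ((1/2) *\<^sub>R p)"
  proof -
    have "p - (1/2) *\<^sub>R p = (1/2) *\<^sub>R p" by (simp add: scaleR_left_diff_distrib[of 1 "1/2" p, simplified, symmetric])
    with convex_on_gradient_inequality[OF cvx d, of "(1/2) *\<^sub>R p" p] show ?thesis by metis
  qed
  from cases show ?thesis
  proof (elim disjE)
    assume "\<forall>p. h p \<ge> norm p powr \<alpha> / C - C"
    then have "h p \<ge> norm p powr \<alpha> / C - C" by blast
    with le C show ?thesis by linarith
  next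
    assume a: "\<forall>p. D p \<bullet> p \<ge> norm p powr \<alpha> / C - C \<and> h p \<ge> - C"
    from a[rule_format, of "(1/2) *\<^sub>R p"] tan half C show ?thesis by linarith
  next
    assume a: "\<forall>p. - h p + D p \<bullet> p \<ge> norm p powr \<alpha> / C - C \<and> h p \<ge> - C"
    from a[rule_format, of "(1/2) *\<^sub>R p"] tan half C show ?thesis by linarith
  qed
qed

text \<open>The constants precede the quantifier over h and D, so that they serve H(x, .) for almost
  every x simultaneously. With \<gamma> = \<alpha>/\<beta> + \<alpha>, the exponents for M(h), for
  its product with the gradient and for E(h) are \<alpha>/\<beta>, \<gamma> - 1 and
  \<gamma>.\<close>

lemma composed_integrand_bounds:
  fixes g M E :: "real \<Rightarrow> real" and \<alpha> \<beta> C :: real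
  assumes \<beta>: "\<beta> > 0" and \<alpha>: "\<alpha> > 1" and C: "C > 1"
    and M0: "\<And>s. M s \<ge> 0"
    and Mup: "\<And>s. M s \<le> (B * (1 + \<bar>s\<bar>)) powr (1 / \<beta>)" and B: "B \<ge> 0"
    and Mlo: "\<And>s. s \<ge> B' \<Longrightarrow> ((s - B') / B') powr (1 / \<beta>) \<le> M s" and B': "B' > 0"
    and E0: "\<And>s. E s \<ge> 0" and Ea: "E a = 0" and Et: "\<And>s s'. E s' \<ge> E s + M s * (s' - s)"
  shows "\<exists>K>0. \<exists>c>0. \<forall>h D :: 'a::euclidean_space \<Rightarrow> _.
     convex_on UNIV h \<and> (\<forall>p. (h has_derivative (\<lambda>q. D p \<bullet> q)) (at p))
     \<and> (\<forall>p. norm (D p) \<le> C * norm p powr (\<alpha> - 1) + C \<and> h 0 \<le> C)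
     \<and> ((\<forall>p. h p \<ge> norm p powr \<alpha> / C - C)
      \<or> (\<forall>p. D p \<bullet> p \<ge> norm p powr \<alpha> / C - C \<and> h p \<ge> - C)
      \<or> (\<forall>p. - h p + D p \<bullet> p \<ge> norm p powr \<alpha> / C - C \<and> h p \<ge> - C)) \<longrightarrow>
     (\<forall>p. M (h p) \<le> K * (1 + norm p) powr (\<alpha> / \<beta>)
        \<and> norm (M (h p) *\<^sub>R D p) \<le> K * (1 + norm p) powr (\<alpha> / \<beta> + \<alpha> - 1)
        \<and> E (h p) \<le> K * (1 + norm p) powr (\<alpha> / \<beta> + \<alpha>)
        \<and> c * norm p powr (\<alpha> / \<beta> + \<alpha>) - K \<le> E (h p)
        \<and> (\<forall>q. E (h q) \<ge> E (h p) + (M (h p) *\<^sub>R D p) \<bullet> (q - p)))"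
proof -
  \<comment> \<open>K1 comes from the upper bound for M at |h| <= 3 C (1 + |p|)^\<alpha>, K2 from
    the upper bound for h - a, and c1 from \<open>Hamiltonian_coercive\<close>.\<close>
  define K1 where "K1 = (B * (1 + 3 * C)) powr (1 / \<beta>) + 1"
  define K2 where "K2 = 3 * C + \<bar>a\<bar>"
  define c1 where "c1 = 1 / (C * 2 powr \<alpha>)"
  \<comment> \<open>From |p|^\<alpha> = R on, h(p) is at least c1 |p|^\<alpha>/2 >= 4 B', so the
    lower bound for M applies at h(p)/2. Below R the last summand of K absorbs c
    |p|^\<gamma>.\<close>
  define R where "R = (8 * B' + 6 * C) / c1"
  define c where "c = (c1 / (8 * B')) powr (1 / \<beta>) * (c1 / 4)"
  define K where "K = K1 + K1 * (2 * C) + K1 * K2 + c * R powr (1 / \<beta> + 1)"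
  have K1: "K1 > 0" by (simp add: K1_def add_nonneg_pos)
  have K2: "K2 > 0" using C by (simp add: K2_def)
  have c1: "c1 > 0" using C by (simp add: c1_def)
  have R: "R > 0" using c1 B' C by (simp add: R_def)
  have c: "c > 0" using c1 B' by (simp add: c_def)
  have K: "K > 0" "K1 \<le> K" "K1 * (2 * C) \<le> K" "K1 * K2 \<le> K" "c * R powr (1 / \<beta> + 1) \<le> K"
  proof -
    have "0 < K1 * (2 * C)" "0 < K1 * K2" "0 < c * R powr (1 / \<beta> + 1)" using K1 K2 C c R by auto
    with K1 show "K > 0" "K1 \<le> K" "K1 * (2 * C) \<le> K" "K1 * K2 \<le> K" "c * R powr (1 / \<beta> + 1) \<le> K"
      unfolding K_def by linarith+
  qed
  show ?thesis
  proof (rule exI[of _ K], rule conjI[OF K(1)], rule exI[of _ c], rule conjI[OF c], intro allI impI, elim conjE)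
    fix h :: "'a \<Rightarrow> real" and D :: "'a \<Rightarrow> 'a" and p :: 'a
    assume cvx: "convex_on UNIV h" and d: "\<forall>p. (h has_derivative (\<lambda>q. D p \<bullet> q)) (at p)"
      and bd: "\<forall>p. norm (D p) \<le> C * norm p powr (\<alpha> - 1) + C \<and> h 0 \<le> C"
      and cs: "(\<forall>p. h p \<ge> norm p powr \<alpha> / C - C)
      \<or> (\<forall>p. D p \<bullet> p \<ge> norm p powr \<alpha> / C - C \<and> h p \<ge> - C)
      \<or> (\<forall>p. - h p + D p \<bullet> p \<ge> norm p powr \<alpha> / C - C \<and> h p \<ge> - C)"
    have tan: "h q \<ge> h p + D p \<bullet> (q - p)" for p q
      using convex_on_gradient_inequality[OF cvx] d by blast
    have low: "h p \<ge> c1 * norm p powr \<alpha> - 3 * C"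
      using Hamiltonian_coercive[OF cvx _ C \<alpha> cs] d by (simp add: c1_def)
    define P where "P = 1 + norm p"
    have P: "P \<ge> 1" "norm p \<le> P" by (auto simp: P_def)
    have P1: "P powr r \<ge> 1" if "r \<ge> 0" for r using P that ge_one_powr_ge_zero by auto
    have Dp: "norm (D p) \<le> 2 * C * P powr (\<alpha> - 1)"
    proof -
      have "norm p powr (\<alpha> - 1) \<le> P powr (\<alpha> - 1)" using P \<alpha> by (intro powr_mono2) auto
      then have "C * norm p powr (\<alpha> - 1) + C * 1 \<le> C * P powr (\<alpha> - 1) + C * P powr (\<alpha> - 1)"
        using C P1[of "\<alpha> - 1"] \<alpha> by (intro add_mono mult_left_mono) auto
      then show ?thesis using bd[rule_format, of p] by simp
    qed
    have PP: "P powr (\<alpha> - 1) * P = P powr \<alpha>" using P powr_mult_base[of P "\<alpha> - 1"] by (simp add: mult.commute)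
    have up: "h p \<le> 3 * C * P powr \<alpha>"
    proof -
      have "h p \<le> h 0 + D p \<bullet> p" using tan[of p 0] by simp
      also have "\<dots> \<le> C + norm (D p) * norm p" using bd norm_cauchy_schwarz[of "D p" p] by (intro add_mono) auto
      also have "\<dots> \<le> C * P powr \<alpha> + (2 * C * P powr (\<alpha> - 1)) * P"
        using Dp P C P1[of \<alpha>] \<alpha> by (intro add_mono mult_mono) auto
      also have "\<dots> = 3 * C * P powr \<alpha>" using PP by (simp add: mult.assoc)
      finally show ?thesis .
    qed
    have habs: "\<bar>h p\<bar> \<le> 3 * C * P powr \<alpha>"
    proof -
      have "3 * C * 1 \<le> 3 * C * P powr \<alpha>" using C P1[of \<alpha>] \<alpha> by (intro mult_left_mono) auto
      moreover have "c1 * norm p powr \<alpha> \<ge> 0" using c1 by simp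
      ultimately show ?thesis using up low unfolding abs_le_iff by (intro conjI) linarith+
    qed
    have Pab: "(P powr \<alpha>) powr (1 / \<beta>) = P powr (\<alpha> / \<beta>)" by (simp add: powr_powr)
    have Mb: "M (h p) \<le> K1 * P powr (\<alpha> / \<beta>)"
    proof -
      have "M (h p) \<le> (B * (1 + \<bar>h p\<bar>)) powr (1 / \<beta>)" by (rule Mup)
      also have "\<dots> \<le> (B * ((1 + 3 * C) * P powr \<alpha>)) powr (1 / \<beta>)"
        using habs P1[of \<alpha>] \<alpha> B \<beta> by (intro powr_mono2 mult_left_mono) (auto simp: distrib_right)
      also have "\<dots> = (B * (1 + 3 * C)) powr (1 / \<beta>) * P powr (\<alpha> / \<beta>)"
        using B C P by (simp add: powr_mult Pab[symmetric] mult.assoc[symmetric])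
      also have "\<dots> \<le> K1 * P powr (\<alpha> / \<beta>)" by (intro mult_right_mono) (auto simp: K1_def)
      finally show ?thesis .
    qed
    have 1: "M (h p) \<le> K * (1 + norm p) powr (\<alpha> / \<beta>)"
      using Mb K mult_right_mono[OF K(2), of "P powr (\<alpha> / \<beta>)"] unfolding P_def[symmetric] by simp
    have 2: "norm (M (h p) *\<^sub>R D p) \<le> K * (1 + norm p) powr (\<alpha> / \<beta> + \<alpha> - 1)"
    proof -
      have "norm (M (h p) *\<^sub>R D p) = M (h p) * norm (D p)" using M0 by simp
      also have "\<dots> \<le> (K1 * P powr (\<alpha> / \<beta>)) * (2 * C * P powr (\<alpha> - 1))"
        using Mb Dp M0 K1 by (intro mult_mono) auto
      also have "\<dots> = K1 * (2 * C) * P powr (\<alpha> / \<beta> + (\<alpha> - 1))" unfolding powr_add by (simp only: mult_ac)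
      also have "\<dots> \<le> K * P powr (\<alpha> / \<beta> + (\<alpha> - 1))" using K by (intro mult_right_mono) auto
      finally show ?thesis unfolding P_def[symmetric] by (simp add: add_diff_eq)
    qed
    have 3: "E (h p) \<le> K * (1 + norm p) powr (\<alpha> / \<beta> + \<alpha>)"
    proof -
      \<comment> \<open>The tangent at h(p), evaluated at a, where E vanishes.\<close>
      have "E (h p) \<le> M (h p) * (h p - a)" using Et[where s = "h p" and s' = a] Ea by (simp add: algebra_simps)
      also have "\<dots> \<le> M (h p) * (K2 * P powr \<alpha>)"
      proof (rule mult_left_mono[OF _ M0])
        have "h p - a \<le> 3 * C * P powr \<alpha> + \<bar>a\<bar> * 1" using up by simp
        also have "\<dots> \<le> 3 * C * P powr \<alpha> + \<bar>a\<bar> * P powr \<alpha>"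
          using P1[of \<alpha>] \<alpha> by (intro add_left_mono mult_left_mono) auto
        finally show "h p - a \<le> K2 * P powr \<alpha>" by (simp add: K2_def distrib_right)
      qed
      also have "\<dots> \<le> (K1 * P powr (\<alpha> / \<beta>)) * (K2 * P powr \<alpha>)"
        using Mb K2 by (intro mult_right_mono) auto
      also have "\<dots> = K1 * K2 * P powr (\<alpha> / \<beta> + \<alpha>)" unfolding powr_add by (simp only: mult_ac)
      also have "\<dots> \<le> K * P powr (\<alpha> / \<beta> + \<alpha>)" using K by (intro mult_right_mono) auto
      finally show ?thesis unfolding P_def[symmetric] .
    qed
    have 4: "c * norm p powr (\<alpha> / \<beta> + \<alpha>) - K \<le> E (h p)"
    proof (cases "norm p powr \<alpha> \<ge> R")
      case False
      have "norm p powr (\<alpha> / \<beta> + \<alpha>) = (norm p powr \<alpha>) powr (1 / \<beta> + 1)"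
        by (simp add: powr_powr distrib_left)
      also have "\<dots> \<le> R powr (1 / \<beta> + 1)" using False \<beta> by (intro powr_mono2) auto
      finally have "c * norm p powr (\<alpha> / \<beta> + \<alpha>) \<le> c * R powr (1 / \<beta> + 1)" using c by (intro mult_left_mono) auto
      then show ?thesis using K(5) E0[of "h p"] by linarith
    next
      case True
      \<comment> \<open>The lower bound for E is its tangent at half the value: E(h) >= M(h/2) h/2,
        where h/2 is still comparable to |p|^\<alpha>.\<close>
      define \<sigma> where "\<sigma> = c1 * norm p powr \<alpha> / 2"
      have "c1 * R \<le> c1 * norm p powr \<alpha>" using True c1 by (intro mult_left_mono) auto
      then have "8 * B' + 6 * C \<le> c1 * norm p powr \<alpha>" using c1 by (simp add: R_def)
      then have \<sigma>: "\<sigma> \<ge> 4 * B'" "h p \<ge> \<sigma>" using low C B' by (simp_all add: \<sigma>_def)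
      have s2: "h p / 2 - B' \<ge> \<sigma> / 4" "h p / 2 \<ge> B'" using \<sigma> B' by linarith+
      have "(c1 / (8 * B')) powr (1 / \<beta>) * (norm p powr (\<alpha> / \<beta>)) = (\<sigma> / 4 / B') powr (1 / \<beta>)"
      proof -
        have "\<sigma> / 4 / B' = (c1 / (8 * B')) * norm p powr \<alpha>" by (simp add: \<sigma>_def)
        then show ?thesis by (simp only: powr_mult powr_powr) simp
      qed
      also have "\<dots> \<le> ((h p / 2 - B') / B') powr (1 / \<beta>)"
        using s2 \<sigma> B' \<beta> by (intro powr_mono2 divide_right_mono) auto
      also have "\<dots> \<le> M (h p / 2)" using Mlo[OF s2(2)] .
      finally have Mh: "(c1 / (8 * B')) powr (1 / \<beta>) * (norm p powr (\<alpha> / \<beta>)) \<le> M (h p / 2)" .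
      have "c * norm p powr (\<alpha> / \<beta> + \<alpha>) = ((c1 / (8 * B')) powr (1 / \<beta>) * (norm p powr (\<alpha> / \<beta>))) * (\<sigma> / 2)"
        unfolding c_def powr_add \<sigma>_def by simp
      also have "\<dots> \<le> M (h p / 2) * (h p / 2)"
        using Mh \<sigma> B' M0 by (intro mult_mono) auto
      also have "\<dots> \<le> E (h p)" using Et[where s = "h p / 2" and s' = "h p"] E0[of "h p / 2"] by simp
      finally show ?thesis using K by linarith
    qed
    have 5: "E (h q) \<ge> E (h p) + (M (h p) *\<^sub>R D p) \<bullet> (q - p)" for q
    proof -
      have "M (h p) * (D p \<bullet> (q - p)) \<le> M (h p) * (h q - h p)"
        using tan[of p q] M0 by (intro mult_left_mono) auto
      then show ?thesis using Et[where s = "h p" and s' = "h q"] by simp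
    qed
    show "M (h p) \<le> K * (1 + norm p) powr (\<alpha> / \<beta>)
        \<and> norm (M (h p) *\<^sub>R D p) \<le> K * (1 + norm p) powr (\<alpha> / \<beta> + \<alpha> - 1)
        \<and> E (h p) \<le> K * (1 + norm p) powr (\<alpha> / \<beta> + \<alpha>)
        \<and> c * norm p powr (\<alpha> / \<beta> + \<alpha>) - K \<le> E (h p)
        \<and> (\<forall>q. E (h q) \<ge> E (h p) + (M (h p) *\<^sub>R D p) \<bullet> (q - p))"
      using 1 2 3 4 5 by blast
  qed
qed

section \<open>Almost minimisers\<close>

text \<open>Replaces weak compactness in the direct method.\<close>
lemma uniformly_convex_Cauchy_selection:
  fixes N :: "'b \<Rightarrow> real" and d :: "'b \<Rightarrow> 'b \<Rightarrow> real" and mid :: "'b \<Rightarrow> 'b \<Rightarrow> 'b" and C :: "nat \<Rightarrow> 'b set"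
  assumes ne: "\<And>n. C n \<noteq> {}" and dec: "\<And>n. C (Suc n) \<subseteq> C n"
    and mid: "\<And>n a b. a \<in> C n \<Longrightarrow> b \<in> C n \<Longrightarrow> mid a b \<in> C n"
    and N: "\<And>a. a \<in> C 0 \<Longrightarrow> 0 \<le> N a \<and> N a \<le> B"
    and uc: "\<And>\<eta>. \<eta> > 0 \<Longrightarrow> \<exists>c\<ge>0. \<forall>a\<in>C 0. \<forall>b\<in>C 0. d a b \<le> \<eta> * (N a + N b) + c * ((N a + N b) / 2 - N (mid a b))"
  obtains w where "\<And>n. w n \<in> C n" "\<And>e. e > 0 \<Longrightarrow> \<exists>n0. \<forall>m\<ge>n0. \<forall>n\<ge>n0. d (w m) (w n) < e"
proof -
  have sub: "C n \<subseteq> C m" if "m \<le> n" for m n using lift_Suc_antimono_le[of C, OF dec that] .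
  have sub0: "C n \<subseteq> C 0" for n by (rule sub) simp
  \<comment> \<open>The infima of N over the shrinking sets increase and stay below B, hence
    converge; \<open>w n\<close> nearly attains the n-th one.\<close>
  define i where "i n = Inf (N ` C n)" for n
  have bdd: "bdd_below (N ` C n)" for n using N sub0[of n] by (intro bdd_belowI[of _ 0]) auto
  have i_le: "i n \<le> N a" if "a \<in> C n" for n a unfolding i_def using that bdd by (intro cInf_lower) auto
  have i_mono: "i m \<le> i n" if "m \<le> n" for m n
    unfolding i_def using sub[OF that] ne bdd by (intro cInf_superset_mono) auto
  have iB: "i n \<le> B" for n
  proof -
    obtain a where "a \<in> C n" using ne by blast
    then show ?thesis using i_le[of a n] N[of a] sub0[of n] by force
  qed
  have "\<exists>a\<in>C n. N a < i n + 1 / real (Suc n)" for n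
  proof -
    have "Inf (N ` C n) < i n + 1 / real (Suc n)" by (simp add: i_def)
    then show ?thesis using cInf_lessD[of "N ` C n"] ne by auto
  qed
  then obtain w where w: "\<And>n. w n \<in> C n" "\<And>n. N (w n) < i n + 1 / real (Suc n)" by metis
  have "incseq i" using i_mono by (simp add: incseq_def)
  then obtain L where L: "i \<longlonglongrightarrow> L" "\<And>n. i n \<le> L" using incseq_convergent[of i B] iB by blast
  show ?thesis
  proof
    show "w n \<in> C n" for n by (rule w)
    fix e :: real assume e: "e > 0"
    have B0: "B \<ge> 0" using N ne[of 0] by (meson all_not_in_conv order_trans)
    \<comment> \<open>\<eta> and e' split e into halves: one for the values of N, at most 2 B in
      sum, one for the convexity gap. The added 1 covers B = 0 and c = 0.\<close>
    define \<eta> where "\<eta> = e / (2 * (2 * B + 1))"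
    have \<eta>: "\<eta> > 0" "\<eta> * (2 * B) < e / 2" using e B0 by (auto simp: \<eta>_def field_simps)
    obtain c where c: "c \<ge> 0" "\<And>a b. a \<in> C 0 \<Longrightarrow> b \<in> C 0 \<Longrightarrow> d a b \<le> \<eta> * (N a + N b) + c * ((N a + N b) / 2 - N (mid a b))"
      using uc[OF \<eta>(1)] by blast
    define e' where "e' = e / (2 * (c + 1))"
    have e': "e' > 0" "c * e' < e / 2" using e c(1) by (auto simp: e'_def field_simps)
    have "\<forall>\<^sub>F n in sequentially. L - e' / 2 < i n" using L(1) e' by (intro order_tendstoD) auto
    moreover have "\<forall>\<^sub>F n in sequentially. 1 / real (Suc n) < e' / 2"
      using LIMSEQ_inverse_real_of_nat e' by (intro order_tendstoD) (auto simp: inverse_eq_divide)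
    ultimately obtain n0 where n0: "\<And>n. n \<ge> n0 \<Longrightarrow> L - e' / 2 < i n" "\<And>n. n \<ge> n0 \<Longrightarrow> 1 / real (Suc n) < e' / 2"
      unfolding eventually_sequentially by (metis linorder_linear order_trans)
    have "d (w m) (w n) < e" if mn: "m \<ge> n0" "n \<ge> n0" for m n
    proof -
      \<comment> \<open>Both elements and their midpoint lie in C n0. The midpoint has N at least i
        n0 > L - e'/2, the elements have N below L + e'/2, so the gap is at most e'.\<close>
      have in0: "w m \<in> C n0" "w n \<in> C n0" using w sub mn by blast+
      have mi: "i n0 \<le> N (mid (w m) (w n))" by (intro i_le mid in0)
      have "N (w m) < L + e' / 2" "N (w n) < L + e' / 2"
        using w(2)[of m] w(2)[of n] L(2)[of m] L(2)[of n] n0(2)[OF mn(1)] n0(2)[OF mn(2)] by linarith+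
      then have gap: "(N (w m) + N (w n)) / 2 - N (mid (w m) (w n)) \<le> e'" using mi n0(1)[OF order_refl] unfolding add_divide_distrib by linarith
      have "d (w m) (w n) \<le> \<eta> * (N (w m) + N (w n)) + c * ((N (w m) + N (w n)) / 2 - N (mid (w m) (w n)))"
        using in0 sub0 by (intro c(2)) auto
      also have "\<dots> \<le> \<eta> * (2 * B) + c * e'"
      proof (intro add_mono mult_left_mono)
        show "N (w m) + N (w n) \<le> 2 * B" using N[of "w m"] N[of "w n"] in0 sub0 by fastforce
      qed (use \<eta> c gap in auto)
      finally show ?thesis using \<eta>(2) e'(2) by linarith
    qed
    then show "\<exists>n0. \<forall>m\<ge>n0. \<forall>n\<ge>n0. d (w m) (w n) < e" by blast
  qed
qed

text \<open>For t <= 0 the slope is zero; for t > 0 this is the tangent of the power, and s is at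
  most its positive part.\<close>

lemma pos_part_powr_tangent:
  fixes p s t :: real
  assumes p: "p > 1"
  shows "(max 0 s) powr p / p \<ge> (max 0 t) powr p / p + (max 0 t) powr (p - 1) * (s - t)"
proof -
  define a h where "a = max 0 t" and "h = max 0 s"
  have "a powr p + p * a powr (p - 1) * (h - a) \<le> h powr p" by (rule powr_tangent) (use p in \<open>auto simp: a_def h_def\<close>)
  moreover have "a powr (p - 1) * (s - t) \<le> a powr (p - 1) * (h - a)"
  proof (cases "t > 0")
    case True
    then show ?thesis by (intro mult_left_mono) (auto simp: a_def h_def)
  qed (simp add: a_def)
  then have "p * (a powr (p - 1) * (s - t)) \<le> p * (a powr (p - 1) * (h - a))"
    by (rule mult_left_mono) (use p in simp)
  ultimately have "a powr p + p * (a powr (p - 1) * (s - t)) \<le> h powr p" unfolding mult.assoc by linarith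
  then have "(a powr p + p * (a powr (p - 1) * (s - t))) / p \<le> h powr p / p" using p by (intro divide_right_mono) auto
  then show ?thesis using p by (simp add: add_divide_distrib a_def h_def)
qed

section \<open>Surface measure on parts of the boundary\<close>

lemma surf_subset:
  fixes S T :: "'a::euclidean_space set"
  assumes "S \<in> sets borel" "T \<in> sets borel" "S \<subseteq> T"
  shows "surf S = restrict_space (surf T) S"
  using assms unfolding surf_def by (subst restrict_restrict_space) (auto simp: Int_absorb1)

lemma measurable_surf_subset:
  fixes S T :: "'a::euclidean_space set"
  assumes "S \<in> sets borel" "T \<in> sets borel" "S \<subseteq> T" "f \<in> borel_measurable (surf T)"
  shows "f \<in> borel_measurable (surf S)"
  unfolding surf_subset[OF assms(1-3)] by (rule measurable_restrict_space1[OF assms(4)])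

lemma nn_integral_surf_subset_le:
  fixes S T :: "'a::euclidean_space set"
  assumes "S \<in> sets borel" "T \<in> sets borel" "S \<subseteq> T" 
  shows "(\<integral>\<^sup>+x. f x \<partial>surf S) \<le> (\<integral>\<^sup>+x. f x \<partial>surf T)"
proof -
  have "S \<inter> space (surf T) \<in> sets (surf T)" using assms by (auto simp: surf_def sets_restrict_space space_restrict_space)
  then have "(\<integral>\<^sup>+x. f x \<partial>surf S) = (\<integral>\<^sup>+x. f x * indicator S x \<partial>surf T)"
    unfolding surf_subset[OF assms(1-3)] by (rule nn_integral_restrict_space)
  also have "\<dots> \<le> (\<integral>\<^sup>+x. f x \<partial>surf T)" by (intro nn_integral_mono) (auto split: split_indicator)
  finally show ?thesis .
qed

lemma Lp_mem_surf_subset: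
  fixes S T :: "'a::euclidean_space set" and f :: "'a \<Rightarrow> real"
  assumes "S \<in> sets borel" "T \<in> sets borel" "S \<subseteq> T" "Lp_mem (surf T) p f"
  shows "Lp_mem (surf S) p f"
  using assms(4) measurable_surf_subset[OF assms(1-3)] nn_integral_surf_subset_le[OF assms(1-3), of "\<lambda>x. ennreal (norm (f x) powr p)"]
  unfolding Lp_mem_iff_nn by (auto intro: le_less_trans)

lemma AE_surf_subset:
  fixes S T :: "'a::euclidean_space set"
  assumes "S \<in> sets borel" "T \<in> sets borel" "S \<subseteq> T" "AE x in surf T. P x"
  shows "AE x in surf S. P x"
proof -
  have "S \<inter> space (surf T) \<in> sets (surf T)" using assms by (auto simp: surf_def sets_restrict_space space_restrict_space)
  then show ?thesis unfolding surf_subset[OF assms(1-3)] using assms(4) by (auto simp: AE_restrict_space_iff elim: eventually_mono)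
qed

lemma tendsto_surf_subset:
  fixes S T :: "'a::euclidean_space set"
  assumes "S \<in> sets borel" "T \<in> sets borel" "S \<subseteq> T" "(\<lambda>n. \<integral>\<^sup>+x. f n x \<partial>surf T) \<longlonglongrightarrow> 0"
  shows "(\<lambda>n. \<integral>\<^sup>+x. f n x \<partial>surf S) \<longlonglongrightarrow> 0"
  by (rule tendsto_sandwich[OF _ _ tendsto_const assms(4)])
     (auto intro!: always_eventually nn_integral_surf_subset_le[OF assms(1-3)])

lemma borel_measurable_surf: "f \<in> borel_measurable borel \<Longrightarrow> f \<in> borel_measurable (surf S)"
  unfolding surf_def by (intro measurable_restrict_space1) (simp cong: measurable_cong_sets)

lemma finite_measure_surf:
  fixes S :: "'a::euclidean_space set"
  assumes "S \<in> sets borel" "emeasure (hausdorff_measure (DIM('a) - 1)) S < top"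
  shows "finite_measure (surf S)"
  using assms by (intro finite_measureI) (simp add: surf_def space_restrict_space emeasure_restrict_space less_top)

lemma finite_measure_lebesgue_on:
  fixes \<Omega> :: "'a::euclidean_space set"
  assumes "\<Omega> \<in> sets borel" "bounded \<Omega>"
  shows "finite_measure (lebesgue_on \<Omega>)"
  using assms emeasure_bounded_finite[OF assms(2)]
  by (intro finite_measureI) (simp add: space_restrict_space emeasure_restrict_space less_top)

lemma borel_measurable_lebesgue_on_borel: "f \<in> borel_measurable borel \<Longrightarrow> f \<in> borel_measurable (lebesgue_on \<Omega>)"
  by (intro measurable_restrict_space1 measurable_completion) simp

section \<open>The convex boundary value problem\<close>

text \<open>The reduced problem after elimination of m and h: F is the composition of E with H, DF a
  continuous field of subgradients, cB the weight of the boundary penalty. Growth, coercivity and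
  the tangent inequality are what the variational argument retains of H and g.\<close>

locale convex_boundary_problem =
  fixes \<Omega> \<Gamma>D \<Gamma>N :: "'a::euclidean_space set" and p q c K cB :: real
    and j :: "'a \<Rightarrow> real" and F :: "'a \<Rightarrow> 'a \<Rightarrow> real" and DF :: "'a \<Rightarrow> 'a \<Rightarrow> 'a"
  assumes \<Omega>: "open \<Omega>" "bounded \<Omega>" "connected \<Omega>" "\<Omega> \<noteq> {}" "C1_boundary \<Omega>"
    and p: "p > 1" and q: "q = p / (p - 1)"
    and \<Gamma>D: "\<Gamma>D \<in> sets borel" "\<Gamma>D \<subseteq> frontier \<Omega>" "emeasure (hausdorff_measure (DIM('a) - 1)) \<Gamma>D > 0"
    and \<Gamma>N: "\<Gamma>N \<in> sets borel" "\<Gamma>N \<subseteq> frontier \<Omega>"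
    and j: "Lp_mem (surf \<Gamma>N) q j" "AE x in surf \<Gamma>N. j x \<ge> 0" "\<not> (AE x in surf \<Gamma>N. j x = 0)"
    and Fmeas: "\<And>u. u \<in> borel_measurable (lebesgue_on \<Omega>) \<Longrightarrow> (\<lambda>x. F x (u x)) \<in> borel_measurable (lebesgue_on \<Omega>)"
    and DFmeas: "\<And>u. u \<in> borel_measurable (lebesgue_on \<Omega>) \<Longrightarrow> (\<lambda>x. DF x (u x)) \<in> borel_measurable (lebesgue_on \<Omega>)"
    and DFcont: "AE x in lebesgue_on \<Omega>. continuous_on UNIV (DF x)"
    and DFbd: "AE x in lebesgue_on \<Omega>. \<forall>P. norm (DF x P) \<le> K * (1 + norm P) powr (p - 1)"
    and Fbd: "AE x in lebesgue_on \<Omega>. \<forall>P. \<bar>F x P\<bar> \<le> K * (1 + norm P) powr p"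
    and Flow: "AE x in lebesgue_on \<Omega>. \<forall>P. c * norm P powr p - K \<le> F x P"
    and Ftan: "AE x in lebesgue_on \<Omega>. \<forall>P Q. F x Q \<ge> F x P + DF x P \<bullet> (Q - P)"
    and c: "c > 0" and K: "K > 0" and cB: "cB > 0"
begin

abbreviation "\<Gamma> \<equiv> frontier \<Omega>"
abbreviation "M\<Omega> \<equiv> lebesgue_on \<Omega>"

lemma q1: "q > 1" using p unfolding q by (simp add: field_simps)

lemma bor: "\<Gamma> \<in> sets borel" "\<Omega> \<in> sets borel"
  using \<Omega> by (auto intro: borel_closed)

lemma fin\<Omega>: "finite_measure M\<Omega>"
  using bor \<Omega> by (intro finite_measure_lebesgue_on)

lemma H\<Gamma>: "emeasure (hausdorff_measure (DIM('a) - 1)) \<Gamma> < top"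
  using Poincare_trace(1)[OF p \<Omega>] .

lemma fin_surf: "S \<in> sets borel \<Longrightarrow> S \<subseteq> \<Gamma> \<Longrightarrow> finite_measure (surf S)"
  using H\<Gamma> bor by (intro finite_measure_surf) (auto intro: le_less_trans[OF emeasure_mono])

lemmas fin\<Gamma> = fin_surf[OF bor(1) order_refl] and finD = fin_surf[OF \<Gamma>D(1,2)] and finN = fin_surf[OF \<Gamma>N]

lemma test_facts:
  assumes "test_fn UNIV \<phi>"
  shows "C1_grad \<phi> (grad \<phi>)" "\<phi> \<in> borel_measurable borel" "grad \<phi> \<in> borel_measurable borel" "smooth_fn \<phi>"
proof -
  show s: "smooth_fn \<phi>" using assms by (simp add: test_fn_def)
  show "C1_grad \<phi> (grad \<phi>)" using s by (rule smooth_fn_C1_grad)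
  then show "\<phi> \<in> borel_measurable borel" "grad \<phi> \<in> borel_measurable borel" by (rule C1_gradD)+
qed

lemma test_Lp:
  assumes \<phi>: "test_fn UNIV \<phi>" and r: "r > 0"
  shows "Lp_mem M\<Omega> r \<phi>" "Lp_mem M\<Omega> r (grad \<phi>)" "Lp_mem (surf \<Gamma>) r \<phi>" "Lp_mem (surf \<Gamma>D) r \<phi>" "Lp_mem (surf \<Gamma>N) r \<phi>"
proof -
  obtain B where B: "\<And>x. \<bar>\<phi> x\<bar> \<le> B" "\<And>x. norm (grad \<phi> x) \<le> B" using test_fn_bounded[OF \<phi>] by metis
  note m = test_facts(2,3)[OF \<phi>]
  show "Lp_mem M\<Omega> r \<phi>" "Lp_mem M\<Omega> r (grad \<phi>)"
    by (rule Lp_mem_bounded[OF fin\<Omega> _ _ r]; use m B in \<open>auto intro: borel_measurable_lebesgue_on_borel\<close>)+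
  show "Lp_mem (surf \<Gamma>) r \<phi>" by (rule Lp_mem_bounded[OF fin\<Gamma> _ _ r]; use m B in \<open>auto intro: borel_measurable_surf\<close>)
  show "Lp_mem (surf \<Gamma>D) r \<phi>" by (rule Lp_mem_bounded[OF finD _ _ r]; use m B in \<open>auto intro: borel_measurable_surf\<close>)
  show "Lp_mem (surf \<Gamma>N) r \<phi>" by (rule Lp_mem_bounded[OF finN _ _ r]; use m B in \<open>auto intro: borel_measurable_surf\<close>)
qed

lemma Lp_one_plus:
  fixes u :: "'b \<Rightarrow> 'c::{real_normed_vector,second_countable_topology}"
  assumes "finite_measure M" "Lp_mem M p u"
  shows "Lp_mem M p (\<lambda>x. 1 + norm (u x))"
  using Lp_mem_add[OF Lp_mem_const[OF assms(1), of p "1::real"] Lp_mem_norm[OF assms(2)]] p by simp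

lemma Lp_integrable_one_plus:
  fixes u :: "'b \<Rightarrow> 'c::{real_normed_vector,second_countable_topology}"
  assumes "finite_measure M" "Lp_mem M p u"
  shows "integrable M (\<lambda>x. (1 + norm (u x)) powr p)"
  using Lp_memD(2)[OF Lp_one_plus[OF assms]] by simp

lemma F_integrable:
  assumes u: "Lp_mem M\<Omega> p u"
  shows "integrable M\<Omega> (\<lambda>x. F x (u x))"
proof (rule Bochner_Integration.integrable_bound[OF _ Fmeas[OF Lp_memD(1)[OF u]]])
  show "integrable M\<Omega> (\<lambda>x. K * (1 + norm (u x)) powr p)"
    using Lp_integrable_one_plus[OF fin\<Omega> u] by simp
  show "AE x in M\<Omega>. norm (F x (u x)) \<le> norm (K * (1 + norm (u x)) powr p)"
    using Fbd by eventually_elim (use K in \<open>auto simp: abs_mult\<close>)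
qed

lemma DF_Lp:
  assumes u: "Lp_mem M\<Omega> p u"
  shows "Lp_mem M\<Omega> q (\<lambda>x. DF x (u x))"
  unfolding Lp_mem_def
proof
  show m: "(\<lambda>x. DF x (u x)) \<in> borel_measurable M\<Omega>" using DFmeas[OF Lp_memD(1)[OF u]] .
  show "integrable M\<Omega> (\<lambda>x. norm (DF x (u x)) powr q)"
  proof (rule Bochner_Integration.integrable_bound)
    show "integrable M\<Omega> (\<lambda>x. K powr q * (1 + norm (u x)) powr p)"
      using Lp_integrable_one_plus[OF fin\<Omega> u] by simp
    show "AE x in M\<Omega>. norm (norm (DF x (u x)) powr q) \<le> norm (K powr q * (1 + norm (u x)) powr p)"
      using DFbd
    proof eventually_elim
      case (elim x)
      have "norm (DF x (u x)) powr q \<le> (K * (1 + norm (u x)) powr (p - 1)) powr q"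
        using elim q1 by (intro powr_mono2) auto
      also have "\<dots> = K powr q * (1 + norm (u x)) powr ((p - 1) * q)"
        by (simp only: powr_mult powr_powr)
      also have "(p - 1) * q = p" using p by (simp add: q)
      finally show ?case by (simp add: abs_mult)
    qed
    show "(\<lambda>x. norm (DF x (u x)) powr q) \<in> borel_measurable M\<Omega>" using m by measurable
  qed
qed

text \<open>\<open>Bf\<close> is the penalty on \<open>\<Gamma>D\<close> and \<open>DB\<close> its
  slope; once cB is fixed by \<epsilon>, the value \<open>DB (tu x)\<close> is the eliminated
  unknown h.\<close>

definition Bf :: "real \<Rightarrow> real" where "Bf t = cB * ((max 0 t) powr p / p)"
definition DB :: "real \<Rightarrow> real" where "DB t = cB * (max 0 t) powr (p - 1)"

lemma Bf_tangent: "Bf s \<ge> Bf t + DB t * (s - t)"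
proof -
  have "cB * ((max 0 t) powr p / p + (max 0 t) powr (p - 1) * (s - t)) \<le> cB * ((max 0 s) powr p / p)"
    using pos_part_powr_tangent[OF p, of t s] cB by (intro mult_left_mono) auto
  then show ?thesis by (simp add: Bf_def DB_def distrib_left mult.assoc)
qed

lemma Bf_nonneg: "Bf t \<ge> 0"
  using cB p by (simp add: Bf_def)

lemma Bf_integrable:
  assumes t: "Lp_mem M p t"
  shows "integrable M (\<lambda>x. Bf (t x))"
proof (rule Bochner_Integration.integrable_bound)
  note [measurable] = Lp_memD(1)[OF t]
  show "integrable M (\<lambda>x. (cB / p) * norm (t x) powr p)" using Lp_memD(2)[OF t] by simp
  show "(\<lambda>x. Bf (t x)) \<in> borel_measurable M" unfolding Bf_def using Lp_memD(1)[OF t] by measurable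
  have "Bf s \<le> (cB / p) * norm s powr p" for s :: real
    unfolding Bf_def using cB p by (simp add: divide_right_mono mult_left_mono powr_mono2)
  then show "AE x in M. norm (Bf (t x)) \<le> norm ((cB / p) * norm (t x) powr p)"
    using Bf_nonneg cB p by (intro AE_I2) (simp add: abs_mult)
qed

lemma DB_Lp:
  assumes t: "Lp_mem M p t"
  shows "Lp_mem M q (\<lambda>x. DB (t x))"
  unfolding Lp_mem_def
proof
  show m: "(\<lambda>x. DB (t x)) \<in> borel_measurable M" unfolding DB_def using Lp_memD(1)[OF t] by measurable
  show "integrable M (\<lambda>x. norm (DB (t x)) powr q)"
  proof (rule Bochner_Integration.integrable_bound)
    show "integrable M (\<lambda>x. cB powr q * norm (t x) powr p)" using Lp_memD(2)[OF t] by simp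
    have "norm (DB s) powr q \<le> cB powr q * norm s powr p" for s :: real
    proof -
      have "norm (DB s) \<le> cB * norm s powr (p - 1)"
        unfolding DB_def using cB p by (simp add: abs_mult mult_left_mono powr_mono2)
      then have "norm (DB s) powr q \<le> (cB * norm s powr (p - 1)) powr q" using q1 by (intro powr_mono2) auto
      also have "\<dots> = cB powr q * norm s powr ((p - 1) * q)" by (simp only: powr_mult powr_powr)
      also have "(p - 1) * q = p" using p by (simp add: q)
      finally show ?thesis .
    qed
    then show "AE x in M. norm (norm (DB (t x)) powr q) \<le> norm (cB powr q * norm (t x) powr p)"
      by (intro AE_I2) (simp add: abs_mult)
    show "(\<lambda>x. norm (DB (t x)) powr q) \<in> borel_measurable M" using m by measurable
  qed
qed

definition J :: "('a \<Rightarrow> real) \<Rightarrow> real" where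
  "J \<phi> = (\<integral>x. F x (grad \<phi> x) \<partial>M\<Omega>) - (\<integral>x. j x * \<phi> x \<partial>surf \<Gamma>N) + (\<integral>x. Bf (\<phi> x) \<partial>surf \<Gamma>D)"

text \<open>Gradients and traces are separate arguments, so that the derivative can be evaluated at
  limits and in directions that are no longer test functions, whereas \<open>J\<close> reads the
  gradient off its argument.\<close>

definition DJ :: "('a \<Rightarrow> 'a) \<Rightarrow> ('a \<Rightarrow> real) \<Rightarrow> ('a \<Rightarrow> 'a) \<Rightarrow> ('a \<Rightarrow> real) \<Rightarrow> real" where
  "DJ Du tu Dv tv = (\<integral>x. DF x (Du x) \<bullet> Dv x \<partial>M\<Omega>) - (\<integral>x. j x * tv x \<partial>surf \<Gamma>N) + (\<integral>x. DB (tu x) * tv x \<partial>surf \<Gamma>D)"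

lemma pairing_integrable:
  assumes "Lp_mem M\<Omega> p Du" "Lp_mem (surf \<Gamma>D) p tu" "Lp_mem M\<Omega> p Dv" "Lp_mem (surf \<Gamma>D) p tv" "Lp_mem (surf \<Gamma>N) p tvN"
  shows "integrable M\<Omega> (\<lambda>x. DF x (Du x) \<bullet> Dv x)" "integrable (surf \<Gamma>D) (\<lambda>x. DB (tu x) * tv x)" "integrable (surf \<Gamma>N) (\<lambda>x. j x * tvN x)"
  using integrable_inner_Lp[OF p q DF_Lp[OF assms(1)] assms(3)] integrable_inner_Lp[OF p q DB_Lp[OF assms(2)] assms(4)]
    integrable_inner_Lp[OF p q j(1) assms(5)] by simp_all

lemma J_tangent:
  assumes \<phi>: "test_fn UNIV \<phi>" and \<psi>: "test_fn UNIV \<psi>"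
  shows "J \<psi> \<ge> J \<phi> + DJ (grad \<phi>) \<phi> (\<lambda>x. grad \<psi> x - grad \<phi> x) (\<lambda>x. \<psi> x - \<phi> x)"
proof -
  have p0: "p > 0" using p by simp
  note L\<phi> = test_Lp[OF \<phi> p0] and L\<psi> = test_Lp[OF \<psi> p0]
  note d = Lp_mem_diff[OF L\<psi>(2) L\<phi>(2) p0] Lp_mem_diff[OF L\<psi>(4) L\<phi>(4) p0] Lp_mem_diff[OF L\<psi>(5) L\<phi>(5) p0]
  note i = pairing_integrable[OF L\<phi>(2,4) d]
  note ij = pairing_integrable(3)[OF L\<phi>(2,4) d(1,2) L\<phi>(5)] pairing_integrable(3)[OF L\<phi>(2,4) d(1,2) L\<psi>(5)]
  have "(\<integral>x. F x (grad \<phi> x) + DF x (grad \<phi> x) \<bullet> (grad \<psi> x - grad \<phi> x) \<partial>M\<Omega>) \<le> (\<integral>x. F x (grad \<psi> x) \<partial>M\<Omega>)"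
  proof (rule integral_mono_AE)
    show "AE x in M\<Omega>. F x (grad \<phi> x) + DF x (grad \<phi> x) \<bullet> (grad \<psi> x - grad \<phi> x) \<le> F x (grad \<psi> x)"
      using Ftan by eventually_elim blast
  qed (use i F_integrable[OF L\<phi>(2)] F_integrable[OF L\<psi>(2)] in auto)
  moreover have "(\<integral>x. Bf (\<phi> x) + DB (\<phi> x) * (\<psi> x - \<phi> x) \<partial>surf \<Gamma>D) \<le> (\<integral>x. Bf (\<psi> x) \<partial>surf \<Gamma>D)"
    by (rule integral_mono) (use i Bf_integrable[OF L\<phi>(4)] Bf_integrable[OF L\<psi>(4)] Bf_tangent in auto)
  ultimately show ?thesis
    unfolding J_def DJ_def
    using i ij F_integrable[OF L\<phi>(2)] Bf_integrable[OF L\<phi>(4)] by (simp add: right_diff_distrib)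
qed

text \<open>One summand for each approximation condition in \<open>has_trace\<close>. Powers are
  used instead of norms because pointwise inequalities between them integrate directly.\<close>

definition Nf :: "('a \<Rightarrow> real) \<Rightarrow> real" where
  "Nf \<phi> = (\<integral>x. norm (\<phi> x) powr p \<partial>M\<Omega>) + (\<integral>x. norm (grad \<phi> x) powr p \<partial>M\<Omega>) + (\<integral>x. norm (\<phi> x) powr p \<partial>surf \<Gamma>)"

lemma DJ_scale: "DJ Du tu (\<lambda>x. r *\<^sub>R Dv x) (\<lambda>x. r * tv x) = r * DJ Du tu Dv tv"
  unfolding DJ_def by (simp add: mult.left_commute[of _ r] right_diff_distrib distrib_left)

text \<open>The tangents at the midpoint towards \<phi> and towards \<psi> have opposite linear
  terms.\<close>

lemma J_midpoint:
  assumes \<phi>: "test_fn UNIV \<phi>" and \<psi>: "test_fn UNIV \<psi>"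
  shows "J (\<lambda>x. (1/2) * \<phi> x + (1/2) * \<psi> x) \<le> (J \<phi> + J \<psi>) / 2"
proof -
  define \<mu> where "\<mu> x = (1/2) * \<phi> x + (1/2) * \<psi> x" for x
  have \<mu>: "test_fn UNIV \<mu>" unfolding \<mu>_def using test_fn_lincomb[OF \<phi> \<psi>] .
  have g\<mu>: "grad \<mu> x = (1/2) *\<^sub>R grad \<phi> x + (1/2) *\<^sub>R grad \<psi> x" for x
    unfolding \<mu>_def by (rule grad_lincomb) (use \<phi> \<psi> test_facts in auto)
  have e1: "grad \<phi> x - grad \<mu> x = (1/2) *\<^sub>R (grad \<phi> x - grad \<psi> x)" "grad \<psi> x - grad \<mu> x = (- 1/2) *\<^sub>R (grad \<phi> x - grad \<psi> x)" for x
    unfolding g\<mu> using scaleR_half_double[of "grad \<phi> x"] scaleR_half_double[of "grad \<psi> x"] by (simp_all add: algebra_simps)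
  have e2: "\<phi> x - \<mu> x = (1/2) * (\<phi> x - \<psi> x)" "\<psi> x - \<mu> x = (- 1/2) * (\<phi> x - \<psi> x)" for x
    by (simp_all add: \<mu>_def field_simps)
  have "DJ (grad \<mu>) \<mu> (\<lambda>x. grad \<phi> x - grad \<mu> x) (\<lambda>x. \<phi> x - \<mu> x) = (1/2) * DJ (grad \<mu>) \<mu> (\<lambda>x. grad \<phi> x - grad \<psi> x) (\<lambda>x. \<phi> x - \<psi> x)"
    "DJ (grad \<mu>) \<mu> (\<lambda>x. grad \<psi> x - grad \<mu> x) (\<lambda>x. \<psi> x - \<mu> x) = (- 1/2) * DJ (grad \<mu>) \<mu> (\<lambda>x. grad \<phi> x - grad \<psi> x) (\<lambda>x. \<phi> x - \<psi> x)"
    by (simp_all only: e1 e2 DJ_scale)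
  then have "2 * J \<mu> \<le> J \<phi> + J \<psi>" using J_tangent[OF \<mu> \<phi>] J_tangent[OF \<mu> \<psi>] by linarith
  then show ?thesis by (simp add: \<mu>_def[abs_def])
qed

lemma Nf_nonneg: "Nf \<phi> \<ge> 0"
  unfolding Nf_def by (intro add_nonneg_nonneg Bochner_Integration.integral_nonneg) auto

text \<open>The pointwise inequality is linear in the powers and in the gap, so it integrates with
  unchanged constants over all three measures; C serves both the scalar and the vector case.\<close>

lemma Nf_uniformly_convex:
  assumes \<eta>: "\<eta> > 0"
  shows "\<exists>C\<ge>0. \<forall>\<phi> \<psi>. test_fn UNIV \<phi> \<longrightarrow> test_fn UNIV \<psi> \<longrightarrow>
    Nf (\<lambda>x. \<phi> x - \<psi> x) \<le> \<eta> * (Nf \<phi> + Nf \<psi>) + C * ((Nf \<phi> + Nf \<psi>) / 2 - Nf (\<lambda>x. (1/2) * \<phi> x + (1/2) * \<psi> x))"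
proof -
  obtain C1 where C1: "C1 \<ge> 0" "\<And>a b :: real. norm (a - b) powr p \<le> \<eta> * (norm a powr p + norm b powr p) + C1 * cvx_gap p a b"
    using norm_powr_uniformly_convex[OF p \<eta>] by blast
  obtain C2 where C2: "C2 \<ge> 0" "\<And>a b :: 'a. norm (a - b) powr p \<le> \<eta> * (norm a powr p + norm b powr p) + C2 * cvx_gap p a b"
    using norm_powr_uniformly_convex[OF p \<eta>] by blast
  define C where "C = max C1 C2"
  have C: "C \<ge> 0" using C1 by (simp add: C_def)
  have uc1: "norm (a - b) powr p \<le> \<eta> * (norm a powr p + norm b powr p) + C * cvx_gap p a b" for a b :: real
    using C1(2)[of a b] mult_right_mono[OF _ cvx_gap(1)[OF p], of C1 C a b] by (simp add: C_def)
  have uc2: "norm (a - b) powr p \<le> \<eta> * (norm a powr p + norm b powr p) + C * cvx_gap p a b" for a b :: 'a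
    using C2(2)[of a b] mult_right_mono[OF _ cvx_gap(1)[OF p], of C2 C a b] by (simp add: C_def)
  have p0: "p > 0" using p by simp
  show ?thesis
  proof (intro exI[of _ C] conjI C allI impI)
    fix \<phi> \<psi> :: "'a \<Rightarrow> real" assume \<phi>: "test_fn UNIV \<phi>" and \<psi>: "test_fn UNIV \<psi>"
    note L\<phi> = test_Lp[OF \<phi> p0] and L\<psi> = test_Lp[OF \<psi> p0]
    have gen: "(\<integral>x. norm (f x - g x) powr p \<partial>M) \<le> \<eta> * ((\<integral>x. norm (f x) powr p \<partial>M) + (\<integral>x. norm (g x) powr p \<partial>M))
        + C * (((\<integral>x. norm (f x) powr p \<partial>M) + (\<integral>x. norm (g x) powr p \<partial>M)) / 2 - (\<integral>x. norm ((1/2) *\<^sub>R f x + (1/2) *\<^sub>R g x) powr p \<partial>M))"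
      if f: "Lp_mem M p f" and g: "Lp_mem M p g"
        and uc: "\<And>a b :: 'c. norm (a - b) powr p \<le> \<eta> * (norm a powr p + norm b powr p) + C * cvx_gap p a b"
      for M :: "'a measure" and f g :: "'a \<Rightarrow> 'c::euclidean_space"
    proof -
      note i = Lp_memD(2)[OF f] Lp_memD(2)[OF g] Lp_memD(2)[OF Lp_mem_add[OF Lp_mem_scaleR[OF f, of "1/2"] Lp_mem_scaleR[OF g, of "1/2"] p0]]
        Lp_memD(2)[OF Lp_mem_diff[OF f g p0]]
      have "(\<integral>x. norm (f x - g x) powr p \<partial>M) \<le> (\<integral>x. \<eta> * (norm (f x) powr p + norm (g x) powr p) + C * cvx_gap p (f x) (g x) \<partial>M)"
        by (rule integral_mono) (use i uc in \<open>auto simp: cvx_gap_def\<close>)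
      also have "\<dots> = \<eta> * ((\<integral>x. norm (f x) powr p \<partial>M) + (\<integral>x. norm (g x) powr p \<partial>M))
        + C * (((\<integral>x. norm (f x) powr p \<partial>M) + (\<integral>x. norm (g x) powr p \<partial>M)) / 2 - (\<integral>x. norm ((1/2) *\<^sub>R f x + (1/2) *\<^sub>R g x) powr p \<partial>M))"
        unfolding cvx_gap_def using i by simp
      finally show ?thesis .
    qed
    have gd: "grad (\<lambda>x. \<phi> x - \<psi> x) x = grad \<phi> x - grad \<psi> x" for x
      using grad_lincomb[OF test_facts(4)[OF \<phi>] test_facts(4)[OF \<psi>], of 1 "-1" x] by simp
    have gm: "grad (\<lambda>x. (1/2) * \<phi> x + (1/2) * \<psi> x) x = (1/2) *\<^sub>R grad \<phi> x + (1/2) *\<^sub>R grad \<psi> x" for x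
      by (rule grad_lincomb[OF test_facts(4)[OF \<phi>] test_facts(4)[OF \<psi>]])
    from gen[OF L\<phi>(1) L\<psi>(1) uc1] gen[OF L\<phi>(2) L\<psi>(2) uc2] gen[OF L\<phi>(3) L\<psi>(3) uc1]
    show "Nf (\<lambda>x. \<phi> x - \<psi> x) \<le> \<eta> * (Nf \<phi> + Nf \<psi>) + C * ((Nf \<phi> + Nf \<psi>) / 2 - Nf (\<lambda>x. (1/2) * \<phi> x + (1/2) * \<psi> x))"
      unfolding Nf_def gd gm real_scaleR_def by (simp only: distrib_left right_diff_distrib add_divide_distrib)
  qed
qed

section \<open>Coercivity of the reduced functional\<close>

lemma Poincare_trace_real:
  obtains C where "C > 0" "\<And>\<phi>. test_fn UNIV \<phi> \<Longrightarrow> \<exists>a.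
    (\<integral>x. norm (\<phi> x - a) powr p \<partial>M\<Omega>) + (\<integral>x. norm (\<phi> x - a) powr p \<partial>surf \<Gamma>) \<le> C * (\<integral>x. norm (grad \<phi> x) powr p \<partial>M\<Omega>)"
proof -
  have p0: "p > 0" using p by simp
  obtain C0 where C0: "C0 < top" "\<And>f Df. C1_grad f Df \<Longrightarrow> \<exists>a.
      (\<integral>\<^sup>+x\<in>\<Omega>. ennreal (\<bar>f x - a\<bar> powr p) \<partial>lborel) + (\<integral>\<^sup>+x\<in>\<Gamma>. ennreal (\<bar>f x - a\<bar> powr p) \<partial>hausdorff_measure (DIM('a) - 1))
        \<le> C0 * (\<integral>\<^sup>+x\<in>\<Omega>. ennreal (norm (Df x) powr p) \<partial>lborel)"
    using Poincare_trace(2)[OF p \<Omega>] by blast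
  obtain C where C: "C0 = ennreal C" "C \<ge> 0" using C0(1) by (cases C0) auto
  have nn\<Omega>: "(\<integral>\<^sup>+x\<in>\<Omega>. f x \<partial>lborel) = (\<integral>\<^sup>+x. f x \<partial>M\<Omega>)" for f :: "'a \<Rightarrow> ennreal"
    using bor by (subst nn_integral_restrict_space) (auto simp: nn_integral_completion)
  have nn\<Gamma>: "(\<integral>\<^sup>+x\<in>\<Gamma>. f x \<partial>hausdorff_measure (DIM('a) - 1)) = (\<integral>\<^sup>+x. f x \<partial>surf \<Gamma>)" for f :: "'a \<Rightarrow> ennreal"
    unfolding surf_def using bor by (subst nn_integral_restrict_space) auto
  show ?thesis
  proof
    show "C + 1 > 0" using C by simp
    fix \<phi> :: "'a \<Rightarrow> real" assume \<phi>: "test_fn UNIV \<phi>"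
    note L = test_Lp[OF \<phi> p0]
    obtain a where a: "(\<integral>\<^sup>+x\<in>\<Omega>. ennreal (\<bar>\<phi> x - a\<bar> powr p) \<partial>lborel) + (\<integral>\<^sup>+x\<in>\<Gamma>. ennreal (\<bar>\<phi> x - a\<bar> powr p) \<partial>hausdorff_measure (DIM('a) - 1))
        \<le> C0 * (\<integral>\<^sup>+x\<in>\<Omega>. ennreal (norm (grad \<phi> x) powr p) \<partial>lborel)"
      using C0(2)[OF test_facts(1)[OF \<phi>]] by blast
    have i: "integrable M\<Omega> (\<lambda>x. \<bar>\<phi> x - a\<bar> powr p)" "integrable (surf \<Gamma>) (\<lambda>x. \<bar>\<phi> x - a\<bar> powr p)" "integrable M\<Omega> (\<lambda>x. norm (grad \<phi> x) powr p)"
      using Lp_memD(2)[OF Lp_mem_diff[OF L(1) Lp_mem_const[OF fin\<Omega>] p0, of a]] Lp_memD(2)[OF Lp_mem_diff[OF L(3) Lp_mem_const[OF fin\<Gamma>] p0, of a]]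
        Lp_memD(2)[OF L(2)] by simp_all
    have "ennreal ((\<integral>x. \<bar>\<phi> x - a\<bar> powr p \<partial>M\<Omega>) + (\<integral>x. \<bar>\<phi> x - a\<bar> powr p \<partial>surf \<Gamma>)) \<le> ennreal (C * (\<integral>x. norm (grad \<phi> x) powr p \<partial>M\<Omega>))"
      using a C unfolding nn\<Omega> nn\<Gamma> nn_integral_eq_integral[OF i(1) AE_I2[OF powr_ge_zero]]
        nn_integral_eq_integral[OF i(2) AE_I2[OF powr_ge_zero]] nn_integral_eq_integral[OF i(3) AE_I2[OF powr_ge_zero]]
      by (simp add: ennreal_mult[symmetric] ennreal_plus[symmetric] del: ennreal_plus)
    then have "(\<integral>x. \<bar>\<phi> x - a\<bar> powr p \<partial>M\<Omega>) + (\<integral>x. \<bar>\<phi> x - a\<bar> powr p \<partial>surf \<Gamma>) \<le> C * (\<integral>x. norm (grad \<phi> x) powr p \<partial>M\<Omega>)"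
      using C by (subst (asm) ennreal_le_iff) auto
    also have "\<dots> \<le> (C + 1) * (\<integral>x. norm (grad \<phi> x) powr p \<partial>M\<Omega>)"
      by (intro mult_right_mono) auto
    finally show "\<exists>a. (\<integral>x. norm (\<phi> x - a) powr p \<partial>M\<Omega>) + (\<integral>x. norm (\<phi> x - a) powr p \<partial>surf \<Gamma>) \<le> (C + 1) * (\<integral>x. norm (grad \<phi> x) powr p \<partial>M\<Omega>)"
      by (intro exI[of _ a]) simp
  qed
qed

end

lemma integral_surf_subset_le:
  fixes S T :: "'a::euclidean_space set" and f :: "'a \<Rightarrow> real"
  assumes "S \<in> sets borel" "T \<in> sets borel" "S \<subseteq> T" "Lp_mem (surf T) p f"
  shows "(\<integral>x. norm (f x) powr p \<partial>surf S) \<le> (\<integral>x. norm (f x) powr p \<partial>surf T)"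
proof -
  note i = Lp_memD(2)[OF assms(4)] Lp_memD(2)[OF Lp_mem_surf_subset[OF assms]]
  have "ennreal (\<integral>x. norm (f x) powr p \<partial>surf S) \<le> ennreal (\<integral>x. norm (f x) powr p \<partial>surf T)"
    using nn_integral_surf_subset_le[OF assms(1-3), of "\<lambda>x. ennreal (norm (f x) powr p)"]
    unfolding nn_integral_eq_integral[OF i(1) AE_I2[OF powr_ge_zero]] nn_integral_eq_integral[OF i(2) AE_I2[OF powr_ge_zero]] .
  then show ?thesis by (subst (asm) ennreal_le_iff) (auto intro: Bochner_Integration.integral_nonneg)
qed

context convex_boundary_problem
begin

lemma flux_pos: "(\<integral>x. j x \<partial>surf \<Gamma>N) > 0" and j_integrable: "integrable (surf \<Gamma>N) j"
proof -
  have "integrable (surf \<Gamma>N) (\<lambda>x. j x \<bullet> 1)"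
    by (rule integrable_inner_Lp[OF p q j(1) Lp_mem_const[OF finN]])
  then show i: "integrable (surf \<Gamma>N) j" by simp
  have "(\<integral>x. j x \<partial>surf \<Gamma>N) \<noteq> 0" using integral_nonneg_eq_0_iff_AE[OF i j(2)] j(3) by simp
  moreover have "(\<integral>x. j x \<partial>surf \<Gamma>N) \<ge> 0" using j(2) by (rule integral_nonneg_AE)
  ultimately show "(\<integral>x. j x \<partial>surf \<Gamma>N) > 0" by simp
qed

text \<open>Split \<phi> into the constant a of the Poincare-trace inequality and an oscillation
  bounded by the gradient integral G. Out of c G, one quarter pays for the oscillation seen by j and
  another for the oscillation on \<open>\<Gamma>D\<close>. For a < 0 the flux term itself provides
  j0 |a|; for a >= 0 the penalty provides a multiple of a^p, which exceeds (j0 + 1) a up to a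
  constant.\<close>

lemma J_coercive:
  obtains k K' C where "k > 0" "C > 0"
    "\<And>\<phi>. test_fn UNIV \<phi> \<Longrightarrow> \<exists>a. (\<integral>x. norm (\<phi> x - a) powr p \<partial>M\<Omega>) + (\<integral>x. norm (\<phi> x - a) powr p \<partial>surf \<Gamma>) \<le> C * (\<integral>x. norm (grad \<phi> x) powr p \<partial>M\<Omega>)
      \<and> k * ((\<integral>x. norm (grad \<phi> x) powr p \<partial>M\<Omega>) + \<bar>a\<bar>) - K' \<le> J \<phi>"
proof -
  have p0: "p > 0" using p by simp
  obtain C where C: "C > 0" "\<And>\<phi>. test_fn UNIV \<phi> \<Longrightarrow> \<exists>a.
    (\<integral>x. norm (\<phi> x - a) powr p \<partial>M\<Omega>) + (\<integral>x. norm (\<phi> x - a) powr p \<partial>surf \<Gamma>) \<le> C * (\<integral>x. norm (grad \<phi> x) powr p \<partial>M\<Omega>)"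
    using Poincare_trace_real by blast
  define j0 where "j0 = (\<integral>x. j x \<partial>surf \<Gamma>N)"
  have j0: "j0 > 0" using flux_pos by (simp add: j0_def)
  define A where "A = (\<integral>x. norm (j x) powr q \<partial>surf \<Gamma>N)"
  define D where "D = measure (surf \<Gamma>D) (space (surf \<Gamma>D))"
  have D: "D > 0"
  proof -
    have "emeasure (surf \<Gamma>D) (space (surf \<Gamma>D)) = emeasure (hausdorff_measure (DIM('a) - 1)) \<Gamma>D"
      using \<Gamma>D by (simp add: surf_def space_restrict_space emeasure_restrict_space)
    moreover have "emeasure (surf \<Gamma>D) (space (surf \<Gamma>D)) \<noteq> top" using finite_measure.emeasure_finite[OF finD] by simp
    ultimately show ?thesis using \<Gamma>D(3) unfolding D_def measure_def by (simp add: enn2real_positive_iff less_top)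
  qed
  define W where "W = measure M\<Omega> (space M\<Omega>)"
  \<comment> \<open>Weight in Young's inequality for j: the boundary oscillation, at most C G, then
    costs c/4 G.\<close>
  define \<eta> where "\<eta> = (c / (4 * C)) powr (1 / p)"
  have \<eta>: "\<eta> > 0" "\<eta> powr p = c / (4 * C)" using c C p by (auto simp: \<eta>_def powr_powr)
  \<comment> \<open>Only a fraction \<theta> of the penalty is spent on a^p, small enough for the
    oscillation on \<open>\<Gamma>D\<close> to cost at most c/4 G.\<close>
  define \<theta> where "\<theta> = min (cB / p) (c / (4 * C))"
  have \<theta>: "\<theta> > 0" "\<theta> \<le> cB / p" "\<theta> \<le> c / (4 * C)" using cB p c C by (auto simp: \<theta>_def)
  have \<theta>C: "\<theta> * C \<le> c / 4" using mult_right_mono[OF \<theta>(3), of C] C(1) by simp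
  define \<theta>' where "\<theta>' = \<theta> * D / 2 powr p"
  have \<theta>': "\<theta>' > 0" using \<theta> D by (simp add: \<theta>'_def)
  \<comment> \<open>Weight for absorbing (j0 + 1) a into \<theta>' a^p; j0 a cancels the flux, and
    the extra 1 leaves the amount a that gives coercivity.\<close>
  define l where "l = \<theta>' powr (1 / p)"
  have l: "l > 0" "l powr p = \<theta>'" using \<theta>' p by (auto simp: l_def powr_powr)
  define K3 where "K3 = ((j0 + 1) / l) powr q"
  have K3: "K3 \<ge> 0" by (simp add: K3_def)
  define K' where "K' = K * W + (1 / \<eta>) powr q * A + K3"
  define k where "k = min (c / 2) (min 1 j0)"
  have k: "k > 0" "k \<le> c / 2" "k \<le> 1" "k \<le> j0" using c j0 by (auto simp: k_def)
  show ?thesis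
  proof (rule that[of k C K'])
    show "k > 0" "C > 0" using k C by auto
    fix \<phi> :: "'a \<Rightarrow> real" assume \<phi>: "test_fn UNIV \<phi>"
    note L = test_Lp[OF \<phi> p0]
    define G where "G = (\<integral>x. norm (grad \<phi> x) powr p \<partial>M\<Omega>)"
    have G0: "G \<ge> 0" unfolding G_def by (intro Bochner_Integration.integral_nonneg) auto
    obtain a where a: "(\<integral>x. norm (\<phi> x - a) powr p \<partial>M\<Omega>) + (\<integral>x. norm (\<phi> x - a) powr p \<partial>surf \<Gamma>) \<le> C * G"
      using C(2)[OF \<phi>] unfolding G_def by blast
    have LdG: "Lp_mem (surf \<Gamma>) p (\<lambda>x. \<phi> x - a)" using Lp_mem_diff[OF L(3) Lp_mem_const[OF fin\<Gamma>] p0] .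
    have LdD: "Lp_mem (surf \<Gamma>D) p (\<lambda>x. \<phi> x - a)" using Lp_mem_diff[OF L(4) Lp_mem_const[OF finD] p0] .
    have LdN: "Lp_mem (surf \<Gamma>N) p (\<lambda>x. \<phi> x - a)" using Lp_mem_diff[OF L(5) Lp_mem_const[OF finN] p0] .
    define XD where "XD = (\<integral>x. norm (\<phi> x - a) powr p \<partial>surf \<Gamma>D)"
    define XN where "XN = (\<integral>x. norm (\<phi> x - a) powr p \<partial>surf \<Gamma>N)"
    have X0: "(\<integral>x. norm (\<phi> x - a) powr p \<partial>M\<Omega>) \<ge> 0" by (intro Bochner_Integration.integral_nonneg) auto
    have XD: "XD \<le> C * G" using integral_surf_subset_le[OF \<Gamma>D(1) bor(1) \<Gamma>D(2) LdG] a X0 unfolding XD_def by linarith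
    have XN: "XN \<le> C * G" using integral_surf_subset_le[OF \<Gamma>N(1) bor(1) \<Gamma>N(2) LdG] a X0 unfolding XN_def by linarith
    have F: "c * G - K * W \<le> (\<integral>x. F x (grad \<phi> x) \<partial>M\<Omega>)"
    proof -
      have iK: "integrable M\<Omega> (\<lambda>x. K)" using finite_measure.integrable_const[OF fin\<Omega>] .
      have "(\<integral>x. c * norm (grad \<phi> x) powr p - K \<partial>M\<Omega>) \<le> (\<integral>x. F x (grad \<phi> x) \<partial>M\<Omega>)"
      proof (rule integral_mono_AE)
        show "AE x in M\<Omega>. c * norm (grad \<phi> x) powr p - K \<le> F x (grad \<phi> x)" using Flow by eventually_elim blast
      qed (use Lp_memD(2)[OF L(2)] iK F_integrable[OF L(2)] in auto)
      moreover have "(\<integral>x. c * norm (grad \<phi> x) powr p - K \<partial>M\<Omega>) = c * G - K * W"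
        using Lp_memD(2)[OF L(2)] iK by (simp add: G_def W_def)
      ultimately show ?thesis by simp
    qed
    have jp: "(\<integral>x. j x * \<phi> x \<partial>surf \<Gamma>N) \<le> a * j0 + (1 / \<eta>) powr q * A + c / 4 * G"
    proof -
      have i1: "integrable (surf \<Gamma>N) (\<lambda>x. j x * (\<phi> x - a))" using integrable_inner_Lp[OF p q j(1) LdN] by simp
      have "(\<integral>x. j x * (\<phi> x - a) \<partial>surf \<Gamma>N) \<le> (\<integral>x. (1 / \<eta>) powr q * norm (j x) powr q + \<eta> powr p * norm (\<phi> x - a) powr p \<partial>surf \<Gamma>N)"
      proof (rule integral_mono[OF i1])
        show "integrable (surf \<Gamma>N) (\<lambda>x. (1 / \<eta>) powr q * norm (j x) powr q + \<eta> powr p * norm (\<phi> x - a) powr p)"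
          using Lp_memD(2)[OF j(1)] Lp_memD(2)[OF LdN] by auto
        fix x
        have "j x * (\<phi> x - a) \<le> norm (j x) * norm (\<phi> x - a)" by (simp add: abs_mult[symmetric])
        also have "\<dots> = ((1 / \<eta>) * norm (j x)) * (\<eta> * norm (\<phi> x - a))" using \<eta> by simp
        also have "\<dots> \<le> ((1 / \<eta>) * norm (j x)) powr q + (\<eta> * norm (\<phi> x - a)) powr p"
          using \<eta> by (intro mult_le_powr_add[OF p q]) auto
        also have "\<dots> = (1 / \<eta>) powr q * norm (j x) powr q + \<eta> powr p * norm (\<phi> x - a) powr p" by (simp only: powr_mult)
        finally show "j x * (\<phi> x - a) \<le> \<dots>" .
      qed
      also have "\<dots> = (1 / \<eta>) powr q * A + \<eta> powr p * XN"
        using Lp_memD(2)[OF j(1)] Lp_memD(2)[OF LdN] by (simp add: A_def XN_def)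
      also have "\<dots> \<le> (1 / \<eta>) powr q * A + \<eta> powr p * (C * G)" using XN by (intro add_left_mono mult_left_mono) auto
      also have "\<eta> powr p * (C * G) = c / 4 * G" unfolding \<eta>(2) using C by simp
      finally have *: "(\<integral>x. j x * (\<phi> x - a) \<partial>surf \<Gamma>N) \<le> (1 / \<eta>) powr q * A + c / 4 * G" .
      have "(\<integral>x. j x * \<phi> x \<partial>surf \<Gamma>N) = (\<integral>x. j x * (\<phi> x - a) + a * j x \<partial>surf \<Gamma>N)"
        by (intro Bochner_Integration.integral_cong) (auto simp: algebra_simps)
      also have "\<dots> = (\<integral>x. j x * (\<phi> x - a) \<partial>surf \<Gamma>N) + a * j0"
        using i1 j_integrable by (simp add: j0_def)
      finally show ?thesis using * by simp
    qed
    define T where "T = (\<integral>x. (max 0 (\<phi> x)) powr p \<partial>surf \<Gamma>D)"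
    have iT: "integrable (surf \<Gamma>D) (\<lambda>x. (max 0 (\<phi> x)) powr p)"
    proof -
      have "integrable (surf \<Gamma>D) (\<lambda>x. (p / cB) * Bf (\<phi> x))" using Bf_integrable[OF L(4)] by simp
      moreover have "(p / cB) * Bf t = (max 0 t) powr p" for t using cB p by (simp add: Bf_def)
      ultimately show ?thesis by simp
    qed
    have T0: "T \<ge> 0" unfolding T_def by (intro Bochner_Integration.integral_nonneg) auto
    have BT: "(\<integral>x. Bf (\<phi> x) \<partial>surf \<Gamma>D) = cB / p * T" unfolding Bf_def T_def by simp
    have B: "(\<integral>x. Bf (\<phi> x) \<partial>surf \<Gamma>D) \<ge> 0" unfolding BT using cB p T0 by simp
    have "k * (G + \<bar>a\<bar>) - K' \<le> J \<phi>"
    proof (cases "a \<ge> 0")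
      case False
      have "k * (G + \<bar>a\<bar>) \<le> c / 2 * G + j0 * \<bar>a\<bar>"
        unfolding distrib_left using k G0 by (intro add_mono mult_right_mono) auto
      also have "\<dots> = c / 2 * G - a * j0" using False by simp
      finally have "k * (G + \<bar>a\<bar>) \<le> c / 2 * G - a * j0" .
      moreover have "c / 2 * G \<le> c * G - c / 4 * G" using c G0 by simp
      ultimately show ?thesis using F jp B K3 unfolding J_def K'_def by linarith
    next
      case True
      \<comment> \<open>For a >= 0 the constant is at most the positive part of \<phi> plus the
        oscillation. Integrated over \<open>\<Gamma>D\<close>, whose measure D is positive, this
        bounds a^p by the penalty and the oscillation.\<close>
      have "a powr p * D \<le> 2 powr p * (T + XD)"
      proof -
        have "(\<integral>x. a powr p \<partial>surf \<Gamma>D) \<le> (\<integral>x. 2 powr p * ((max 0 (\<phi> x)) powr p + norm (\<phi> x - a) powr p) \<partial>surf \<Gamma>D)"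
        proof (rule integral_mono)
          show "integrable (surf \<Gamma>D) (\<lambda>x. a powr p)" using finite_measure.integrable_const[OF finD] .
          show "integrable (surf \<Gamma>D) (\<lambda>x. 2 powr p * ((max 0 (\<phi> x)) powr p + norm (\<phi> x - a) powr p))"
            using iT Lp_memD(2)[OF LdD] by auto
          fix x
          have "a powr p \<le> (max 0 (\<phi> x) + norm (\<phi> x - a)) powr p"
            using True p by (intro powr_mono2) (auto simp: max_def)
          also have "\<dots> \<le> 2 powr p * ((max 0 (\<phi> x)) powr p + norm (\<phi> x - a) powr p)"
            by (rule powr_add_le) (use p in auto)
          finally show "a powr p \<le> 2 powr p * ((max 0 (\<phi> x)) powr p + norm (\<phi> x - a) powr p)" .
        qed
        also have "(\<integral>x. a powr p \<partial>surf \<Gamma>D) = a powr p * D" by (simp add: D_def)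
        also have "(\<integral>x. 2 powr p * ((max 0 (\<phi> x)) powr p + norm (\<phi> x - a) powr p) \<partial>surf \<Gamma>D) = 2 powr p * (T + XD)"
          using iT Lp_memD(2)[OF LdD] by (simp add: T_def XD_def)
        finally show ?thesis .
      qed
      then have "\<theta> * (a powr p * D) \<le> \<theta> * (2 powr p * (T + XD))" using \<theta> by (intro mult_left_mono) auto
      then have "\<theta>' * a powr p \<le> \<theta> * (T + XD)" by (simp add: \<theta>'_def field_simps)
      also have "\<dots> \<le> cB / p * T + c / 4 * G"
      proof -
        have "\<theta> * T \<le> cB / p * T" using \<theta> T0 by (intro mult_right_mono) auto
        moreover have "\<theta> * XD \<le> \<theta> * (C * G)" using \<theta> XD by (intro mult_left_mono) auto
        moreover have "\<theta> * (C * G) \<le> c / 4 * G" using mult_right_mono[OF \<theta>C G0] by (simp add: mult.assoc)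
        ultimately show ?thesis by (simp add: distrib_left)
      qed
      finally have bT: "\<theta>' * a powr p - c / 4 * G \<le> (\<integral>x. Bf (\<phi> x) \<partial>surf \<Gamma>D)" unfolding BT by simp
      have "(j0 + 1) * a = ((j0 + 1) / l) * (l * a)" using l by simp
      also have "\<dots> \<le> ((j0 + 1) / l) powr q + (l * a) powr p"
        using l j0 True by (intro mult_le_powr_add[OF p q]) auto
      also have "\<dots> = K3 + \<theta>' * a powr p" by (simp only: powr_mult l K3_def)
      finally have ya: "a + a * j0 \<le> K3 + \<theta>' * a powr p" by (simp add: algebra_simps)
      have "k * (G + \<bar>a\<bar>) \<le> c / 2 * G + 1 * \<bar>a\<bar>"
        unfolding distrib_left using k G0 by (intro add_mono mult_right_mono) auto
      also have "\<dots> = c / 2 * G + a" using True by simp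
      finally have "k * (G + \<bar>a\<bar>) \<le> c / 2 * G + a" .
      moreover have "c / 2 * G = c * G - c / 4 * G - c / 4 * G" by (simp add: algebra_simps)
      ultimately show ?thesis using F jp bT ya unfolding J_def K'_def by linarith
    qed
    then show "\<exists>a. (\<integral>x. norm (\<phi> x - a) powr p \<partial>M\<Omega>) + (\<integral>x. norm (\<phi> x - a) powr p \<partial>surf \<Gamma>) \<le> C * (\<integral>x. norm (grad \<phi> x) powr p \<partial>M\<Omega>)
      \<and> k * ((\<integral>x. norm (grad \<phi> x) powr p \<partial>M\<Omega>) + \<bar>a\<bar>) - K' \<le> J \<phi>"
      using a unfolding G_def by blast
  qed
qed

lemma J_bounded_below: "\<exists>L. \<forall>\<phi>. test_fn UNIV \<phi> \<longrightarrow> L \<le> J \<phi>"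
  and J_level_bounded: "\<exists>B. \<forall>\<phi>. test_fn UNIV \<phi> \<longrightarrow> J \<phi> \<le> L \<longrightarrow> Nf \<phi> \<le> B"
proof -
  have p0: "p > 0" using p by simp
  obtain k K' C where k: "k > 0" "C > 0" and co:
    "\<And>\<phi>. test_fn UNIV \<phi> \<Longrightarrow> \<exists>a. (\<integral>x. norm (\<phi> x - a) powr p \<partial>M\<Omega>) + (\<integral>x. norm (\<phi> x - a) powr p \<partial>surf \<Gamma>) \<le> C * (\<integral>x. norm (grad \<phi> x) powr p \<partial>M\<Omega>)
      \<and> k * ((\<integral>x. norm (grad \<phi> x) powr p \<partial>M\<Omega>) + \<bar>a\<bar>) - K' \<le> J \<phi>"
    by (rule J_coercive) (rule that)
  have G0: "(\<integral>x. norm (grad \<phi> x) powr p \<partial>M\<Omega>) \<ge> 0" for \<phi> by (intro Bochner_Integration.integral_nonneg) auto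
  show "\<exists>L. \<forall>\<phi>. test_fn UNIV \<phi> \<longrightarrow> L \<le> J \<phi>"
  proof (intro exI[of _ "- K'"] allI impI)
    fix \<phi> :: "'a \<Rightarrow> real" assume "test_fn UNIV \<phi>"
    then obtain a where "k * ((\<integral>x. norm (grad \<phi> x) powr p \<partial>M\<Omega>) + \<bar>a\<bar>) - K' \<le> J \<phi>" using co by blast
    moreover have "k * ((\<integral>x. norm (grad \<phi> x) powr p \<partial>M\<Omega>) + \<bar>a\<bar>) \<ge> 0" using k G0 by simp
    ultimately show "- K' \<le> J \<phi>" by linarith
  qed
  define W where "W = measure M\<Omega> (space M\<Omega>) + measure (surf \<Gamma>) (space (surf \<Gamma>))"
  \<comment> \<open>On the level set both the gradient integral and |a| are at most R, and \<phi> is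
    recovered as a plus the oscillation.\<close>
  define R where "R = (L + K') / k"
  show "\<exists>B. \<forall>\<phi>. test_fn UNIV \<phi> \<longrightarrow> J \<phi> \<le> L \<longrightarrow> Nf \<phi> \<le> B"
  proof (intro exI[of _ "R + 2 powr p * (C * R + R powr p * W)"] allI impI)
    fix \<phi> :: "'a \<Rightarrow> real" assume \<phi>: "test_fn UNIV \<phi>" and JL: "J \<phi> \<le> L"
    note Lp = test_Lp[OF \<phi> p0]
    define G where "G = (\<integral>x. norm (grad \<phi> x) powr p \<partial>M\<Omega>)"
    obtain a where a: "(\<integral>x. norm (\<phi> x - a) powr p \<partial>M\<Omega>) + (\<integral>x. norm (\<phi> x - a) powr p \<partial>surf \<Gamma>) \<le> C * G" "k * (G + \<bar>a\<bar>) - K' \<le> J \<phi>"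
      using co[OF \<phi>] unfolding G_def by blast
    have "k * (G + \<bar>a\<bar>) \<le> L + K'" using a(2) JL by linarith
    then have "G + \<bar>a\<bar> \<le> R" using k by (simp add: R_def field_simps)
    then have R: "G \<le> R" "\<bar>a\<bar> \<le> R" using G0[of \<phi>] unfolding G_def[symmetric] by linarith+
    have gen: "(\<integral>x. norm (\<phi> x) powr p \<partial>M) \<le> 2 powr p * ((\<integral>x. norm (\<phi> x - a) powr p \<partial>M) + R powr p * measure M (space M))"
      if M: "finite_measure M" and LM: "Lp_mem M p \<phi>" for M
    proof -
      note d = Lp_memD(2)[OF Lp_mem_diff[OF LM Lp_mem_const[OF M] p0, of a]]
      have iR: "integrable M (\<lambda>x. R powr p)" using finite_measure.integrable_const[OF M] .
      have "(\<integral>x. norm (\<phi> x) powr p \<partial>M) \<le> (\<integral>x. 2 powr p * (norm (\<phi> x - a) powr p + R powr p) \<partial>M)"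
      proof (rule integral_mono)
        show "integrable M (\<lambda>x. norm (\<phi> x) powr p)" using Lp_memD(2)[OF LM] .
        show "integrable M (\<lambda>x. 2 powr p * (norm (\<phi> x - a) powr p + R powr p))" using d iR by auto
        fix x
        have "norm (\<phi> x) powr p \<le> (norm (\<phi> x - a) + R) powr p" using R p by (intro powr_mono2) auto
        also have "\<dots> \<le> 2 powr p * (norm (\<phi> x - a) powr p + R powr p)" by (rule powr_add_le) (use p R in auto)
        finally show "norm (\<phi> x) powr p \<le> 2 powr p * (norm (\<phi> x - a) powr p + R powr p)" .
      qed
      also have "\<dots> = 2 powr p * ((\<integral>x. norm (\<phi> x - a) powr p \<partial>M) + R powr p * measure M (space M))"
        using d iR by (simp add: mult.commute)
      finally show ?thesis .
    qed
    have "Nf \<phi> \<le> G + 2 powr p * (((\<integral>x. norm (\<phi> x - a) powr p \<partial>M\<Omega>) + (\<integral>x. norm (\<phi> x - a) powr p \<partial>surf \<Gamma>)) + R powr p * W)"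
      using gen[OF fin\<Omega> Lp(1)] gen[OF fin\<Gamma> Lp(3)] unfolding Nf_def G_def W_def by (simp add: distrib_left)
    also have "\<dots> \<le> R + 2 powr p * (C * R + R powr p * W)"
    proof (intro add_mono mult_left_mono R(1))
      show "(\<integral>x. norm (\<phi> x - a) powr p \<partial>M\<Omega>) + (\<integral>x. norm (\<phi> x - a) powr p \<partial>surf \<Gamma>) \<le> C * R"
        using a(1) mult_left_mono[OF R(1), of C] k by linarith
    qed auto
    finally show "Nf \<phi> \<le> R + 2 powr p * (C * R + R powr p * W)" .
  qed
qed

end

section \<open>Minimising sequence and Euler-Lagrange equation\<close>

context convex_boundary_problem
begin

text \<open>The sets of test functions within e n of the infimum are closed under midpoints and
  bounded in \<open>Nf\<close>, so the Cauchy selection applies; a subsequence attains the rate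
  demanded by \<open>Lp_fast_Cauchy_limit\<close>.\<close>

lemma minimizing_sequence:
  obtains w where "\<And>n. test_fn UNIV (w n)"
    "\<And>n \<phi>. test_fn UNIV \<phi> \<Longrightarrow> J (w n) \<le> J \<phi> + (1 / real (Suc n))\<^sup>2"
    "\<And>n. Nf (\<lambda>x. w (Suc n) x - w n x) < 2 powr (- (p + 1) * n)"
proof -
  define V where "V = {\<phi> :: 'a \<Rightarrow> real. test_fn UNIV \<phi>}"
  have V0: "(\<lambda>x. 0) \<in> V" by (simp add: V_def test_fn_zero)
  obtain L where L: "\<And>\<phi>. \<phi> \<in> V \<Longrightarrow> L \<le> J \<phi>" using J_bounded_below by (auto simp: V_def)
  define I where "I = Inf (J ` V)"
  have bdd: "bdd_below (J ` V)" using L by (intro bdd_belowI[of _ L]) auto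
  have I: "I \<le> J \<phi>" if "\<phi> \<in> V" for \<phi> unfolding I_def using that bdd by (intro cInf_lower) auto
  \<comment> \<open>The tolerance is the square of the step 1/(n+1) by which the sequence will be
    perturbed, so that tolerance over step tends to 0.\<close>
  define e where "e n = (1 / real (Suc n))\<^sup>2" for n
  have e: "e n > 0" "e (Suc n) \<le> e n" for n
    unfolding e_def by (simp, intro power_mono) (auto simp: field_simps)
  define C where "C n = {\<phi> \<in> V. J \<phi> \<le> I + e n}" for n
  define mid where "mid \<phi> \<psi> = (\<lambda>x::'a. (1/2) * \<phi> x + (1/2) * \<psi> x :: real)" for \<phi> \<psi>
  obtain B where B: "\<And>\<phi>. \<phi> \<in> V \<Longrightarrow> J \<phi> \<le> I + e 0 \<Longrightarrow> Nf \<phi> \<le> B"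
    using J_level_bounded[of "I + e 0"] by (auto simp: V_def)
  obtain w where w: "\<And>n. w n \<in> C n" "\<And>\<epsilon>. \<epsilon> > 0 \<Longrightarrow> \<exists>n0. \<forall>m\<ge>n0. \<forall>n\<ge>n0. Nf (\<lambda>x. w m x - w n x) < \<epsilon>"
  proof (rule uniformly_convex_Cauchy_selection[of C mid Nf B "\<lambda>\<phi> \<psi>. Nf (\<lambda>x. \<phi> x - \<psi> x)"])
    fix n
    have "Inf (J ` V) < I + e n" using e(1)[of n] by (simp add: I_def)
    then obtain \<phi> where "\<phi> \<in> V" "J \<phi> < I + e n" using cInf_lessD[of "J ` V"] V0 by auto
    then show "C n \<noteq> {}" by (auto simp: C_def)
    show "C (Suc n) \<subseteq> C n" using e(2)[of n] by (auto simp: C_def)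
    show "mid \<phi> \<psi> \<in> C n" if "\<phi> \<in> C n" "\<psi> \<in> C n" for \<phi> \<psi>
    proof -
      have t: "test_fn UNIV \<phi>" "test_fn UNIV \<psi>" and JJ: "J \<phi> \<le> I + e n" "J \<psi> \<le> I + e n"
        using that by (auto simp: C_def V_def)
      have "J (mid \<phi> \<psi>) \<le> I + e n" using J_midpoint[OF t] JJ unfolding mid_def add_divide_distrib by linarith
      then show ?thesis using test_fn_lincomb[OF t, of "1/2" "1/2"] by (auto simp: C_def V_def mid_def)
    qed
    show "0 \<le> Nf \<phi> \<and> Nf \<phi> \<le> B" if "\<phi> \<in> C 0" for \<phi> using that B Nf_nonneg by (auto simp: C_def)
    show "\<exists>c\<ge>0. \<forall>a\<in>C 0. \<forall>b\<in>C 0. Nf (\<lambda>x. a x - b x) \<le> \<eta> * (Nf a + Nf b) + c * ((Nf a + Nf b) / 2 - Nf (mid a b))" if "\<eta> > 0" for \<eta>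
      using Nf_uniformly_convex[OF that] unfolding mid_def C_def V_def by blast
  qed blast
  obtain r where r: "strict_mono r" "\<And>n. Nf (\<lambda>x. w (r (Suc n)) x - w (r n) x) < 2 powr (- (p + 1) * n)"
    by (rule Cauchy_fast_subsequence[of "\<lambda>m n. Nf (\<lambda>x. w m x - w n x)" "\<lambda>n. 2 powr (- (p + 1) * real n)"])
       (use w(2) in auto)
  \<comment> \<open>Passing to a subsequence only improves the tolerance.\<close>
  have ee: "e (r n) \<le> e n" for n
  proof -
    have "n \<le> r n" using strict_mono_imp_increasing[OF r(1)] .
    then show ?thesis unfolding e_def by (intro power_mono) (auto simp: field_simps)
  qed
  show ?thesis
  proof (rule that[of "\<lambda>n. w (r n)"])
    show "test_fn UNIV (w (r n))" for n using w(1)[of "r n"] by (simp add: C_def V_def)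
    show "J (w (r n)) \<le> J \<phi> + (1 / real (Suc n))\<^sup>2" if "test_fn UNIV \<phi>" for n \<phi>
      using w(1)[of "r n"] I[of \<phi>] ee[of n] that unfolding e_def[of n, symmetric] by (auto simp: C_def V_def)
    show "Nf (\<lambda>x. w (r (Suc n)) x - w (r n) x) < 2 powr (- (p + 1) * n)" for n by (rule r(2))
  qed
qed

text \<open>Integration by parts holds for each f n, and both sides are pairings with fixed bounded
  functions, hence converge.\<close>

lemma trace_limit_weak_grad:
  fixes f :: "nat \<Rightarrow> 'a \<Rightarrow> real"
  assumes f: "\<And>n. test_fn UNIV (f n)" and u: "Lp_mem M\<Omega> p u" and Du: "Lp_mem M\<Omega> p Du"
    and limu: "(\<lambda>n. \<integral>\<^sup>+x. ennreal (norm (f n x - u x) powr p) \<partial>M\<Omega>) \<longlonglongrightarrow> 0"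
    and limDu: "(\<lambda>n. \<integral>\<^sup>+x. ennreal (norm (grad (f n) x - Du x) powr p) \<partial>M\<Omega>) \<longlonglongrightarrow> 0"
  shows "weak_grad \<Omega> u Du"
  unfolding weak_grad_def
proof (intro allI impI ballI)
  fix \<zeta> and b :: 'a assume \<zeta>: "test_fn \<Omega> \<zeta>" and b: "b \<in> Basis"
  have p0: "p > 0" and q0: "q > 0" using p q1 by auto
  note L = test_Lp[OF f p0] and L\<zeta> = test_Lp[OF test_fn_UNIV[OF \<zeta>] q0]
  have fd: "frechet_derivative \<zeta> (at x) b = grad \<zeta> x \<bullet> b" for x
    using \<zeta> by (intro frechet_derivative_eq_grad smooth_fn_differentiable) (simp add: test_fn_def)
  have "norm (grad \<zeta> x \<bullet> b) \<le> norm (norm b *\<^sub>R grad \<zeta> x)" for x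
    using Cauchy_Schwarz_ineq2[of "grad \<zeta> x" b] by (simp add: mult.commute)
  note cs = AE_I2[OF this]
  have g1: "Lp_mem M\<Omega> q (\<lambda>x. grad \<zeta> x \<bullet> b)"
    by (rule Lp_mem_dominated[OF Lp_mem_scaleR[OF L\<zeta>(2), of "norm b"]])
       (use Lp_memD(1)[OF L\<zeta>(2)] cs q0 in \<open>auto simp del: norm_scaleR\<close>)
  have g2: "Lp_mem M\<Omega> q (\<lambda>x. \<zeta> x *\<^sub>R b)"
    by (rule Lp_mem_dominated[OF Lp_mem_scaleR[OF L\<zeta>(1), of "norm b"]])
       (use Lp_memD(1)[OF L\<zeta>(1)] q0 in \<open>auto simp: mult.commute abs_mult\<close>)
  have "(\<lambda>n. \<integral>x. (grad \<zeta> x \<bullet> b) \<bullet> f n x \<partial>M\<Omega>) \<longlonglongrightarrow> (\<integral>x. (grad \<zeta> x \<bullet> b) \<bullet> u x \<partial>M\<Omega>)"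
    by (rule tendsto_integral_inner_Lp[OF p q g1 L(1) u limu])
  moreover have "(\<lambda>n. \<integral>x. (\<zeta> x *\<^sub>R b) \<bullet> grad (f n) x \<partial>M\<Omega>) \<longlonglongrightarrow> (\<integral>x. (\<zeta> x *\<^sub>R b) \<bullet> Du x \<partial>M\<Omega>)"
    by (rule tendsto_integral_inner_Lp[OF p q g2 L(2) Du limDu])
  then have "(\<lambda>n. - (\<integral>x. (\<zeta> x *\<^sub>R b) \<bullet> grad (f n) x \<partial>M\<Omega>)) \<longlonglongrightarrow> - (\<integral>x. (\<zeta> x *\<^sub>R b) \<bullet> Du x \<partial>M\<Omega>)"
    by (rule tendsto_minus)
  moreover have "(\<integral>x. (grad \<zeta> x \<bullet> b) \<bullet> f n x \<partial>M\<Omega>) = - (\<integral>x. (\<zeta> x *\<^sub>R b) \<bullet> grad (f n) x \<partial>M\<Omega>)" for n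
    using test_fn_integration_by_parts[OF f[of n] \<zeta> \<Omega>(1), of b] by (simp add: mult.commute inner_commute)
  ultimately have "(\<integral>x. (grad \<zeta> x \<bullet> b) \<bullet> u x \<partial>M\<Omega>) = - (\<integral>x. (\<zeta> x *\<^sub>R b) \<bullet> Du x \<partial>M\<Omega>)"
    using LIMSEQ_unique by simp
  then show "(\<integral>x. u x * frechet_derivative \<zeta> (at x) b \<partial>M\<Omega>) = - (\<integral>x. (Du x \<bullet> b) * \<zeta> x \<partial>M\<Omega>)"
    unfolding fd by (simp add: mult.commute inner_commute)
qed

text \<open>Stationarity is read off the sequence instead of J at the limit: perturbing f n by t n
  \<psi> shows that DJ at the perturbed function is at least -t n in direction \<psi>, and DJ
  converges by dominated convergence with the majorants from
  \<open>Lp_fast_Cauchy_limit\<close>.\<close>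

proposition minimizer_exists:
  obtains u Du tu where "W1p \<Omega> p u Du" "has_trace \<Omega> p u Du tu" "Lp_mem (surf \<Gamma>) p tu"
    "\<And>\<psi>. test_fn UNIV \<psi> \<Longrightarrow> DJ Du tu (grad \<psi>) \<psi> = 0"
proof -
  have p0: "p > 0" using p by simp
  obtain f where f: "\<And>n. test_fn UNIV (f n)"
    "\<And>n \<phi>. test_fn UNIV \<phi> \<Longrightarrow> J (f n) \<le> J \<phi> + (1 / real (Suc n))\<^sup>2"
    "\<And>n. Nf (\<lambda>x. f (Suc n) x - f n x) < 2 powr (- (p + 1) * n)"
    by (rule minimizing_sequence) (rule that)
  note L = test_Lp[OF f(1) p0] and mt = Lp_memD(1)[OF test_Lp(1)[OF f(1) p0]] Lp_memD(1)[OF test_Lp(2)[OF f(1) p0]] Lp_memD(1)[OF test_Lp(3)[OF f(1) p0]]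
  have gd: "grad (\<lambda>x. f (Suc n) x - f n x) x = grad (f (Suc n)) x - grad (f n) x" for n x
    using grad_lincomb[OF test_facts(4)[OF f(1)] test_facts(4)[OF f(1)], of 1 "Suc n" "-1" n x] by simp
  have fast: "(\<integral>\<^sup>+x. ennreal (norm (f (Suc n) x - f n x) powr p) \<partial>M\<Omega>) \<le> ennreal (2 powr (- (p + 1) * n))"
    "(\<integral>\<^sup>+x. ennreal (norm (grad (f (Suc n)) x - grad (f n) x) powr p) \<partial>M\<Omega>) \<le> ennreal (2 powr (- (p + 1) * n))"
    "(\<integral>\<^sup>+x. ennreal (norm (f (Suc n) x - f n x) powr p) \<partial>surf \<Gamma>) \<le> ennreal (2 powr (- (p + 1) * n))" for n
  proof -
    have nn: "(\<integral>x. norm (g x) powr p \<partial>M) \<ge> 0" for M :: "'a measure" and g :: "'a \<Rightarrow> 'c::real_normed_vector"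
      by (intro Bochner_Integration.integral_nonneg) auto
    have s: "(\<integral>x. norm (f (Suc n) x - f n x) powr p \<partial>M\<Omega>) + (\<integral>x. norm (grad (f (Suc n)) x - grad (f n) x) powr p \<partial>M\<Omega>)
       + (\<integral>x. norm (f (Suc n) x - f n x) powr p \<partial>surf \<Gamma>) < 2 powr (- (p + 1) * n)"
      using f(3)[of n] unfolding Nf_def gd .
    note i = Lp_memD(2)[OF Lp_mem_diff[OF L(1) L(1) p0]] Lp_memD(2)[OF Lp_mem_diff[OF L(2) L(2) p0]] Lp_memD(2)[OF Lp_mem_diff[OF L(3) L(3) p0]]
    note n0 = nn[of M\<Omega> "\<lambda>x. f (Suc n) x - f n x"] nn[of M\<Omega> "\<lambda>x. grad (f (Suc n)) x - grad (f n) x"] nn[of "surf \<Gamma>" "\<lambda>x. f (Suc n) x - f n x"]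
    show "(\<integral>\<^sup>+x. ennreal (norm (f (Suc n) x - f n x) powr p) \<partial>M\<Omega>) \<le> ennreal (2 powr (- (p + 1) * n))"
      unfolding nn_integral_eq_integral[OF i(1) AE_I2[OF powr_ge_zero]] by (rule ennreal_leI) (use s n0 in linarith)
    show "(\<integral>\<^sup>+x. ennreal (norm (grad (f (Suc n)) x - grad (f n) x) powr p) \<partial>M\<Omega>) \<le> ennreal (2 powr (- (p + 1) * n))"
      unfolding nn_integral_eq_integral[OF i(2) AE_I2[OF powr_ge_zero]] by (rule ennreal_leI) (use s n0 in linarith)
    show "(\<integral>\<^sup>+x. ennreal (norm (f (Suc n) x - f n x) powr p) \<partial>surf \<Gamma>) \<le> ennreal (2 powr (- (p + 1) * n))"
      unfolding nn_integral_eq_integral[OF i(3) AE_I2[OF powr_ge_zero]] by (rule ennreal_leI) (use s n0 in linarith)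
  qed
  obtain u S1 where u: "u \<in> borel_measurable M\<Omega>" "(\<lambda>n. \<integral>\<^sup>+x. ennreal (norm (f n x - u x) powr p) \<partial>M\<Omega>) \<longlonglongrightarrow> 0"
    by (rule Lp_fast_Cauchy_limit[OF p mt(1) fast(1)]) (rule that)
  obtain Du S2 where Du: "Du \<in> borel_measurable M\<Omega>" "Lp_mem M\<Omega> p (S2 :: 'a \<Rightarrow> real)"
    "AE x in M\<Omega>. (\<lambda>n. grad (f n) x) \<longlonglongrightarrow> Du x" "AE x in M\<Omega>. \<forall>n. norm (grad (f n) x - Du x) \<le> S2 x"
    "(\<lambda>n. \<integral>\<^sup>+x. ennreal (norm (grad (f n) x - Du x) powr p) \<partial>M\<Omega>) \<longlonglongrightarrow> 0"
    by (rule Lp_fast_Cauchy_limit[OF p mt(2) fast(2)]) (rule that)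
  obtain tu S3 where tu: "tu \<in> borel_measurable (surf \<Gamma>)" "Lp_mem (surf \<Gamma>) p (S3 :: 'a \<Rightarrow> real)"
    "AE x in surf \<Gamma>. (\<lambda>n. f n x) \<longlonglongrightarrow> tu x" "AE x in surf \<Gamma>. \<forall>n. norm (f n x - tu x) \<le> S3 x"
    "(\<lambda>n. \<integral>\<^sup>+x. ennreal (norm (f n x - tu x) powr p) \<partial>surf \<Gamma>) \<longlonglongrightarrow> 0"
    by (rule Lp_fast_Cauchy_limit[OF p mt(3) fast(3)]) (rule that)
  have Lu: "Lp_mem M\<Omega> p u" by (rule Lp_mem_limit[OF L(1) u(1) p0 u(2)])
  have LDu: "Lp_mem M\<Omega> p Du" by (rule Lp_mem_limit[OF L(2) Du(1) p0 Du(5)])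
  have Ltu: "Lp_mem (surf \<Gamma>) p tu" by (rule Lp_mem_limit[OF L(3) tu(1) p0 tu(5)])
  have LtuD: "Lp_mem (surf \<Gamma>D) p tu" by (rule Lp_mem_surf_subset[OF \<Gamma>D(1) bor(1) \<Gamma>D(2) Ltu])
  have LS3: "Lp_mem (surf \<Gamma>D) p S3" by (rule Lp_mem_surf_subset[OF \<Gamma>D(1) bor(1) \<Gamma>D(2) tu(2)])
  note tuD = AE_surf_subset[OF \<Gamma>D(1) bor(1) \<Gamma>D(2) tu(3)] AE_surf_subset[OF \<Gamma>D(1) bor(1) \<Gamma>D(2) tu(4)]
  have W: "W1p \<Omega> p u Du"
    unfolding W1p_def using Lu LDu trace_limit_weak_grad[OF f(1) Lu LDu u(2) Du(5)] by blast
  have T: "has_trace \<Omega> p u Du tu"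
    unfolding has_trace_def using tu(1,5) u(2) Du(5) f(1) by (intro conjI exI[of _ f]) auto
  have DJ_ge: "DJ Du tu (grad \<psi>) \<psi> \<ge> 0" if \<psi>: "test_fn UNIV \<psi>" for \<psi>
  proof -
    note L\<psi> = test_Lp[OF \<psi> p0]
    obtain B where B: "B \<ge> 0" "\<And>x. \<bar>\<psi> x\<bar> \<le> B" "\<And>x. norm (grad \<psi> x) \<le> B" using test_fn_bounded[OF \<psi>] by metis
    define t where "t n = 1 / real (Suc n)" for n
    have t: "t n > 0" "t n \<le> 1" for n by (auto simp: t_def)
    have tlim: "t \<longlonglongrightarrow> 0" unfolding t_def using LIMSEQ_inverse_real_of_nat by (simp add: inverse_eq_divide)
    define w where "w n x = f n x + t n * \<psi> x" for n x
    have w: "test_fn UNIV (w n)" for n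
      using test_fn_lincomb[OF f(1)[of n] \<psi>, of 1 "t n"] by (simp add: w_def[abs_def])
    have gw: "grad (w n) x = grad (f n) x + t n *\<^sub>R grad \<psi> x" for n x
      using grad_lincomb[OF test_facts(4)[OF f(1)[of n]] test_facts(4)[OF \<psi>], of 1 "t n" x] by (simp add: w_def[abs_def])
    note Lw = test_Lp[OF w p0]
    have low: "- t n \<le> DJ (grad (w n)) (w n) (grad \<psi>) \<psi>" for n
    proof -
      \<comment> \<open>The tangent is taken at w n and evaluated at f n. Combined with
        near-minimality of f n, the values of J cancel and leave -(t n)^2 <= t n DJ.\<close>
      have e1: "grad (f n) x - grad (w n) x = (- t n) *\<^sub>R grad \<psi> x" "f n x - w n x = (- t n) * \<psi> x" for x
        by (simp_all add: gw w_def)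
      have "J (w n) + (- t n) * DJ (grad (w n)) (w n) (grad \<psi>) \<psi> \<le> J (f n)"
        using J_tangent[OF w[of n] f(1)[of n]] unfolding e1 DJ_scale .
      also have "J (f n) \<le> J (w n) + (t n)\<^sup>2" using f(2)[OF w[of n], of n] by (simp add: t_def)
      finally have "t n * (- t n) \<le> t n * DJ (grad (w n)) (w n) (grad \<psi>) \<psi>" by (simp add: power2_eq_square)
      then show ?thesis using t(1)[of n] by (subst (asm) mult_le_cancel_left_pos) auto
    qed
    have lim1: "(\<lambda>n. \<integral>x. DF x (grad (w n) x) \<bullet> grad \<psi> x \<partial>M\<Omega>) \<longlonglongrightarrow> (\<integral>x. DF x (Du x) \<bullet> grad \<psi> x \<partial>M\<Omega>)"
    proof (rule integral_dominated_convergence)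
      show "(\<lambda>x. DF x (Du x) \<bullet> grad \<psi> x) \<in> borel_measurable M\<Omega>"
        using DFmeas[OF Du(1)] Lp_memD(1)[OF L\<psi>(2)] by measurable
      show "(\<lambda>x. DF x (grad (w n) x) \<bullet> grad \<psi> x) \<in> borel_measurable M\<Omega>" for n
        using DFmeas[OF Lp_memD(1)[OF Lw(2)[of n]]] Lp_memD(1)[OF L\<psi>(2)] by measurable
      have LS: "Lp_mem M\<Omega> p (\<lambda>x. norm (Du x) + norm (S2 x) + B)"
        by (intro Lp_mem_add Lp_mem_norm LDu Du(2) Lp_mem_const[OF fin\<Omega>] p0)
      show "integrable M\<Omega> (\<lambda>x. B * (K * (1 + norm (norm (Du x) + norm (S2 x) + B)) powr p))"
        using Lp_integrable_one_plus[OF fin\<Omega> LS] by simp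
      show "AE x in M\<Omega>. (\<lambda>n. DF x (grad (w n) x) \<bullet> grad \<psi> x) \<longlonglongrightarrow> DF x (Du x) \<bullet> grad \<psi> x"
        using DFcont Du(3)
      proof eventually_elim
        case (elim x)
        have "(\<lambda>n. grad (w n) x) \<longlonglongrightarrow> Du x + 0 *\<^sub>R grad \<psi> x" unfolding gw by (intro tendsto_intros elim(2) tlim)
        then have "(\<lambda>n. grad (w n) x) \<longlonglongrightarrow> Du x" by simp
        then have "(\<lambda>n. DF x (grad (w n) x)) \<longlonglongrightarrow> DF x (Du x)"
          using elim(1) by (auto intro: continuous_on_tendsto_compose)
        then show ?case by (intro tendsto_intros)
      qed
      show "AE x in M\<Omega>. norm (DF x (grad (w n) x) \<bullet> grad \<psi> x) \<le> B * (K * (1 + norm (norm (Du x) + norm (S2 x) + B)) powr p)" for n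
        using DFbd Du(4)
      proof eventually_elim
        case (elim x)
        define Z where "Z = norm (Du x) + norm (S2 x) + B"
        have Z0: "Z \<ge> 0" using B by (simp add: Z_def)
        have "norm (grad (w n) x) \<le> norm (grad (f n) x) + t n * norm (grad \<psi> x)"
          unfolding gw using norm_triangle_ineq[of "grad (f n) x" "t n *\<^sub>R grad \<psi> x"] t(1)[of n] by simp
        also have "\<dots> \<le> (norm (Du x) + norm (S2 x)) + 1 * B"
        proof (intro add_mono mult_mono)
          have "norm (grad (f n) x) \<le> norm (Du x) + norm (grad (f n) x - Du x)"
            using norm_triangle_ineq[of "Du x" "grad (f n) x - Du x"] by simp
          also have "norm (grad (f n) x - Du x) \<le> norm (S2 x)" using elim(2)[rule_format, of n] by simp
          finally show "norm (grad (f n) x) \<le> norm (Du x) + norm (S2 x)" by simp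
        qed (use t[of n] B in auto)
        finally have nz: "norm (grad (w n) x) \<le> Z" by (simp add: Z_def)
        have "norm (DF x (grad (w n) x) \<bullet> grad \<psi> x) \<le> norm (DF x (grad (w n) x)) * norm (grad \<psi> x)"
          using Cauchy_Schwarz_ineq2 by simp
        also have "\<dots> \<le> (K * (1 + norm (grad (w n) x)) powr (p - 1)) * B"
          using elim(1) B K by (intro mult_mono) auto
        \<comment> \<open>The exponent may be raised from p - 1 to p because 1 + Z >= 1; the
          majorant is then integrable by \<open>Lp_integrable_one_plus\<close>.\<close>
        also have "\<dots> \<le> (K * (1 + Z) powr p) * B"
        proof (intro mult_right_mono mult_left_mono)
          have "(1 + norm (grad (w n) x)) powr (p - 1) \<le> (1 + Z) powr (p - 1)" using nz p by (intro powr_mono2) auto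
          also have "\<dots> \<le> (1 + Z) powr p" using Z0 by (intro powr_mono) auto
          finally show "(1 + norm (grad (w n) x)) powr (p - 1) \<le> (1 + Z) powr p" .
        qed (use B K in auto)
        finally show ?case using Z0 by (simp add: Z_def mult.commute)
      qed
    qed
    have cDB: "continuous_on UNIV DB"
      unfolding DB_def using p by (intro continuous_intros continuous_on_powr') auto
    have lim2: "(\<lambda>n. \<integral>x. DB (w n x) * \<psi> x \<partial>surf \<Gamma>D) \<longlonglongrightarrow> (\<integral>x. DB (tu x) * \<psi> x \<partial>surf \<Gamma>D)"
    proof (rule integral_dominated_convergence)
      show "(\<lambda>x. DB (tu x) * \<psi> x) \<in> borel_measurable (surf \<Gamma>D)"
        using Lp_memD(1)[OF DB_Lp[OF LtuD]] Lp_memD(1)[OF L\<psi>(4)] by measurable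
      show "(\<lambda>x. DB (w n x) * \<psi> x) \<in> borel_measurable (surf \<Gamma>D)" for n
        using Lp_memD(1)[OF DB_Lp[OF Lw(4)[of n]]] Lp_memD(1)[OF L\<psi>(4)] by measurable
      have LS: "Lp_mem (surf \<Gamma>D) p (\<lambda>x. norm (tu x) + norm (S3 x) + B)"
        by (intro Lp_mem_add Lp_mem_norm LtuD LS3 Lp_mem_const[OF finD] p0)
      show "integrable (surf \<Gamma>D) (\<lambda>x. B * (cB * (1 + norm (norm (tu x) + norm (S3 x) + B)) powr p))"
        using Lp_integrable_one_plus[OF finD LS] by simp
      show "AE x in surf \<Gamma>D. (\<lambda>n. DB (w n x) * \<psi> x) \<longlonglongrightarrow> DB (tu x) * \<psi> x"
        using tuD(1)
      proof eventually_elim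
        case (elim x)
        have "(\<lambda>n. w n x) \<longlonglongrightarrow> tu x + 0 * \<psi> x" unfolding w_def by (intro tendsto_intros elim tlim)
        then have "(\<lambda>n. w n x) \<longlonglongrightarrow> tu x" by simp
        then have "(\<lambda>n. DB (w n x)) \<longlonglongrightarrow> DB (tu x)"
          using cDB by (auto intro: continuous_on_tendsto_compose)
        then show ?case by (intro tendsto_intros)
      qed
      show "AE x in surf \<Gamma>D. norm (DB (w n x) * \<psi> x) \<le> B * (cB * (1 + norm (norm (tu x) + norm (S3 x) + B)) powr p)" for n
        using tuD(2)
      proof eventually_elim
        case (elim x)
        define Z where "Z = norm (tu x) + norm (S3 x) + B"
        have Z0: "Z \<ge> 0" using B by (simp add: Z_def)
        have "t n * \<bar>\<psi> x\<bar> \<le> 1 * B" using t[of n] B by (intro mult_mono) auto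
        then have "\<bar>w n x\<bar> \<le> \<bar>f n x\<bar> + B"
          unfolding w_def using abs_triangle_ineq[of "f n x" "t n * \<psi> x"] t(1)[of n] by (simp add: abs_mult)
        moreover have "\<bar>f n x\<bar> \<le> \<bar>tu x\<bar> + \<bar>S3 x\<bar>" using elim[rule_format, of n] by simp
        ultimately have nz: "\<bar>w n x\<bar> \<le> Z" by (simp add: Z_def)
        have "(max 0 (w n x)) powr (p - 1) \<le> (1 + Z) powr (p - 1)" using nz Z0 p by (intro powr_mono2) auto
        also have "\<dots> \<le> (1 + Z) powr p" using Z0 by (intro powr_mono) auto
        finally have "norm (DB (w n x)) \<le> cB * (1 + Z) powr p" unfolding DB_def using cB by (simp add: abs_mult)
        then have "norm (DB (w n x)) * norm (\<psi> x) \<le> (cB * (1 + Z) powr p) * B"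
          using B cB by (intro mult_mono) auto
        then show ?case using Z0 by (simp add: Z_def mult.commute abs_mult)
      qed
    qed
    have "(\<lambda>n. DJ (grad (w n)) (w n) (grad \<psi>) \<psi>) \<longlonglongrightarrow> DJ Du tu (grad \<psi>) \<psi>"
      unfolding DJ_def by (intro tendsto_intros lim1 lim2)
    moreover have "(\<lambda>n. - t n) \<longlonglongrightarrow> - 0" by (intro tendsto_intros tlim)
    ultimately show ?thesis using LIMSEQ_le[of "\<lambda>n. - t n" "- 0"] low by auto
  qed
  \<comment> \<open>The inequality for \<psi> and for -\<psi> gives equality, DJ being linear in its
    direction.\<close>
  have "DJ Du tu (grad \<psi>) \<psi> = 0" if \<psi>: "test_fn UNIV \<psi>" for \<psi>
  proof -
    have t: "test_fn UNIV (\<lambda>x. (- 1) * \<psi> x)" using test_fn_lincomb[OF \<psi> \<psi>, of "-1" 0] by simp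
    have "grad (\<lambda>x. (- 1) * \<psi> x) = (\<lambda>x. (- 1) *\<^sub>R grad \<psi> x)"
      using grad_lincomb[OF test_facts(4)[OF \<psi>] test_facts(4)[OF \<psi>], of "-1" 0] by (simp add: fun_eq_iff)
    then have "DJ Du tu (grad (\<lambda>x. (- 1) * \<psi> x)) (\<lambda>x. (- 1) * \<psi> x) = (- 1) * DJ Du tu (grad \<psi>) \<psi>"
      by (simp only: DJ_scale)
    then show ?thesis using DJ_ge[OF t] DJ_ge[OF \<psi>] by simp
  qed
  then show ?thesis using W T Ltu that by blast
qed

text \<open>The trace is at finite distance from a test function, which is bounded on a boundary of
  finite measure.\<close>

lemma trace_Lp:
  assumes "has_trace \<Omega> p v Dv tv"
  shows "Lp_mem (surf \<Gamma>) p tv"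
proof -
  have p0: "p > 0" using p by simp
  obtain \<phi> where \<phi>: "\<And>n. test_fn UNIV (\<phi> n)" "tv \<in> borel_measurable (surf \<Gamma>)"
    "(\<lambda>n. \<integral>\<^sup>+x. ennreal (\<bar>\<phi> n x - tv x\<bar> powr p) \<partial>surf \<Gamma>) \<longlonglongrightarrow> 0"
    using assms by (auto simp: has_trace_def)
  show ?thesis by (rule Lp_mem_limit[OF test_Lp(3)[OF \<phi>(1) p0] \<phi>(2) p0]) (use \<phi>(3) in simp)
qed

text \<open>DJ is continuous in its direction with respect to the L^p norms of gradient and trace,
  and \<open>has_trace\<close> supplies test functions converging in this sense.\<close>

lemma DJ_zero_extend:
  assumes Du: "Lp_mem M\<Omega> p Du" and tu: "Lp_mem (surf \<Gamma>) p tu"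
    and z: "\<And>\<psi>. test_fn UNIV \<psi> \<Longrightarrow> DJ Du tu (grad \<psi>) \<psi> = 0"
    and v: "Lp_mem M\<Omega> p Dv" "has_trace \<Omega> p v Dv tv"
  shows "DJ Du tu Dv tv = 0"
proof -
  have p0: "p > 0" using p by simp
  obtain \<phi> where \<phi>: "\<And>n. test_fn UNIV (\<phi> n)" 
    "(\<lambda>n. \<integral>\<^sup>+x. ennreal (norm (grad (\<phi> n) x - Dv x) powr p) \<partial>M\<Omega>) \<longlonglongrightarrow> 0"
    "(\<lambda>n. \<integral>\<^sup>+x. ennreal (norm (\<phi> n x - tv x) powr p) \<partial>surf \<Gamma>) \<longlonglongrightarrow> 0"
    using v(2) by (auto simp: has_trace_def)
  note tv = trace_Lp[OF v(2)]
  note L = test_Lp[OF \<phi>(1) p0]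
  have l1: "(\<lambda>n. \<integral>x. DF x (Du x) \<bullet> grad (\<phi> n) x \<partial>M\<Omega>) \<longlonglongrightarrow> (\<integral>x. DF x (Du x) \<bullet> Dv x \<partial>M\<Omega>)"
    by (rule tendsto_integral_inner_Lp[OF p q DF_Lp[OF Du] L(2) v(1) \<phi>(2)])
  have l2: "(\<lambda>n. \<integral>x. j x \<bullet> \<phi> n x \<partial>surf \<Gamma>N) \<longlonglongrightarrow> (\<integral>x. j x \<bullet> tv x \<partial>surf \<Gamma>N)"
    by (rule tendsto_integral_inner_Lp[OF p q j(1) L(5) Lp_mem_surf_subset[OF \<Gamma>N(1) bor(1) \<Gamma>N(2) tv] tendsto_surf_subset[OF \<Gamma>N(1) bor(1) \<Gamma>N(2) \<phi>(3)]])
  have l3: "(\<lambda>n. \<integral>x. DB (tu x) \<bullet> \<phi> n x \<partial>surf \<Gamma>D) \<longlonglongrightarrow> (\<integral>x. DB (tu x) \<bullet> tv x \<partial>surf \<Gamma>D)"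
    by (rule tendsto_integral_inner_Lp[OF p q DB_Lp[OF Lp_mem_surf_subset[OF \<Gamma>D(1) bor(1) \<Gamma>D(2) tu]] L(4) Lp_mem_surf_subset[OF \<Gamma>D(1) bor(1) \<Gamma>D(2) tv] tendsto_surf_subset[OF \<Gamma>D(1) bor(1) \<Gamma>D(2) \<phi>(3)]])
  have "(\<lambda>n. DJ Du tu (grad (\<phi> n)) (\<phi> n)) \<longlonglongrightarrow> DJ Du tu Dv tv"
    using tendsto_add[OF tendsto_diff[OF l1 l2] l3] by (simp add: DJ_def)
  then show ?thesis unfolding z[OF \<phi>(1)] by (simp add: LIMSEQ_const_iff)
qed

end

section \<open>The variational inequality\<close>

text \<open>Lebesgue measure is complete, so changes on null sets preserve measurability; extension
  by zero moves the question to the whole space.\<close>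

lemma borel_measurable_lebesgue_on_AE:
  fixes f g :: "'a::euclidean_space \<Rightarrow> 'c::euclidean_space"
  assumes \<Omega>: "\<Omega> \<in> sets borel" and f: "f \<in> borel_measurable (lebesgue_on \<Omega>)" and AE: "AE x in lebesgue_on \<Omega>. f x = g x"
  shows "g \<in> borel_measurable (lebesgue_on \<Omega>)"
proof -
  have \<Omega>': "\<Omega> \<in> sets lebesgue" using \<Omega> by auto
  have "(\<lambda>x. if x \<in> \<Omega> then f x else 0) \<in> borel_measurable lebesgue"
    using f \<Omega>' by (simp add: borel_measurable_if)
  moreover have "AE x in lebesgue. (if x \<in> \<Omega> then f x else 0) = (if x \<in> \<Omega> then g x else 0)"
  proof -
    have "AE x in lebesgue. x \<in> \<Omega> \<longrightarrow> f x = g x" using AE \<Omega>' by (simp add: AE_restrict_space_iff)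
    then show ?thesis by eventually_elim auto
  qed
  ultimately have "(\<lambda>x. if x \<in> \<Omega> then g x else 0) \<in> borel_measurable lebesgue"
    by (rule borel_measurable_AE)
  then show ?thesis using \<Omega>' by (simp add: borel_measurable_if)
qed

text \<open>For a simple u only finitely many sections of F occur, each of them measurable.
  Continuity in the second variable, valid for almost every x, carries this to limits of simple
  functions.\<close>

lemma Caratheodory_measurable:
  fixes F :: "'a::euclidean_space \<Rightarrow> 'b::euclidean_space \<Rightarrow> 'c::euclidean_space"
  assumes \<Omega>: "\<Omega> \<in> sets borel" and F: "\<And>P. (\<lambda>x. F x P) \<in> borel_measurable (lebesgue_on \<Omega>)"
    and cont: "AE x in lebesgue_on \<Omega>. continuous_on UNIV (F x)"
    and u: "u \<in> borel_measurable (lebesgue_on \<Omega>)"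
  shows "(\<lambda>x. F x (u x)) \<in> borel_measurable (lebesgue_on \<Omega>)"
proof -
  obtain s where s: "\<And>i. simple_function (lebesgue_on \<Omega>) (s i)" "\<And>x. x \<in> space (lebesgue_on \<Omega>) \<Longrightarrow> (\<lambda>i. s i x) \<longlonglongrightarrow> u x"
    using borel_measurable_implies_sequence_metric[OF u, of 0] by blast
  have m: "(\<lambda>x. F x (s i x)) \<in> borel_measurable (lebesgue_on \<Omega>)" for i
  proof (rule measurable_compose_countable'[where f = "\<lambda>P x. F x P" and I = "s i ` space (lebesgue_on \<Omega>)"])
    show "s i \<in> measurable (lebesgue_on \<Omega>) (count_space (s i ` space (lebesgue_on \<Omega>)))"
    proof (rule measurable_count_space_eq2[THEN iffD2])
      show "finite (s i ` space (lebesgue_on \<Omega>))" using simple_functionD(1)[OF s(1)] .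
      show "s i \<in> space (lebesgue_on \<Omega>) \<rightarrow> s i ` space (lebesgue_on \<Omega>) \<and> (\<forall>a\<in>s i ` space (lebesgue_on \<Omega>). s i -` {a} \<inter> space (lebesgue_on \<Omega>) \<in> sets (lebesgue_on \<Omega>))"
        using simple_functionD(2)[OF s(1)] by auto
    qed
    show "countable (s i ` space (lebesgue_on \<Omega>))" using simple_functionD(1)[OF s(1)] by (rule countable_finite)
  qed (rule F)
  have "(\<lambda>x. lim (\<lambda>i. F x (s i x))) \<in> borel_measurable (lebesgue_on \<Omega>)"
    using m by measurable
  moreover have "AE x in lebesgue_on \<Omega>. lim (\<lambda>i. F x (s i x)) = F x (u x)"
    using cont AE_space
  proof eventually_elim
    case (elim x)
    have "(\<lambda>i. F x (s i x)) \<longlonglongrightarrow> F x (u x)"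
      by (rule continuous_on_tendsto_compose[OF elim(1) s(2)[OF elim(2)]]) auto
    then show ?case by (rule limI)
  qed
  ultimately show ?thesis by (rule borel_measurable_lebesgue_on_AE[OF \<Omega>])
qed

text \<open>Each component of the gradient is an a.e. limit of measurable difference
  quotients.\<close>

lemma gradient_measurable:
  fixes H :: "'a::euclidean_space \<Rightarrow> 'b::euclidean_space \<Rightarrow> real"
  assumes \<Omega>: "\<Omega> \<in> sets borel" and H: "\<And>P. (\<lambda>x. H x P) \<in> borel_measurable (lebesgue_on \<Omega>)"
    and d: "AE x in lebesgue_on \<Omega>. (H x has_derivative (\<lambda>q. D x \<bullet> q)) (at P)"
  shows "D \<in> borel_measurable (lebesgue_on \<Omega>)"
proof (subst borel_measurable_euclidean_space, rule ballI)
  fix b :: 'b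
  define Q where "Q n x = (H x ((1 / real (Suc n)) *\<^sub>R b + P) - H x P) / (1 / real (Suc n))" for n x
  have [measurable]: "Q n \<in> borel_measurable (lebesgue_on \<Omega>)" for n
    unfolding Q_def using H by measurable
  have "(\<lambda>x. lim (\<lambda>n. Q n x)) \<in> borel_measurable (lebesgue_on \<Omega>)" by measurable
  moreover have "AE x in lebesgue_on \<Omega>. lim (\<lambda>n. Q n x) = D x \<bullet> b"
    using d by eventually_elim (use directional_derivative_LIMSEQ in \<open>auto simp: Q_def intro!: limI\<close>)
  ultimately show "(\<lambda>x. D x \<bullet> b) \<in> borel_measurable (lebesgue_on \<Omega>)"
    by (rule borel_measurable_lebesgue_on_AE[OF \<Omega>])
qed

lemma (in convex_boundary_problem) DJ_diff:
  assumes "Lp_mem M\<Omega> p Du" "Lp_mem (surf \<Gamma>) p tu" "Lp_mem M\<Omega> p Dv" "Lp_mem (surf \<Gamma>) p tv" "Lp_mem M\<Omega> p Dw" "Lp_mem (surf \<Gamma>) p tw"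
  shows "DJ Du tu (\<lambda>x. Dv x - Dw x) (\<lambda>x. tv x - tw x) = DJ Du tu Dv tv - DJ Du tu Dw tw"
proof -
  note sD = Lp_mem_surf_subset[OF \<Gamma>D(1) bor(1) \<Gamma>D(2)] and sN = Lp_mem_surf_subset[OF \<Gamma>N(1) bor(1) \<Gamma>N(2)]
  note iv = pairing_integrable[OF assms(1) sD[OF assms(2)] assms(3) sD[OF assms(4)] sN[OF assms(4)]]
  note iw = pairing_integrable[OF assms(1) sD[OF assms(2)] assms(5) sD[OF assms(6)] sN[OF assms(6)]]
  show ?thesis unfolding DJ_def using iv iw by (simp add: inner_diff_right right_diff_distrib)
qed

theorem theorem1p1:
  fixes \<Omega> \<Gamma>D \<Gamma>N :: "'a::euclidean_space set"
    and \<alpha> \<beta> \<gamma> \<gamma>' \<epsilon> :: real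
    and j :: "'a \<Rightarrow> real"
    and g :: "real \<Rightarrow> real"
    and H :: "'a \<Rightarrow> 'a \<Rightarrow> real"
    and DpH :: "'a \<Rightarrow> 'a \<Rightarrow> 'a"
  assumes dom: "open \<Omega>" "bounded \<Omega>" "connected \<Omega>" "C1_boundary \<Omega>"
    and GD: "openin (top_of_set (frontier \<Omega>)) \<Gamma>D" "\<Gamma>D \<noteq> {}"
            "emeasure (hausdorff_measure (DIM('a) - 1)) \<Gamma>D > 0"
    and GN: "openin (top_of_set (frontier \<Omega>)) \<Gamma>N" "\<Gamma>N \<noteq> {}"
            "emeasure (hausdorff_measure (DIM('a) - 1)) \<Gamma>N > 0"
    and GDN: "\<Gamma>D \<inter> \<Gamma>N = {}" "frontier \<Omega> = closure (\<Gamma>D \<union> \<Gamma>N)"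
             "emeasure (hausdorff_measure (DIM('a) - 1)) ((closure \<Gamma>D - \<Gamma>D) \<inter> (closure \<Gamma>N - \<Gamma>N)) = 0"
    and exps: "\<alpha> > 1" "\<beta> > 0" "\<gamma> = (\<beta> + 1) / \<beta> * \<alpha>" "\<gamma>' = \<gamma> / (\<gamma> - 1)"
    and jass: "Lp_mem (surf \<Gamma>N) \<gamma>' j" "AE x in surf \<Gamma>N. j x \<ge> 0"
              "\<not> (AE x in surf \<Gamma>N. j x = 0)"
    and gass: "continuous_on {0..} g" "strict_mono_on {0..} g"
              "\<exists>C>1. \<forall>m\<ge>0. m powr \<beta> / C - C \<le> g m \<and> g m \<le> C * m powr \<beta> + C"
    and Hmeas: "\<forall>p. (\<lambda>x. H x p) \<in> borel_measurable (lebesgue_on \<Omega>)"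
    and HC1: "AE x in lebesgue_on \<Omega>.
                (\<forall>p. (H x has_derivative (\<lambda>q. DpH x p \<bullet> q)) (at p))
                \<and> continuous_on UNIV (DpH x) \<and> convex_on UNIV (H x)"
    and Hbounds: "\<exists>C>1.
        (AE x in lebesgue_on \<Omega>. \<forall>p. norm (DpH x p) \<le> C * norm p powr (\<alpha> - 1) + C \<and> H x 0 \<le> C)
      \<and> ((AE x in lebesgue_on \<Omega>. \<forall>p. H x p \<ge> norm p powr \<alpha> / C - C)
         \<or> (AE x in lebesgue_on \<Omega>. \<forall>p. DpH x p \<bullet> p \<ge> norm p powr \<alpha> / C - C \<and> H x p \<ge> - C)
         \<or> (AE x in lebesgue_on \<Omega>. \<forall>p. - H x p + DpH x p \<bullet> p \<ge> norm p powr \<alpha> / C - C \<and> H x p \<ge> - C))"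
    and eps: "\<epsilon> > 0"
  shows "\<exists>m u Du tu h. Xplus \<Omega> \<Gamma>D \<beta> \<alpha> m u Du tu h \<and>
           (\<forall>\<mu> v Dv tv k. Xplus \<Omega> \<Gamma>D \<beta> \<alpha> \<mu> v Dv tv k \<longrightarrow>
              A_pair \<Omega> \<Gamma>D \<Gamma>N \<beta> \<alpha> H DpH g j \<epsilon> m Du tu h
                 (\<lambda>x. \<mu> x - m x) (\<lambda>x. Dv x - Du x) (\<lambda>x. tv x - tu x) (\<lambda>x. k x - h x) \<ge> 0)"
proof -
  have \<gamma>eq: "\<gamma> = \<alpha> / \<beta> + \<alpha>" unfolding exps(3) using exps(2) by (simp add: field_simps)
  have "\<alpha> / \<beta> > 0" using exps(1,2) by simp
  then have \<gamma>: "\<gamma> > 1" using exps(1) unfolding \<gamma>eq by linarith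
  have \<Omega>ne: "\<Omega> \<noteq> {}" using GD openin_imp_subset[OF GD(1)] by auto
  have fr: "frontier \<Omega> \<in> sets borel" "\<Omega> \<in> sets borel" using dom(1) by (auto intro: borel_closed)
  have openin_borel: "S \<in> sets borel" "S \<subseteq> frontier \<Omega>" if "openin (top_of_set (frontier \<Omega>)) S" for S
    using that fr by (auto simp: openin_open)
  obtain Cg where Cg: "Cg > 1" "\<And>m. m \<ge> 0 \<Longrightarrow> m powr \<beta> / Cg - Cg \<le> g m \<and> g m \<le> Cg * m powr \<beta> + Cg"
    using gass(3) by blast
  obtain M where M: "\<And>s. M s \<ge> 0" "\<And>s. g (M s) = max s (g 0)" "continuous_on UNIV M" "mono M"
    "\<And>s. M s \<le> (Cg * Cg * (1 + \<bar>s\<bar>)) powr (1 / \<beta>)"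
    "\<And>s. s \<ge> Cg \<Longrightarrow> ((s - Cg) / Cg) powr (1 / \<beta>) \<le> M s"
    by (rule growth_inverse[OF gass(1,2) exps(2) Cg]) (assumption, rule that)
  have Mz: "M s = 0" if "s \<le> g 0" for s
  proof (rule ccontr)
    assume "M s \<noteq> 0"
    then have "M s > 0" using M(1)[of s] by simp
    then have "g 0 < g (M s)" using gass(2) by (auto simp: strict_mono_on_def)
    then show False using M(2)[of s] that by simp
  qed
  obtain E where E: "\<And>s. E s \<ge> 0" "E (g 0) = 0" "\<And>s s'. E s' \<ge> E s + M s * (s' - s)" "mono E"
    by (rule monotone_antiderivative[OF M(3,4,1) Mz[OF order_refl]]) (rule that)
  obtain CH where CH: "CH > 1" "AE x in lebesgue_on \<Omega>. \<forall>p. norm (DpH x p) \<le> CH * norm p powr (\<alpha> - 1) + CH \<and> H x 0 \<le> CH"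
    "(AE x in lebesgue_on \<Omega>. \<forall>p. H x p \<ge> norm p powr \<alpha> / CH - CH)
         \<or> (AE x in lebesgue_on \<Omega>. \<forall>p. DpH x p \<bullet> p \<ge> norm p powr \<alpha> / CH - CH \<and> H x p \<ge> - CH)
         \<or> (AE x in lebesgue_on \<Omega>. \<forall>p. - H x p + DpH x p \<bullet> p \<ge> norm p powr \<alpha> / CH - CH \<and> H x p \<ge> - CH)"
    using Hbounds by blast
  have cases: "AE x in lebesgue_on \<Omega>. (\<forall>p. H x p \<ge> norm p powr \<alpha> / CH - CH)
      \<or> (\<forall>p. DpH x p \<bullet> p \<ge> norm p powr \<alpha> / CH - CH \<and> H x p \<ge> - CH)
      \<or> (\<forall>p. - H x p + DpH x p \<bullet> p \<ge> norm p powr \<alpha> / CH - CH \<and> H x p \<ge> - CH)"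
    using CH(3) by (elim disjE; elim eventually_mono) blast+
  \<comment> \<open>Here M enters with the constants B = Cg * Cg and B' = Cg, and E vanishes at a =
    g(0).\<close>
  have "\<exists>K>0. \<exists>c>0. \<forall>h D :: 'a \<Rightarrow> _.
     convex_on UNIV h \<and> (\<forall>p. (h has_derivative (\<lambda>q. D p \<bullet> q)) (at p))
     \<and> (\<forall>p. norm (D p) \<le> CH * norm p powr (\<alpha> - 1) + CH \<and> h 0 \<le> CH)
     \<and> ((\<forall>p. h p \<ge> norm p powr \<alpha> / CH - CH)
      \<or> (\<forall>p. D p \<bullet> p \<ge> norm p powr \<alpha> / CH - CH \<and> h p \<ge> - CH)
      \<or> (\<forall>p. - h p + D p \<bullet> p \<ge> norm p powr \<alpha> / CH - CH \<and> h p \<ge> - CH)) \<longrightarrow>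
     (\<forall>p. M (h p) \<le> K * (1 + norm p) powr (\<alpha> / \<beta>)
        \<and> norm (M (h p) *\<^sub>R D p) \<le> K * (1 + norm p) powr (\<alpha> / \<beta> + \<alpha> - 1)
        \<and> E (h p) \<le> K * (1 + norm p) powr (\<alpha> / \<beta> + \<alpha>)
        \<and> c * norm p powr (\<alpha> / \<beta> + \<alpha>) - K \<le> E (h p)
        \<and> (\<forall>q. E (h q) \<ge> E (h p) + (M (h p) *\<^sub>R D p) \<bullet> (q - p)))"
    by (rule composed_integrand_bounds[OF exps(2,1) CH(1) M(1) M(5) _ M(6) _ E(1-3)]) (use Cg in auto)
  then obtain K c where K: "K > 0" and c: "c > 0" and bounds: "\<And>h D :: 'a \<Rightarrow> _.
     convex_on UNIV h \<and> (\<forall>p. (h has_derivative (\<lambda>q. D p \<bullet> q)) (at p))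
     \<and> (\<forall>p. norm (D p) \<le> CH * norm p powr (\<alpha> - 1) + CH \<and> h 0 \<le> CH)
     \<and> ((\<forall>p. h p \<ge> norm p powr \<alpha> / CH - CH)
      \<or> (\<forall>p. D p \<bullet> p \<ge> norm p powr \<alpha> / CH - CH \<and> h p \<ge> - CH)
      \<or> (\<forall>p. - h p + D p \<bullet> p \<ge> norm p powr \<alpha> / CH - CH \<and> h p \<ge> - CH)) \<Longrightarrow>
     (\<forall>p. M (h p) \<le> K * (1 + norm p) powr (\<alpha> / \<beta>)
        \<and> norm (M (h p) *\<^sub>R D p) \<le> K * (1 + norm p) powr (\<gamma> - 1)
        \<and> E (h p) \<le> K * (1 + norm p) powr \<gamma>
        \<and> c * norm p powr \<gamma> - K \<le> E (h p)
        \<and> (\<forall>q. E (h q) \<ge> E (h p) + (M (h p) *\<^sub>R D p) \<bullet> (q - p)))"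
    unfolding \<gamma>eq by blast
  define F where "F x P = E (H x P)" for x P
  define DF where "DF x P = M (H x P) *\<^sub>R DpH x P" for x P
  \<comment> \<open>The equation
    \<open>\<epsilon> powr \<gamma>' * h powr (\<gamma>' - 1) = t\<close> with t >= 0 has the
    solution \<open>h = cB * t powr (\<gamma> - 1)\<close>, because (\<gamma> - 1)(\<gamma>' - 1) =
    1.\<close>
  define cB where "cB = (1 / \<epsilon> powr \<gamma>') powr (\<gamma> - 1)"
  have AEb: "AE x in lebesgue_on \<Omega>. \<forall>P. M (H x P) \<le> K * (1 + norm P) powr (\<alpha> / \<beta>)
        \<and> norm (DF x P) \<le> K * (1 + norm P) powr (\<gamma> - 1)
        \<and> F x P \<le> K * (1 + norm P) powr \<gamma>
        \<and> c * norm P powr \<gamma> - K \<le> F x P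
        \<and> (\<forall>q. F x q \<ge> F x P + DF x P \<bullet> (q - P))"
    using HC1 CH(2) cases
  proof eventually_elim
    case (elim x)
    show ?case unfolding F_def DF_def by (rule bounds) (use elim in blast)
  qed
  have contH: "AE x in lebesgue_on \<Omega>. continuous_on UNIV (H x)"
    using HC1
  proof eventually_elim
    case (elim x)
    then show ?case by (auto simp: continuous_on_eq_continuous_at intro!: has_derivative_continuous)
  qed
  have Hm: "(\<lambda>x. H x (u x)) \<in> borel_measurable (lebesgue_on \<Omega>)" if "u \<in> borel_measurable (lebesgue_on \<Omega>)" for u
    by (rule Caratheodory_measurable[OF fr(2) _ contH that]) (use Hmeas in blast)
  have Dm: "(\<lambda>x. DpH x (u x)) \<in> borel_measurable (lebesgue_on \<Omega>)" if "u \<in> borel_measurable (lebesgue_on \<Omega>)" for u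
  proof (rule Caratheodory_measurable[OF fr(2) _ _ that])
    show "(\<lambda>x. DpH x P) \<in> borel_measurable (lebesgue_on \<Omega>)" for P
    proof (rule gradient_measurable[OF fr(2)])
      show "AE x in lebesgue_on \<Omega>. (H x has_derivative (\<lambda>q. DpH x P \<bullet> q)) (at P)"
        using HC1 by eventually_elim blast
    qed (use Hmeas in blast)
    show "AE x in lebesgue_on \<Omega>. continuous_on UNIV (DpH x)" using HC1 by eventually_elim blast
  qed
  have MB[measurable]: "M \<in> borel_measurable borel" using M(3) by (rule borel_measurable_continuous_onI)
  have EB[measurable]: "E \<in> borel_measurable borel" using E(4) by (rule borel_measurable_mono)
  have Mm: "(\<lambda>x. M (H x (u x))) \<in> borel_measurable (lebesgue_on \<Omega>)" if "u \<in> borel_measurable (lebesgue_on \<Omega>)" for u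
    using measurable_compose[OF Hm[OF that] MB] .
  interpret convex_boundary_problem \<Omega> \<Gamma>D \<Gamma>N \<gamma> \<gamma>' c K cB j F DF
  proof
    show "(\<lambda>x. F x (u x)) \<in> borel_measurable (lebesgue_on \<Omega>)" if "u \<in> borel_measurable (lebesgue_on \<Omega>)" for u
      unfolding F_def using measurable_compose[OF Hm[OF that] EB] .
    show "(\<lambda>x. DF x (u x)) \<in> borel_measurable (lebesgue_on \<Omega>)" if "u \<in> borel_measurable (lebesgue_on \<Omega>)" for u
      unfolding DF_def using Mm[OF that] Dm[OF that] by measurable
    show "AE x in lebesgue_on \<Omega>. continuous_on UNIV (DF x)"
      using HC1 contH unfolding DF_def
      by eventually_elim (auto intro!: continuous_intros continuous_on_compose2[OF M(3)])
    show "AE x in lebesgue_on \<Omega>. \<forall>P. norm (DF x P) \<le> K * (1 + norm P) powr (\<gamma> - 1)"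
      using AEb by eventually_elim blast
    show "AE x in lebesgue_on \<Omega>. \<forall>P. \<bar>F x P\<bar> \<le> K * (1 + norm P) powr \<gamma>"
      using AEb by eventually_elim (use E(1) in \<open>simp add: F_def\<close>)
    show "AE x in lebesgue_on \<Omega>. \<forall>P. c * norm P powr \<gamma> - K \<le> F x P"
      using AEb by eventually_elim blast
    show "AE x in lebesgue_on \<Omega>. \<forall>P Q. F x P + DF x P \<bullet> (Q - P) \<le> F x Q"
      using AEb by eventually_elim blast
    show "0 < cB" using eps by (simp add: cB_def)
  qed (use dom \<Omega>ne \<gamma> exps GD GN openin_borel jass c K in auto)
  obtain u Du tu where u: "W1p \<Omega> \<gamma> u Du" "has_trace \<Omega> \<gamma> u Du tu" "Lp_mem (surf (frontier \<Omega>)) \<gamma> tu"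
    "\<And>\<psi>. test_fn UNIV \<psi> \<Longrightarrow> DJ Du tu (grad \<psi>) \<psi> = 0"
    by (rule minimizer_exists) (rule that)
  have LDu: "Lp_mem (lebesgue_on \<Omega>) \<gamma> Du" using u(1) by (simp add: W1p_def)
  define m where "m x = M (H x (Du x))" for x
  define h where "h x = DB (tu x)" for x
  have Lm: "Lp_mem (lebesgue_on \<Omega>) (\<beta> + 1) m"
    unfolding Lp_mem_def
  proof
    show mm: "m \<in> borel_measurable (lebesgue_on \<Omega>)" unfolding m_def using Mm[OF Lp_memD(1)[OF LDu]] .
    show "integrable (lebesgue_on \<Omega>) (\<lambda>x. norm (m x) powr (\<beta> + 1))"
    proof (rule Bochner_Integration.integrable_bound)
      show "integrable (lebesgue_on \<Omega>) (\<lambda>x. K powr (\<beta> + 1) * (1 + norm (Du x)) powr \<gamma>)"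
        using Lp_integrable_one_plus[OF fin\<Omega> LDu] by simp
      show "AE x in lebesgue_on \<Omega>. norm (norm (m x) powr (\<beta> + 1)) \<le> norm (K powr (\<beta> + 1) * (1 + norm (Du x)) powr \<gamma>)"
        using AEb
      proof eventually_elim
        case (elim x)
        \<comment> \<open>Since (\<alpha>/\<beta>)(\<beta> + 1) = \<gamma>, the growth of M turns
          \<gamma>-integrability of Du into exactly the integrability required of m.\<close>
        have "norm (m x) powr (\<beta> + 1) \<le> (K * (1 + norm (Du x)) powr (\<alpha> / \<beta>)) powr (\<beta> + 1)"
          using elim M(1) exps(2) by (intro powr_mono2) (auto simp: m_def)
        also have "\<dots> = K powr (\<beta> + 1) * (1 + norm (Du x)) powr (\<alpha> / \<beta> * (\<beta> + 1))"
          by (simp only: powr_mult powr_powr)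
        also have "\<alpha> / \<beta> * (\<beta> + 1) = \<gamma>" using exps(2) by (simp add: \<gamma>eq field_simps)
        finally show ?case by (simp add: abs_mult)
      qed
      show "(\<lambda>x. norm (m x) powr (\<beta> + 1)) \<in> borel_measurable (lebesgue_on \<Omega>)" using mm by measurable
    qed
  qed
  have Lh: "Lp_mem (surf \<Gamma>D) \<gamma>' h"
    unfolding h_def[abs_def] by (rule DB_Lp[OF Lp_mem_surf_subset[OF \<Gamma>D(1) bor(1) \<Gamma>D(2) u(3)]])
  have h0: "h x \<ge> 0" for x using cB by (simp add: h_def DB_def)
  have Xp: "Xplus \<Omega> \<Gamma>D \<beta> \<alpha> m u Du tu h"
    unfolding Xplus_def Let_def exps(3)[symmetric] exps(4)[symmetric]
    using Lm u(1,2) Lh M(1) h0 by (simp add: m_def)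
  have hpow: "\<epsilon> powr \<gamma>' * h x powr (\<gamma>' - 1) = max 0 (tu x)" for x
  proof -
    have "h x = cB * max 0 (tu x) powr (\<gamma> - 1)" by (simp only: h_def DB_def)
    also have "\<dots> = (1 / \<epsilon> powr \<gamma>' * max 0 (tu x)) powr (\<gamma> - 1)" by (simp only: cB_def powr_mult)
    finally have "h x powr (\<gamma>' - 1) = (1 / \<epsilon> powr \<gamma>' * max 0 (tu x)) powr ((\<gamma> - 1) * (\<gamma>' - 1))"
      by (simp only: powr_powr)
    also have "(\<gamma> - 1) * (\<gamma>' - 1) = 1" using \<gamma> unfolding exps(4) by (simp add: field_simps)
    also have "(1 / \<epsilon> powr \<gamma>' * max 0 (tu x)) powr 1 = 1 / \<epsilon> powr \<gamma>' * max 0 (tu x)" using eps by simp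
    finally show ?thesis using eps by simp
  qed
  have "A_pair \<Omega> \<Gamma>D \<Gamma>N \<beta> \<alpha> H DpH g j \<epsilon> m Du tu h
                 (\<lambda>x. \<mu> x - m x) (\<lambda>x. Dv x - Du x) (\<lambda>x. tv x - tu x) (\<lambda>x. k x - h x) \<ge> 0"
    if X: "Xplus \<Omega> \<Gamma>D \<beta> \<alpha> \<mu> v Dv tv k" for \<mu> v Dv tv k
  proof -
    have v: "AE x in lebesgue_on \<Omega>. \<mu> x \<ge> 0" "Lp_mem (lebesgue_on \<Omega>) \<gamma> Dv" "has_trace \<Omega> \<gamma> v Dv tv" "AE x in surf \<Gamma>D. k x \<ge> 0"
      using X unfolding Xplus_def Let_def exps(3)[symmetric] exps(4)[symmetric] W1p_def by auto
    \<comment> \<open>Pointwise complementarity: either g(m) = H and the first factor vanishes, or m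
      = 0 and g(0) - H >= 0 is multiplied by \<mu> >= 0.\<close>
    have 1: "(\<integral>x. (- H x (Du x) + g (m x)) * (\<mu> x - m x) \<partial>lebesgue_on \<Omega>) \<ge> 0"
    proof (rule integral_nonneg_AE)
      show "AE x in lebesgue_on \<Omega>. 0 \<le> (- H x (Du x) + g (m x)) * (\<mu> x - m x)"
        using v(1)
      proof eventually_elim
        case (elim x)
        show ?case
        proof (cases "H x (Du x) \<le> g 0")
          case True
          then show ?thesis using elim Mz[OF True] by (simp add: m_def)
        next
          case False
          then show ?thesis using M(2) by (simp add: m_def)
        qed
      qed
    qed
    \<comment> \<open>By \<open>hpow\<close> the first factor is the negative part of tu; where it
      is nonzero, h = 0 and it is multiplied by k >= 0.\<close>
    have 2: "(\<integral>x. (- tu x + \<epsilon> powr \<gamma>' * h x powr (\<gamma>' - 1)) * (k x - h x) \<partial>surf \<Gamma>D) \<ge> 0"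
    proof (rule integral_nonneg_AE)
      show "AE x in surf \<Gamma>D. 0 \<le> (- tu x + \<epsilon> powr \<gamma>' * h x powr (\<gamma>' - 1)) * (k x - h x)"
        using v(4)
      proof eventually_elim
        case (elim x)
        show ?case unfolding hpow
        proof (cases "tu x \<ge> 0")
          case False
          then have "h x = 0" by (simp add: h_def DB_def)
          then show "0 \<le> (- tu x + max 0 (tu x)) * (k x - h x)" using False elim by (simp add: mult_nonpos_nonneg)
        qed simp
      qed
    qed
    \<comment> \<open>With m and h inserted, DJ is the sum of the three remaining terms of the
      pairing; it vanishes in the direction of v as well as of u.\<close>
    have "DJ Du tu (\<lambda>x. Dv x - Du x) (\<lambda>x. tv x - tu x) = DJ Du tu Dv tv - DJ Du tu Du tu"
      by (rule DJ_diff[OF LDu u(3) v(2) trace_Lp[OF v(3)] LDu u(3)])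
    also have "\<dots> = 0"
      using DJ_zero_extend[OF LDu u(3,4) v(2,3)] DJ_zero_extend[OF LDu u(3,4) LDu u(2)] by simp
    finally have 3: "(\<integral>x. m x * (DpH x (Du x) \<bullet> (Dv x - Du x)) \<partial>lebesgue_on \<Omega>) - (\<integral>x. j x * (tv x - tu x) \<partial>surf \<Gamma>N) + (\<integral>x. h x * (tv x - tu x) \<partial>surf \<Gamma>D) = 0"
      by (simp add: DJ_def DF_def m_def h_def)
    show ?thesis
      unfolding A_pair_def Let_def exps(3)[symmetric] exps(4)[symmetric] using 1 2 3 by linarith
  qed
  with Xp show ?thesis by blast
qed

end
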